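(* Let $f\in W^{-1,2}(\Omega)$ and, for $\eta>0$, let $u_\eta\in W^{1,2}_0(\Omega)$ be the solution of $$-\mathrm{div}\Big(\sigma\Big(\frac{\mathbf R\boldsymbol x}{\eta}\Big)\mathrm{grad}\,u_\eta(\boldsymbol x)\Big)=f(\boldsymbol x),\quad \boldsymbol x\in\Omega,\qquad u_\eta|_{\partial\Omega}=0.$$ Then, as $\eta\to0$, the sequence $\{u_\eta\}$ converges weakly in $W^{1,2}_0(\Omega)$ to the solution $u$ of the homogenized equation $$-\mathrm{div}\,\big(\sigma^h\nabla u(\boldsymbol x)\big)=f(\boldsymbol x),\quad\boldsymbol x\in\Omega,\qquad u|_{\partial\Omega}=0,$$ where $$\sigma^h_{ik}=\int_{Y^m}\sigma_{ij}(\boldsymbol y)\big(\delta_{jk}-(\mathbf R^T_j\nabla_{\boldsymbol y})\chi^k(\boldsymbol y)\big)\,d\boldsymbol y$$ and, for each $k$, $\big((\mathbf R^T_j\nabla_{\boldsymbol y})\chi^k\big)_{j=1,2,3}\in L^2(Y^m;\mathbb{R}^3)$ solves the local equation $$\int_{Y^m}\sigma_{ij}(\boldsymbol y)\big(\delta_{jk}-(\mathbf R^T_j\nabla_{\boldsymbol y})\chi^k(\boldsymbol y)\big)(\mathbf R^T_i\nabla_{\boldsymbol y})\phi(\boldsymbol y)\,d\boldsymbol y=0\quad\text{for all }\phi\in W^{1,2}_\sharp(Y^m),$$ supplied with periodic boundary conditions.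
   Context: $\Omega\subset\mathbb{R}^3$ is a bounded domain with Lipschitz boundary. $\mathbf R$ is a real matrix with $m$ rows and $3$ columns, $m>3$, satisfying $\mathbf R^T\boldsymbol k\neq\boldsymbol 0$ for all $\boldsymbol k\in\mathbb{Z}^m\setminus\{\boldsymbol 0\}$. $Y^m=]0,1[^m$; $\sharp$ denotes $Y^m$-periodicity. The conductivity $\sigma$ is $Y^m$-periodic, bounded ($\sigma\in L^\infty_\sharp(Y^m;\mathbb{R}^{3\times3})$, and $\sigma_\eta(\boldsymbol x)=\sigma(\mathbf R\boldsymbol x/\eta)$ is in $L^\infty(\Omega;\mathbb{R}^{3\times3})$), and coercive: there is a constant $c>0$ such that $\sigma\xi\cdot\xi\ge c|\xi|^2$ a.e. for all $\xi\in\mathbb{R}^3$ (for $\sigma$ and for $\sigma_\eta$). Consequently the solutions $u_\eta$ are uniformly bounded in $W^{1,2}_0(\Omega)$ with respect to $\eta$. $\mathbf R_j^T$ is the $j$-th row of $\mathbf R^T$, so $(\mathbf R^T_j\nabla_{\boldsymbol y})\chi=\sum_{l=1}^m\mathbf R_{lj}\,\partial\chi/\partial y_l$ is the $j$-th component of $\nabla_{\mathbf R}\chi=(\mathbf R^T\nabla_{\boldsymbol y})\chi$. An element of $L^2_\sharp(Y^m;\mathbb{R}^3)$ is written $\nabla_{\mathbf R}\chi$ if its Fourier coefficients are $2\pi i\,\mathbf R^T\boldsymbol k\,\chi_{\boldsymbol k}$, $\boldsymbol k\in\mathbb{Z}^m$, for some complex scalars $\chi_{\boldsymbol k}$; the potential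 $\chi$ itself need not be in $L^2(Y^m)$. Summation over repeated indices $i,j\in\{1,2,3\}$ is understood ($i$ is free in the formula for $\sigma^h_{ik}$).
   Formalization: Added hypothesis: σ is approximable by continuous periodic functions in mean square on Y^m and, for small η, σ_η along the cut in Ω. Without such a link it fails: σ=2I on the null set R(ℝ³)+ℤ^m, σ=I elsewhere gives σ^h=I but σ_η=2I. *)

theory Defs
  imports "HOL-Analysis.Analysis"
begin

section \<open>Test functions\<close>

definition grad :: "(real^'n \<Rightarrow> real) \<Rightarrow> real^'n \<Rightarrow> real^'n" where
  "grad \<phi> x = (\<chi> i. frechet_derivative \<phi> (at x) (axis i 1))"

primrec C_k :: "nat \<Rightarrow> (real^'n \<Rightarrow> real) \<Rightarrow> bool" where
  "C_k 0 \<phi> \<longleftrightarrow> continuous_on UNIV \<phi>"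
| "C_k (Suc n) \<phi> \<longleftrightarrow> (\<forall>x. \<phi> differentiable (at x)) \<and> (\<forall>i. C_k n (\<lambda>x. grad \<phi> x $ i))"

definition test_function :: "(real^'n) set \<Rightarrow> (real^'n \<Rightarrow> real) \<Rightarrow> bool" where
  "test_function U \<phi> \<longleftrightarrow>
     (\<forall>n. C_k n \<phi>) \<and> compact (closure {x. \<phi> x \<noteq> 0}) \<and> closure {x. \<phi> x \<noteq> 0} \<subseteq> U"

section \<open>Lebesgue and Sobolev spaces\<close>

text \<open>Elements of function spaces are represented by functions on the whole ambient space; only
  their values on the set in question matter, up to Lebesgue null sets.\<close>

definition L_inf :: "(real^'n) set \<Rightarrow> (real^'n \<Rightarrow> 'b::euclidean_space) \<Rightarrow> bool" where
  "L_inf S f \<longleftrightarrow> f \<in> borel_measurable (lebesgue_on S) \<and> (\<exists>M. AE x in lebesgue_on S. norm (f x) \<le> M)"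

definition L_two :: "(real^'n) set \<Rightarrow> (real^'n \<Rightarrow> 'b::euclidean_space) \<Rightarrow> bool" where
  "L_two S f \<longleftrightarrow>
     f \<in> borel_measurable (lebesgue_on S) \<and> integrable (lebesgue_on S) (\<lambda>x. (norm (f x))\<^sup>2)"

definition L_two_norm :: "(real^'n) set \<Rightarrow> (real^'n \<Rightarrow> 'b::euclidean_space) \<Rightarrow> real" where
  "L_two_norm S f = sqrt (LINT x|lebesgue_on S. (norm (f x))\<^sup>2)"

definition has_weak_grad ::
  "(real^'n) set \<Rightarrow> (real^'n \<Rightarrow> real) \<Rightarrow> (real^'n \<Rightarrow> real^'n) \<Rightarrow> bool" where
  "has_weak_grad U u g \<longleftrightarrow> L_two U u \<and> L_two U g \<and>
     (\<forall>\<phi> i. test_function U \<phi> \<longrightarrow>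
        (LINT x|lebesgue_on U. u x * grad \<phi> x $ i) = - (LINT x|lebesgue_on U. g x $ i * \<phi> x))"

definition W12 :: "(real^'n) set \<Rightarrow> (real^'n \<Rightarrow> real) \<Rightarrow> bool" where
  "W12 U u \<longleftrightarrow> (\<exists>g. has_weak_grad U u g)"

text \<open>For open \<open>U\<close> the weak gradient is unique up to null sets, and it enters below only
  through integrals over \<open>U\<close>, so the choice of representative is immaterial.\<close>

definition weak_grad :: "(real^'n) set \<Rightarrow> (real^'n \<Rightarrow> real) \<Rightarrow> real^'n \<Rightarrow> real^'n" where
  "weak_grad U u = (SOME g. has_weak_grad U u g)"

definition W12_norm :: "(real^'n) set \<Rightarrow> (real^'n \<Rightarrow> real) \<Rightarrow> real" where
  "W12_norm U u = sqrt ((L_two_norm U u)\<^sup>2 + (L_two_norm U (weak_grad U u))\<^sup>2)"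

definition W12_0 :: "(real^'n) set \<Rightarrow> (real^'n \<Rightarrow> real) \<Rightarrow> bool" where
  "W12_0 U u \<longleftrightarrow> W12 U u \<and>
     (\<exists>\<phi>. (\<forall>n::nat. test_function U (\<phi> n)) \<and> (\<lambda>n. W12_norm U (\<lambda>x. u x - \<phi> n x)) \<longlonglongrightarrow> 0)"

text \<open>\<open>W\<^sup>-\<^sup>1\<^sup>,\<^sup>2(U)\<close> is the space of bounded linear functionals on \<open>W\<^sub>0\<^sup>1\<^sup>,\<^sup>2(U)\<close>. Boundedness
  forces a functional to respect equality almost everywhere.\<close>

definition W12_dual :: "(real^'n) set \<Rightarrow> ((real^'n \<Rightarrow> real) \<Rightarrow> real) \<Rightarrow> bool" where
  "W12_dual U F \<longleftrightarrow>
     (\<forall>u v a b. W12_0 U u \<longrightarrow> W12_0 U v \<longrightarrow> F (\<lambda>x. a * u x + b * v x) = a * F u + b * F v) \<and>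
     (\<exists>C. \<forall>u. W12_0 U u \<longrightarrow> \<bar>F u\<bar> \<le> C * W12_norm U u)"

definition weakly_converges_W12_0 ::
  "(real^'n) set \<Rightarrow> ('i \<Rightarrow> real^'n \<Rightarrow> real) \<Rightarrow> (real^'n \<Rightarrow> real) \<Rightarrow> 'i filter \<Rightarrow> bool" where
  "weakly_converges_W12_0 U u u0 A \<longleftrightarrow>
     (\<forall>\<^sub>F \<eta> in A. W12_0 U (u \<eta>)) \<and> W12_0 U u0 \<and>
     (\<forall>F. W12_dual U F \<longrightarrow> ((\<lambda>\<eta>. F (u \<eta>)) \<longlongrightarrow> F u0) A)"

text \<open>Weak formulation of \<open>- div (A grad u) = F\<close> in \<open>U\<close>, \<open>u = 0\<close> on the boundary of \<open>U\<close>.\<close>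

definition dirichlet_solution ::
  "(real^'n) set \<Rightarrow> (real^'n \<Rightarrow> real^'n^'n) \<Rightarrow> ((real^'n \<Rightarrow> real) \<Rightarrow> real) \<Rightarrow> (real^'n \<Rightarrow> real) \<Rightarrow> bool"
  where
  "dirichlet_solution U A F u \<longleftrightarrow> W12_0 U u \<and>
     (\<forall>v. W12_0 U v \<longrightarrow> (LINT x|lebesgue_on U. (A x *v weak_grad U u x) \<bullet> weak_grad U v x) = F v)"

section \<open>Bounded Lipschitz domains\<close>

text \<open>Near each boundary point, after an orthogonal change of coordinates, the domain is the
  part of a ball lying strictly above the graph of a Lipschitz function.\<close>

definition bounded_lipschitz_domain :: "(real^3) set \<Rightarrow> bool" where
  "bounded_lipschitz_domain \<Omega> \<longleftrightarrow> \<Omega> \<noteq> {} \<and> open \<Omega> \<and> connected \<Omega> \<and> bounded \<Omega> \<and>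
     (\<forall>p \<in> frontier \<Omega>. \<exists>r > 0. \<exists>(T :: real^3 \<Rightarrow> real^3) (\<gamma> :: real^2 \<Rightarrow> real) L.
        orthogonal_transformation T \<and> L-lipschitz_on UNIV \<gamma> \<and>
        \<Omega> \<inter> ball p r = {x \<in> ball p r. \<gamma> (vector [T x $ 1, T x $ 2]) < T x $ 3})"

section \<open>Periodic functions and the cut-and-projection setting\<close>

definition int_vec :: "int^'m \<Rightarrow> real^'m" where
  "int_vec k = (\<chi> i. real_of_int (k $ i))"

definition unit_cell :: "(real^'m) set" where
  "unit_cell = {y. \<forall>i. 0 < y $ i \<and> y $ i < 1}"

definition periodic :: "(real^'m \<Rightarrow> 'b) \<Rightarrow> bool" where
  "periodic f \<longleftrightarrow> (\<forall>y k. f (y + int_vec k) = f y)"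

text \<open>Periodic Sobolev functions: no jumps across the faces of the cell, i.e. the weak gradient
  exists on the whole space and not merely inside the cell.\<close>

definition W12_per :: "(real^'m \<Rightarrow> real) \<Rightarrow> bool" where
  "W12_per \<phi> \<longleftrightarrow> periodic \<phi> \<and> (\<forall>U. open U \<and> bounded U \<longrightarrow> W12 U \<phi>)"

definition fourier_coeff :: "(real^'m \<Rightarrow> real) \<Rightarrow> int^'m \<Rightarrow> complex" where
  "fourier_coeff f k =
     (LINT y|lebesgue_on unit_cell. complex_of_real (f y) * cis (- 2 * pi * (int_vec k \<bullet> y)))"

definition scaled_cut :: "real^3^'m \<Rightarrow> real \<Rightarrow> (real^'m \<Rightarrow> 'b) \<Rightarrow> real^3 \<Rightarrow> 'b" where
  "scaled_cut R \<eta> f x = f ((1 / \<eta>) *\<^sub>R (R *v x))"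

text \<open>The set of all points \<open>R x / \<eta>\<close>, even modulo integer translations, is Lebesgue null when
  \<open>m > 3\<close>, so knowing \<open>f\<close> almost everywhere says nothing about \<open>scaled_cut R \<eta> f\<close>. The following condition
  ties the two together: \<open>f\<close> is approximated by continuous periodic functions in mean square,
  over the cell and, for small \<open>\<eta>\<close>, along the cut. It is trivially true for continuous periodic
  \<open>f\<close>; bounded periodic functions with a null set of discontinuities also satisfy it if \<open>\<Omega>\<close> is
  bounded and \<open>transpose R *v int_vec k\<close> vanishes only for \<open>k = 0\<close>.\<close>

definition admissible_cut ::
  "real^3^'m \<Rightarrow> (real^3) set \<Rightarrow> (real^'m \<Rightarrow> 'b::euclidean_space) \<Rightarrow> bool" where
  "admissible_cut R \<Omega> f \<longleftrightarrow> (\<forall>\<epsilon> > 0. \<exists>p. periodic p \<and> continuous_on UNIV p \<and>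
     L_two_norm unit_cell (\<lambda>y. f y - p y) < \<epsilon> \<and>
     (\<forall>\<^sub>F \<eta> in at_right 0. L_two_norm \<Omega> (\<lambda>x. scaled_cut R \<eta> f x - scaled_cut R \<eta> p x) < \<epsilon>))"

definition coercive_on :: "(real^'n) set \<Rightarrow> real \<Rightarrow> (real^'n \<Rightarrow> real^3^3) \<Rightarrow> bool" where
  "coercive_on S c A \<longleftrightarrow> (AE x in lebesgue_on S. \<forall>\<xi>. (A x *v \<xi>) \<bullet> \<xi> \<ge> c * (norm \<xi>)\<^sup>2)"

section \<open>Local problem and homogenized matrix\<close>

text \<open>\<open>g\<close> is of the form \<open>\<nabla>\<^sub>R \<chi>\<close>; the potential exists only through its formal Fourier
  coefficients \<open>X\<close>.\<close>

definition is_R_gradient :: "real^3^'m \<Rightarrow> (real^'m \<Rightarrow> real^3) \<Rightarrow> bool" where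
  "is_R_gradient R g \<longleftrightarrow> periodic g \<and> L_two unit_cell g \<and>
     (\<exists>X. \<forall>k j. fourier_coeff (\<lambda>y. g y $ j) k =
        2 * complex_of_real pi * \<i> * complex_of_real ((transpose R *v int_vec k) $ j) * X k)"

definition local_solution ::
  "real^3^'m \<Rightarrow> (real^'m \<Rightarrow> real^3^3) \<Rightarrow> 3 \<Rightarrow> (real^'m \<Rightarrow> real^3) \<Rightarrow> bool" where
  "local_solution R \<sigma> k g \<longleftrightarrow> is_R_gradient R g \<and>
     (\<forall>\<phi>. W12_per \<phi> \<longrightarrow>
        (LINT y|lebesgue_on unit_cell. (\<Sum>i\<in>UNIV. \<Sum>j\<in>UNIV.
           \<sigma> y $ i $ j * (of_bool (j = k) - g y $ j) *
           (transpose R *v weak_grad unit_cell \<phi> y) $ i)) = 0)"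

definition homogenized ::
  "(real^'m \<Rightarrow> real^3^3) \<Rightarrow> (3 \<Rightarrow> real^'m \<Rightarrow> real^3) \<Rightarrow> real^3^3" where
  "homogenized \<sigma> g = (\<chi> i k. LINT y|lebesgue_on unit_cell.
     (\<Sum>j\<in>UNIV. \<sigma> y $ i $ j * (of_bool (j = k) - g k y $ j)))"

end

theory Submission
  imports Defs "HOL-Computational_Algebra.Polynomial"
begin

text \<open>
  The proof is Tartar's method of oscillating test functions, carried out with trigonometric
  polynomials only. Write \<open>\<sigma>\<^sub>\<eta>\<close> for the coefficient along the cut, \<open>A\<close> for the homogenized matrix and \<open>\<nabla>\<^sub>R = R\<^sup>T \<nabla>\<close>.
  A test function \<open>v\<close> is perturbed to \<open>v\<^sub>\<eta> = v + \<eta> \<Sum>\<^sub>k \<partial>\<^sub>k v \<phi>\<^sub>k (R x / \<eta>)\<close>, where \<open>\<phi>\<^sub>k\<close> is a trigonometric polynomial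
  that almost solves the adjoint local problem: \<open>\<sigma>\<^sup>T (e\<^sub>k + \<nabla>\<^sub>R \<phi>\<^sub>k)\<close> is almost orthogonal to all gradients \<open>\<nabla>\<^sub>R \<psi>\<close>.
  Such \<open>\<phi>\<^sub>k\<close> exist by an approximate form of the Lax--Milgram theorem, adapted to spaces that are not complete. Then
  \<open>f v\<^sub>\<eta> = \<integral> \<nabla>u\<^sub>\<eta> \<bullet> \<sigma>\<^sub>\<eta>\<^sup>T \<nabla>v\<^sub>\<eta>\<close>, and up to a remainder of order \<open>\<eta>\<close> the second factor is the sum of the
  adjoint fluxes \<open>\<sigma>\<^sup>T (e\<^sub>k + \<nabla>\<^sub>R \<phi>\<^sub>k)\<close>, read along the cut and weighted with \<open>\<partial>\<^sub>k v\<close>.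

  Admissibility and the Stone--Weierstrass theorem allow replacing \<open>\<sigma>\<close> by a trigonometric matrix \<open>P\<close>, both
  in the cell and along the cut. The flux becomes a trigonometric field, and since \<open>R\<^sup>T k\<close> vanishes for no
  \<open>k \<noteq> 0\<close> it splits, mode by mode, into its mean, a solenoidal part and a gradient \<open>\<nabla>\<^sub>R \<psi>\<close> (\<open>splits_trig_vector\<close>).

  \<^item> The mean is close to \<open>A\<^sup>T e\<^sub>k\<close>: pair the flux with the given solutions \<open>e\<^sub>i - g\<^sub>i\<close> of the local problem. A
    trigonometric field sees only finitely many Fourier coefficients of \<open>g\<^sub>i\<close>, which is why it does not matter that the
    potential of \<open>g\<^sub>i\<close> is not square integrable (\<open>approximate_corrector_gradient_like\<close>, \<open>homogenized_inner\<close>).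
  \<^item> The gradient part is small in mean square over the cell, by the choice of \<open>\<phi>\<^sub>k\<close>, hence also along the cut, since the
    nonconstant modes of \<open>\<bar>\<nabla>\<^sub>R \<psi>\<bar>\<^sup>2\<close> average out (\<open>small_gradient_along_cut\<close>).
  \<^item> Against the solenoidal part two integrations by parts gain a factor \<open>\<eta>\<close> (\<open>solenoidal_oscillation\<close>).

  Finally \<open>f v\<^sub>\<eta>\<close> tends to \<open>f v\<close>, because \<open>f\<close> is represented by a gradient that may be taken smooth
  (\<open>W12_dual_oscillation\<close>). Therefore \<open>\<integral> \<nabla>u\<^sub>\<eta> \<bullet> A\<^sup>T \<nabla>v\<close> tends to \<open>f v\<close>, first for test functions and then, since
  \<open>\<nabla>u\<^sub>\<eta>\<close> is bounded, for all \<open>v\<close> in \<open>W\<^sub>0\<^sup>1\<^sup>,\<^sup>2\<close> (\<open>flux_converges\<close>).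

  The same approximate correctors show that \<open>A\<close> is coercive (\<open>homogenized_coercive\<close>), so the homogenized problem
  and its adjoint are uniquely solvable (\<open>dirichlet_solution_exists\<close>). An arbitrary functional \<open>F\<close> is represented by
  the adjoint solution \<open>z\<close>: then \<open>F u\<^sub>\<eta> = \<integral> \<nabla>u\<^sub>\<eta> \<bullet> A\<^sup>T \<nabla>z\<close> tends to \<open>f z = \<integral> A \<nabla>u\<^sub>0 \<bullet> \<nabla>z = F u\<^sub>0\<close>, which is weak
  convergence.
\<close>

section \<open>Square integrable functions\<close>

text \<open>The discriminant argument behind every Cauchy--Schwarz inequality below. The leading coefficient may
  vanish, since all the quadratic forms in question are only semidefinite.\<close>

lemma discriminant_nonneg_form:
  fixes A B C :: real
  assumes "\<And>t. 0 \<le> A + 2 * t * B + t\<^sup>2 * C"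
  shows "B\<^sup>2 \<le> A * C"
proof (cases "C = 0")
  case True
  have "B = 0"
  proof (rule ccontr)
    assume "B \<noteq> 0"
    have "0 \<le> A + 2 * (- (A + 1) / (2 * B)) * B" using assms[of "- (A + 1) / (2 * B)"] True by simp
    also have "\<dots> = -1" using \<open>B \<noteq> 0\<close> by (simp add: field_simps)
    finally show False by simp
  qed
  then show ?thesis using True by simp
next
  case False
  have "0 \<le> C"
  proof (rule ccontr)
    assume "\<not> 0 \<le> C"
    then have neg: "C < 0" by simp
    define t where "t = (\<bar>A\<bar> + 2 * \<bar>B\<bar> + 1) / (- C) + 1"
    have t1: "1 \<le> t" using neg unfolding t_def by (simp add: field_simps)
    have "t * (- C) \<ge> \<bar>A\<bar> + 2 * \<bar>B\<bar> + 1" using neg unfolding t_def by (simp add: field_simps)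
    then have "t * (t * (- C)) \<ge> t * (\<bar>A\<bar> + 2 * \<bar>B\<bar> + 1)" using t1 by (intro mult_left_mono) auto
    moreover have "t * \<bar>A\<bar> \<ge> A" using mult_right_mono[OF t1, of "\<bar>A\<bar>"] by linarith
    moreover have "t * \<bar>B\<bar> \<ge> t * B" using t1 by (intro mult_left_mono) auto
    ultimately have "A + 2 * t * B + t\<^sup>2 * C \<le> - t" by (simp add: power2_eq_square algebra_simps)
    with assms[of t] t1 show False by simp
  qed
  with False have pos: "C > 0" by simp
  have "0 \<le> (A + 2 * (- B / C) * B + (- B / C)\<^sup>2 * C) * C" using assms[of "- B / C"] pos
    by (intro mult_nonneg_nonneg) auto
  also have "\<dots> = A * C - B\<^sup>2" using pos by (simp add: field_simps power2_eq_square)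
  finally show ?thesis by simp
qed

definition L_two_inner :: "(real^'n) set \<Rightarrow> (real^'n \<Rightarrow> 'b::euclidean_space) \<Rightarrow> (real^'n \<Rightarrow> 'b) \<Rightarrow> real" where
  "L_two_inner S f g = (LINT x|lebesgue_on S. f x \<bullet> g x)"

lemma L_two_measurable: "L_two S f \<Longrightarrow> f \<in> borel_measurable (lebesgue_on S)"
  by (simp add: L_two_def)

lemma L_two_integrable_inner:
  assumes "L_two S f" "L_two S g"
  shows "integrable (lebesgue_on S) (\<lambda>x. f x \<bullet> g x)"
proof (rule Bochner_Integration.integrable_bound)
  show "integrable (lebesgue_on S) (\<lambda>x. (norm (f x))\<^sup>2 + (norm (g x))\<^sup>2)"
    using assms by (auto simp: L_two_def)
  show "(\<lambda>x. f x \<bullet> g x) \<in> borel_measurable (lebesgue_on S)"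
    using assms by (intro borel_measurable_inner) (auto simp: L_two_def)
  have "norm (f x \<bullet> g x) \<le> norm ((norm (f x))\<^sup>2 + (norm (g x))\<^sup>2)" for x
  proof -
    have "\<bar>f x \<bullet> g x\<bar> \<le> norm (f x) * norm (g x)" by (rule Cauchy_Schwarz_ineq2)
    also have "\<dots> \<le> (norm (f x))\<^sup>2 + (norm (g x))\<^sup>2"
      using sum_squares_bound[of "norm (f x)" "norm (g x)"] mult_nonneg_nonneg[OF norm_ge_zero norm_ge_zero, of "f x" "g x"]
      by linarith
    finally show ?thesis by simp
  qed
  then show "AE x in lebesgue_on S. norm (f x \<bullet> g x) \<le> norm ((norm (f x))\<^sup>2 + (norm (g x))\<^sup>2)" by simp
qed

lemma L_two_bound:
  assumes "L_two S f" "h \<in> borel_measurable (lebesgue_on S)"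
    and "AE x in lebesgue_on S. norm (h x) \<le> C * norm (f x)"
  shows "L_two S h"
  unfolding L_two_def
proof
  show "integrable (lebesgue_on S) (\<lambda>x. (norm (h x))\<^sup>2)"
  proof (rule Bochner_Integration.integrable_bound)
    show "integrable (lebesgue_on S) (\<lambda>x. C\<^sup>2 * (norm (f x))\<^sup>2)" using assms by (auto simp: L_two_def)
    show "AE x in lebesgue_on S. norm ((norm (h x))\<^sup>2) \<le> norm (C\<^sup>2 * (norm (f x))\<^sup>2)"
      using assms(3)
    proof eventually_elim
      case (elim x)
      then have "(norm (h x))\<^sup>2 \<le> (C * norm (f x))\<^sup>2" by (intro power_mono) auto
      then show ?case by (simp add: power_mult_distrib)
    qed
  qed (use assms in measurable)
qed (fact assms)

lemma L_two_add:
  assumes "L_two S f" "L_two S g"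
  shows "L_two S (\<lambda>x. f x + g x)"
  unfolding L_two_def
proof
  show "(\<lambda>x. f x + g x) \<in> borel_measurable (lebesgue_on S)" using assms by (auto simp: L_two_def)
  have "integrable (lebesgue_on S) (\<lambda>x. (norm (f x))\<^sup>2 + 2 * (f x \<bullet> g x) + (norm (g x))\<^sup>2)"
    using assms L_two_integrable_inner[OF assms] by (auto simp: L_two_def)
  then show "integrable (lebesgue_on S) (\<lambda>x. (norm (f x + g x))\<^sup>2)"
    by (simp add: power2_norm_eq_inner inner_add inner_commute algebra_simps)
qed

lemma L_two_scaleR: "L_two S f \<Longrightarrow> L_two S (\<lambda>x. a *\<^sub>R f x)"
  by (rule L_two_bound[where C = "\<bar>a\<bar>" and f = f]) (auto simp: L_two_def)

lemma L_two_cmult: "L_two S f \<Longrightarrow> L_two S (\<lambda>x. a * f x :: real)"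
  using L_two_scaleR[of S f a] by simp

lemma L_two_diff: "L_two S f \<Longrightarrow> L_two S g \<Longrightarrow> L_two S (\<lambda>x. f x - g x)"
  using L_two_add[OF _ L_two_scaleR[of S g "-1"], of f] by simp

lemma L_two_zero: "L_two S (\<lambda>x. 0)"
  by (simp add: L_two_def)

lemma L_two_sum: "finite I \<Longrightarrow> (\<And>i. i \<in> I \<Longrightarrow> L_two S (f i)) \<Longrightarrow> L_two S (\<lambda>x. \<Sum>i\<in>I. f i x)"
  by (induction rule: finite_induct) (auto simp: L_two_zero intro!: L_two_add)

lemma L_two_norm_nonneg: "0 \<le> L_two_norm S f"
  by (simp add: L_two_norm_def)

lemma L_two_norm_power2: "(L_two_norm S f)\<^sup>2 = L_two_inner S f f"
  by (simp add: L_two_norm_def L_two_inner_def power2_norm_eq_inner)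

lemma L_two_inner_commute: "L_two_inner S f g = L_two_inner S g f"
  by (simp add: L_two_inner_def inner_commute)

lemma L_two_inner_add_left:
  assumes "L_two S f" "L_two S g" "L_two S h"
  shows "L_two_inner S (\<lambda>x. f x + g x) h = L_two_inner S f h + L_two_inner S g h"
  using assms by (simp add: L_two_inner_def inner_add_left L_two_integrable_inner)

lemma L_two_inner_add_right:
  assumes "L_two S f" "L_two S g" "L_two S h"
  shows "L_two_inner S h (\<lambda>x. f x + g x) = L_two_inner S h f + L_two_inner S h g"
  using L_two_inner_add_left[OF assms] by (simp add: L_two_inner_commute)

lemma L_two_inner_scaleR_left: "L_two_inner S (\<lambda>x. a *\<^sub>R f x) h = a * L_two_inner S f h"
  by (simp add: L_two_inner_def)

lemma L_two_inner_scaleR_right: "L_two_inner S h (\<lambda>x. a *\<^sub>R f x) = a * L_two_inner S h f"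
  by (simp add: L_two_inner_def)

lemma L_two_inner_diff_left:
  assumes "L_two S f" "L_two S g" "L_two S h"
  shows "L_two_inner S (\<lambda>x. f x - g x) h = L_two_inner S f h - L_two_inner S g h"
  using assms by (simp add: L_two_inner_def inner_diff_left L_two_integrable_inner)

lemma L_two_inner_diff_right:
  assumes "L_two S f" "L_two S g" "L_two S h"
  shows "L_two_inner S h (\<lambda>x. f x - g x) = L_two_inner S h f - L_two_inner S h g"
  using L_two_inner_diff_left[OF assms] by (simp add: L_two_inner_commute)

lemma L_two_inner_sum_right:
  assumes "finite I" "\<And>i. i \<in> I \<Longrightarrow> L_two S (f i)" "L_two S h"
  shows "L_two_inner S h (\<lambda>x. \<Sum>i\<in>I. f i x) = (\<Sum>i\<in>I. L_two_inner S h (f i))"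
  using assms by (simp add: L_two_inner_def inner_sum_right L_two_integrable_inner)

lemma L_two_inner_cong_AE:
  assumes "AE x in lebesgue_on S. f x = f' x" "AE x in lebesgue_on S. g x = g' x"
    "f \<in> borel_measurable (lebesgue_on S)" "f' \<in> borel_measurable (lebesgue_on S)"
    "g \<in> borel_measurable (lebesgue_on S)" "g' \<in> borel_measurable (lebesgue_on S)"
  shows "L_two_inner S f g = L_two_inner S f' g'"
  unfolding L_two_inner_def
proof (rule integral_cong_AE)
  show "AE x in lebesgue_on S. f x \<bullet> g x = f' x \<bullet> g' x"
    using assms(1,2) by eventually_elim simp
qed (use assms in measurable)

lemma L_two_norm_cong_AE:
  assumes "AE x in lebesgue_on S. f x = f' x"
    "f \<in> borel_measurable (lebesgue_on S)" "f' \<in> borel_measurable (lebesgue_on S)"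
  shows "L_two_norm S f = L_two_norm S f'"
  using L_two_inner_cong_AE[OF assms(1) assms(1) assms(2,3) assms(2,3)]
  by (metis L_two_norm_power2 L_two_norm_nonneg power2_eq_iff_nonneg)

lemma L_two_inner_le:
  assumes "L_two S f" "L_two S g"
  shows "\<bar>L_two_inner S f g\<bar> \<le> L_two_norm S f * L_two_norm S g"
proof -
  have "0 \<le> L_two_inner S f f + 2 * t * L_two_inner S f g + t\<^sup>2 * L_two_inner S g g" for t
  proof -
    have "0 \<le> L_two_inner S (\<lambda>x. f x + t *\<^sub>R g x) (\<lambda>x. f x + t *\<^sub>R g x)"
      by (simp add: L_two_inner_def)
    also have "\<dots> = L_two_inner S f f + 2 * t * L_two_inner S f g + t\<^sup>2 * L_two_inner S g g"
      using assms by (simp add: L_two_inner_add_left L_two_inner_add_right L_two_add L_two_scaleR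
          L_two_inner_scaleR_left L_two_inner_scaleR_right L_two_inner_commute[of S g f]
          power2_eq_square algebra_simps)
    finally show ?thesis .
  qed
  then have "(L_two_inner S f g)\<^sup>2 \<le> (L_two_norm S f * L_two_norm S g)\<^sup>2"
    by (simp add: discriminant_nonneg_form power_mult_distrib L_two_norm_power2)
  then show ?thesis
    using abs_le_square_iff[of "L_two_inner S f g" "L_two_norm S f * L_two_norm S g"]
    by (simp add: L_two_norm_nonneg)
qed

lemma L_two_norm_mono:
  assumes "L_two S f" "h \<in> borel_measurable (lebesgue_on S)" "0 \<le> C"
    and "AE x in lebesgue_on S. norm (h x) \<le> C * norm (f x)"
  shows "L_two_norm S h \<le> C * L_two_norm S f"
proof -
  have h: "L_two S h" using L_two_bound assms by blast
  have "(LINT x|lebesgue_on S. (norm (h x))\<^sup>2) \<le> (LINT x|lebesgue_on S. C\<^sup>2 * (norm (f x))\<^sup>2)"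
  proof (rule integral_mono_AE)
    show "AE x in lebesgue_on S. (norm (h x))\<^sup>2 \<le> C\<^sup>2 * (norm (f x))\<^sup>2"
      using assms(4) by eventually_elim (metis norm_ge_zero power_mono power_mult_distrib)
  qed (use h assms in \<open>auto simp: L_two_def\<close>)
  then have "L_two_norm S h \<le> sqrt (C\<^sup>2 * (LINT x|lebesgue_on S. (norm (f x))\<^sup>2))"
    unfolding L_two_norm_def by (simp add: real_sqrt_le_mono)
  also have "\<dots> = C * L_two_norm S f" using assms(3) by (simp add: real_sqrt_mult L_two_norm_def)
  finally show ?thesis .
qed

lemma L_two_norm_scaleR: "L_two_norm S (\<lambda>x. a *\<^sub>R f x) = \<bar>a\<bar> * L_two_norm S f"
  by (simp add: L_two_norm_def power_mult_distrib real_sqrt_mult)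

lemma L_two_norm_minus_commute: "L_two_norm S (\<lambda>x. f x - g x) = L_two_norm S (\<lambda>x. g x - f x)"
  by (simp add: L_two_norm_def norm_minus_commute)

lemma L_two_norm_triangle:
  assumes "L_two S f" "L_two S g"
  shows "L_two_norm S (\<lambda>x. f x + g x) \<le> L_two_norm S f + L_two_norm S g"
proof -
  have "(L_two_norm S (\<lambda>x. f x + g x))\<^sup>2 = (L_two_norm S f)\<^sup>2 + 2 * L_two_inner S f g + (L_two_norm S g)\<^sup>2"
    using assms by (simp add: L_two_norm_power2 L_two_inner_add_left L_two_inner_add_right L_two_add
          L_two_inner_commute[of S g f])
  also have "\<dots> \<le> (L_two_norm S f + L_two_norm S g)\<^sup>2"
    using L_two_inner_le[OF assms] by (simp add: power2_sum algebra_simps abs_le_iff)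
  finally show ?thesis by (meson L_two_norm_nonneg add_nonneg_nonneg power2_le_imp_le)
qed

lemma L_two_norm_triangle3:
  assumes "L_two S f" "L_two S g" "L_two S h"
  shows "L_two_norm S (\<lambda>x. f x - h x) \<le> L_two_norm S (\<lambda>x. f x - g x) + L_two_norm S (\<lambda>x. g x - h x)"
  using L_two_norm_triangle[of S "\<lambda>x. f x - g x" "\<lambda>x. g x - h x"] assms by (simp add: L_two_diff)

lemma L_two_bounded:
  assumes "S \<in> lmeasurable" "f \<in> borel_measurable (lebesgue_on S)" "AE x in lebesgue_on S. norm (f x) \<le> C"
  shows "L_two S f"
proof -
  interpret finite_measure "lebesgue_on S" using assms(1) by (rule finite_measure_lebesgue_on)
  have "L_two S (\<lambda>x. 1::real)" by (simp add: L_two_def)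
  from L_two_bound[OF this assms(2), of C] assms(3) show ?thesis by simp
qed

lemma L_two_norm_le_bounded:
  assumes "S \<in> lmeasurable" "f \<in> borel_measurable (lebesgue_on S)" "AE x in lebesgue_on S. norm (f x) \<le> C"
    "0 \<le> C"
  shows "L_two_norm S f \<le> C * sqrt (measure lebesgue S)"
proof -
  interpret finite_measure "lebesgue_on S" using assms(1) by (rule finite_measure_lebesgue_on)
  have 1: "L_two S (\<lambda>x. 1::real)" by (simp add: L_two_def)
  have S: "S \<in> sets lebesgue" using assms(1) by (simp add: fmeasurable_def)
  have "L_two_norm S (\<lambda>x. 1::real) = sqrt (measure lebesgue S)"
    using S by (simp add: L_two_norm_def measure_restrict_space)
  with L_two_norm_mono[OF 1 assms(2), of C] assms(3,4) show ?thesis by simp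
qed

lemma L_two_norm_zero_AE:
  assumes "L_two S f" "L_two_norm S f = 0"
  shows "AE x in lebesgue_on S. f x = 0"
proof -
  have "(LINT x|lebesgue_on S. (norm (f x))\<^sup>2) = 0" using assms(2) by (simp add: L_two_norm_def)
  then have "AE x in lebesgue_on S. (norm (f x))\<^sup>2 = 0"
    using assms(1) by (subst (asm) integral_nonneg_eq_0_iff_AE) (auto simp: L_two_def)
  then show ?thesis by simp
qed

text \<open>On a set of finite measure the \<open>L\<^sup>2\<close> norm dominates the \<open>L\<^sup>1\<close> norm, so the telescoping series
  of a fast Cauchy sequence converges absolutely almost everywhere; Fatou's lemma turns the
  pointwise limit into a limit in mean square.\<close>

lemma nn_integral_norm_le_L_two_norm:
  assumes "S \<in> lmeasurable" "L_two S f"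
  shows "(\<integral>\<^sup>+x. norm (f x) \<partial>lebesgue_on S) \<le> ennreal (sqrt (measure lebesgue S) * L_two_norm S f)"
proof -
  interpret finite_measure "lebesgue_on S" using assms(1) by (rule finite_measure_lebesgue_on)
  have 1: "L_two S (\<lambda>x. 1::real)" by (simp add: L_two_def)
  have n: "L_two S (\<lambda>x. norm (f x))"
    by (rule L_two_bound[OF assms(2), of _ 1]) (use assms in \<open>auto simp: L_two_def\<close>)
  have S: "S \<in> sets lebesgue" using assms(1) by (simp add: fmeasurable_def)
  have i: "integrable (lebesgue_on S) (\<lambda>x. norm (f x))" using L_two_integrable_inner[OF 1 n] by simp
  have "L_two_norm S (\<lambda>x. 1::real) = sqrt (measure lebesgue S)"
    using S by (simp add: L_two_norm_def measure_restrict_space)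
  moreover have "L_two_norm S (\<lambda>x. norm (f x)) = L_two_norm S f" by (simp add: L_two_norm_def)
  ultimately have "(LINT x|lebesgue_on S. norm (f x)) \<le> sqrt (measure lebesgue S) * L_two_norm S f"
    using L_two_inner_le[OF 1 n] by (simp add: L_two_inner_def)
  then show ?thesis using i by (subst nn_integral_eq_integral) (auto intro!: ennreal_leI)
qed

text \<open>Lower semicontinuity of the norm; \<open>L_two S g\<close> is part of the conclusion because the limit arises only
  as a measurable function.\<close>

lemma L_two_norm_Fatou:
  assumes "\<And>n. L_two S (f n)" "g \<in> borel_measurable (lebesgue_on S)"
    and "AE x in lebesgue_on S. (\<lambda>n. f n x) \<longlonglongrightarrow> g x"
    and "\<And>n. n \<ge> N \<Longrightarrow> L_two_norm S (f n) \<le> e"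
  shows "L_two S g \<and> L_two_norm S g \<le> e"
proof -
  have e: "0 \<le> e" using assms(4)[of N] L_two_norm_nonneg[of S "f N"] by linarith
  have le: "(\<integral>\<^sup>+x. ennreal ((norm (f n x))\<^sup>2) \<partial>lebesgue_on S) \<le> ennreal (e\<^sup>2)" if "n \<ge> N" for n
  proof -
    have "(LINT x|lebesgue_on S. (norm (f n x))\<^sup>2) = (L_two_norm S (f n))\<^sup>2"
      by (simp add: L_two_norm_def)
    also have "\<dots> \<le> e\<^sup>2" using assms(4)[OF that] L_two_norm_nonneg by (intro power_mono)
    finally show ?thesis using assms(1)[of n] unfolding L_two_def
      by (subst nn_integral_eq_integral) (auto intro!: ennreal_leI)
  qed
  have "(\<integral>\<^sup>+x. ennreal ((norm (g x))\<^sup>2) \<partial>lebesgue_on S)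
      = (\<integral>\<^sup>+x. liminf (\<lambda>n. ennreal ((norm (f n x))\<^sup>2)) \<partial>lebesgue_on S)"
  proof (rule nn_integral_cong_AE, use assms(3) in eventually_elim)
    case (elim x)
    then have "(\<lambda>n. ennreal ((norm (f n x))\<^sup>2)) \<longlonglongrightarrow> ennreal ((norm (g x))\<^sup>2)"
      by (intro tendsto_intros tendsto_ennrealI)
    from lim_imp_Liminf[OF _ this] show ?case by simp
  qed
  also have "\<dots> \<le> liminf (\<lambda>n. \<integral>\<^sup>+x. ennreal ((norm (f n x))\<^sup>2) \<partial>lebesgue_on S)"
    by (rule nn_integral_liminf) (use assms in \<open>auto simp: L_two_def\<close>)
  also have "\<dots> \<le> liminf (\<lambda>n. ennreal (e\<^sup>2))"
    by (rule Liminf_mono) (use le in \<open>auto simp: eventually_sequentially\<close>)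
  also have "\<dots> = ennreal (e\<^sup>2)" by (simp add: Liminf_const)
  finally have b: "(\<integral>\<^sup>+x. ennreal ((norm (g x))\<^sup>2) \<partial>lebesgue_on S) \<le> ennreal (e\<^sup>2)" .
  have "integrable (lebesgue_on S) (\<lambda>x. (norm (g x))\<^sup>2)"
    by (rule integrableI_nonneg)
      (use assms(2) b in \<open>auto intro: le_less_trans\<close>)
  moreover from this b have "(LINT x|lebesgue_on S. (norm (g x))\<^sup>2) \<le> e\<^sup>2"
    by (subst (asm) nn_integral_eq_integral) auto
  then have "L_two_norm S g \<le> e" unfolding L_two_norm_def using e by (simp add: real_le_lsqrt)
  ultimately show ?thesis using assms(2) by (simp add: L_two_def)
qed

theorem L_two_complete:
  fixes f :: "nat \<Rightarrow> real^'n \<Rightarrow> 'b::euclidean_space"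
  assumes S: "S \<in> lmeasurable" and f: "\<And>n. L_two S (f n)"
    and cauchy: "\<And>e. e > 0 \<Longrightarrow> \<exists>N. \<forall>m\<ge>N. \<forall>n\<ge>N. L_two_norm S (\<lambda>x. f m x - f n x) < e"
  shows "\<exists>g. L_two S g \<and> (\<lambda>n. L_two_norm S (\<lambda>x. f n x - g x)) \<longlonglongrightarrow> 0"
proof -
  have "\<forall>k. \<exists>N. \<forall>m\<ge>N. \<forall>n\<ge>N. L_two_norm S (\<lambda>x. f m x - f n x) < (1/2)^k"
    using cauchy by simp
  then obtain N where N: "\<And>k m n. m \<ge> N k \<Longrightarrow> n \<ge> N k \<Longrightarrow> L_two_norm S (\<lambda>x. f m x - f n x) < (1/2)^k"
    by metis
  define r where "r k = (\<Sum>j\<le>k. N j)" for k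
  have rN: "r k \<ge> N k" for k unfolding r_def by (rule member_le_sum) auto
  have rmono: "r j \<le> r k" if "j \<le> k" for j k unfolding r_def using that by (intro sum_mono2) auto
  define d where "d k x = f (r (Suc k)) x - f (r k) x" for k x
  have dL: "L_two S (d k)" for k unfolding d_def by (intro L_two_diff f)
  have dn: "L_two_norm S (d k) \<le> (1/2)^k" for k
    unfolding d_def using N[of k "r (Suc k)" "r k"] rN[of k] rmono[of k "Suc k"] by (simp add: less_imp_le)
  let ?C = "sqrt (measure lebesgue S)"
  have "(\<integral>\<^sup>+x. (\<Sum>k. ennreal (norm (d k x))) \<partial>lebesgue_on S) = (\<Sum>k. \<integral>\<^sup>+x. norm (d k x) \<partial>lebesgue_on S)"
    by (rule nn_integral_suminf) (use L_two_measurable[OF dL] in measurable)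
  also have "\<dots> \<le> (\<Sum>k. ennreal (?C * (1/2)^k))"
  proof (rule suminf_le)
    fix k
    have "(\<integral>\<^sup>+x. norm (d k x) \<partial>lebesgue_on S) \<le> ennreal (?C * L_two_norm S (d k))"
      by (rule nn_integral_norm_le_L_two_norm[OF S dL])
    also have "\<dots> \<le> ennreal (?C * (1/2)^k)"
      by (intro ennreal_leI mult_left_mono dn) simp
    finally show "(\<integral>\<^sup>+x. norm (d k x) \<partial>lebesgue_on S) \<le> ennreal (?C * (1/2)^k)" .
  qed auto
  also have "\<dots> = ennreal (\<Sum>k. ?C * (1/2)^k)"
    by (rule suminf_ennreal2) (auto intro!: summable_mult summable_geometric)
  also have "\<dots> < \<infinity>" by simp
  finally have fin: "(\<integral>\<^sup>+x. (\<Sum>k. ennreal (norm (d k x))) \<partial>lebesgue_on S) \<noteq> \<infinity>" by simp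
  have "AE x in lebesgue_on S. (\<Sum>k. ennreal (norm (d k x))) \<noteq> \<infinity>"
    by (rule nn_integral_noteq_infinite[OF _ fin]) (use L_two_measurable[OF dL] in measurable)
  then have conv: "AE x in lebesgue_on S. convergent (\<lambda>k. f (r k) x)"
  proof eventually_elim
    case (elim x)
    have "summable (\<lambda>k. norm (d k x))"
      by (rule summable_suminf_not_top) (use elim in auto)
    then have "summable (\<lambda>k. d k x)" by (rule summable_norm_cancel)
    then have "convergent (\<lambda>n. \<Sum>k<n. d k x)" by (simp add: summable_iff_convergent)
    moreover have "(\<Sum>k<n. d k x) = f (r n) x - f (r 0) x" for n
      unfolding d_def by (rule sum_lessThan_telescope)
    ultimately show ?case by (simp add: convergent_diff_const_right_iff)
  qed
  define g where "g x = lim (\<lambda>k. f (r k) x)" for x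
  have gm: "g \<in> borel_measurable (lebesgue_on S)"
    unfolding g_def by (rule borel_measurable_lim_metric) (use f in \<open>auto simp: L_two_def\<close>)
  have lim: "AE x in lebesgue_on S. (\<lambda>k. f (r k) x) \<longlonglongrightarrow> g x"
    using conv by eventually_elim (simp add: g_def convergent_LIMSEQ_iff)
  have est: "L_two S (\<lambda>x. g x - f n x) \<and> L_two_norm S (\<lambda>x. g x - f n x) \<le> (1/2)^k" if "n \<ge> N k" for n k
  proof (rule L_two_norm_Fatou)
    show "L_two S (\<lambda>x. f (r j) x - f n x)" for j by (intro L_two_diff f)
    show "AE x in lebesgue_on S. (\<lambda>j. f (r j) x - f n x) \<longlonglongrightarrow> g x - f n x"
      using lim by eventually_elim (auto intro: tendsto_intros)
    show "L_two_norm S (\<lambda>x. f (r j) x - f n x) \<le> (1/2)^k" if "j \<ge> k" for j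
      using N[of k "r j" n] rN[of k] rmono[OF that] \<open>n \<ge> N k\<close> by (simp add: less_imp_le)
    show "(\<lambda>x. g x - f n x) \<in> borel_measurable (lebesgue_on S)"
      using gm L_two_measurable[OF f[of n]] by measurable
  qed
  have "L_two S (\<lambda>x. (g x - f (N 0) x) + f (N 0) x)" using est[of 0] f by (intro L_two_add) auto
  then have "L_two S g" by simp
  moreover have "(\<lambda>n. L_two_norm S (\<lambda>x. f n x - g x)) \<longlonglongrightarrow> 0"
  proof (rule LIMSEQ_I)
    fix e :: real assume "0 < e"
    then obtain k where k: "(1/2)^k < e" using real_arch_pow_inv[of e "1/2"] by auto
    have "norm (L_two_norm S (\<lambda>x. f n x - g x) - 0) < e" if "n \<ge> N k" for n
      using est[OF that] k L_two_norm_nonneg[of S "\<lambda>x. f n x - g x"]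
      by (simp add: L_two_norm_minus_commute[of S "f n" g])
    then show "\<exists>no. \<forall>n\<ge>no. norm (L_two_norm S (\<lambda>x. f n x - g x) - 0) < e" by blast
  qed
  ultimately show ?thesis by blast
qed

section \<open>Smooth functions and test functions\<close>

abbreviation smooth :: "(real^'n \<Rightarrow> real) \<Rightarrow> bool" where
  "smooth \<phi> \<equiv> \<forall>n. C_k n \<phi>"

lemma grad_eqI:
  assumes "(f has_derivative (\<lambda>h. v \<bullet> h)) (at x)"
  shows "grad f x = v"
  using frechet_derivative_at[OF assms, symmetric] by (simp add: grad_def vec_eq_iff inner_axis)

lemma has_derivative_grad:
  assumes "f differentiable (at x)"
  shows "(f has_derivative (\<lambda>h. grad f x \<bullet> h)) (at x)"
proof -
  have d: "(f has_derivative frechet_derivative f (at x)) (at x)"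
    using assms frechet_derivative_works by blast
  then have lin: "linear (frechet_derivative f (at x))" by (rule has_derivative_linear)
  have "frechet_derivative f (at x) h = grad f x \<bullet> h" for h
  proof -
    have "frechet_derivative f (at x) h = frechet_derivative f (at x) (\<Sum>i\<in>UNIV. h $ i *\<^sub>R axis i 1)"
      using basis_expansion[of h] by (simp add: scalar_mult_eq_scaleR)
    also have "\<dots> = (\<Sum>i\<in>UNIV. h $ i * frechet_derivative f (at x) (axis i 1))"
      using lin by (simp add: linear_sum linear_scale)
    also have "\<dots> = grad f x \<bullet> h" by (simp add: inner_vec_def grad_def mult.commute)
    finally show ?thesis .
  qed
  then have "frechet_derivative f (at x) = (\<lambda>h. grad f x \<bullet> h)" by auto
  with d show ?thesis by simp
qed

lemma C_k_Suc_imp: "C_k (Suc n) \<phi> \<Longrightarrow> C_k n \<phi>"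
proof (induction n arbitrary: \<phi>)
  case 0
  then show ?case
    by (auto intro!: continuous_at_imp_continuous_on differentiable_imp_continuous_within)
next
  case (Suc n)
  then show ?case by (metis C_k.simps(2))
qed

lemma smooth_differentiable: "smooth \<phi> \<Longrightarrow> \<phi> differentiable (at x)"
  by (metis C_k.simps(2))

lemma smooth_has_derivative: "smooth \<phi> \<Longrightarrow> (\<phi> has_derivative (\<lambda>h. grad \<phi> x \<bullet> h)) (at x)"
  by (simp add: has_derivative_grad smooth_differentiable)

lemma smooth_continuous: "smooth \<phi> \<Longrightarrow> continuous_on S \<phi>"
  by (metis C_k.simps(1) continuous_on_subset subset_UNIV)

lemma smooth_grad: "smooth \<phi> \<Longrightarrow> smooth (\<lambda>x. grad \<phi> x $ i)"
  by (metis C_k.simps(2))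

lemma smooth_continuous_grad:
  fixes \<phi> :: "real^'n \<Rightarrow> real"
  assumes "smooth \<phi>" shows "continuous_on S (grad \<phi>)"
proof -
  have "continuous_on S (\<lambda>x. \<chi> i. grad \<phi> x $ i)"
    by (intro continuous_on_vec_lambda smooth_continuous smooth_grad assms)
  then show ?thesis by simp
qed

lemma grad_const [simp]: "grad (\<lambda>x. c) x = 0"
  by (rule grad_eqI) simp

lemma grad_add:
  assumes "f differentiable (at x)" "g differentiable (at x)"
  shows "grad (\<lambda>x. f x + g x) x = grad f x + grad g x"
  by (rule grad_eqI)
    (use has_derivative_add[OF has_derivative_grad[OF assms(1)] has_derivative_grad[OF assms(2)]] in
      \<open>simp add: inner_add_left\<close>)

lemma grad_mult:
  assumes "f differentiable (at x)" "g differentiable (at x)"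
  shows "grad (\<lambda>x. f x * g x) x = f x *\<^sub>R grad g x + g x *\<^sub>R grad f x"
  by (rule grad_eqI)
    (use has_derivative_mult[OF has_derivative_grad[OF assms(1)] has_derivative_grad[OF assms(2)]] in
      \<open>simp add: inner_add_left algebra_simps\<close>)

lemma C_k_const: "C_k n (\<lambda>x. c)"
  by (induction n arbitrary: c) auto

lemma C_k_add: "C_k n f \<Longrightarrow> C_k n g \<Longrightarrow> C_k n (\<lambda>x. f x + g x)"
proof (induction n arbitrary: f g)
  case 0 then show ?case by (auto intro: continuous_intros)
next
  case (Suc n) then show ?case by (auto simp: grad_add)
qed

lemma C_k_mult: "C_k n f \<Longrightarrow> C_k n g \<Longrightarrow> C_k n (\<lambda>x. f x * g x)"
proof (induction n arbitrary: f g)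
  case 0 then show ?case by (auto intro: continuous_intros)
next
  case (Suc n)
  have "C_k n f" "C_k n g" using Suc.prems C_k_Suc_imp by blast+
  with Suc show ?case by (auto simp: grad_mult intro!: C_k_add)
qed

lemma smooth_const: "smooth (\<lambda>x. c)" by (simp add: C_k_const)
lemma smooth_add: "smooth f \<Longrightarrow> smooth g \<Longrightarrow> smooth (\<lambda>x. f x + g x)" by (simp add: C_k_add)
lemma smooth_mult: "smooth f \<Longrightarrow> smooth g \<Longrightarrow> smooth (\<lambda>x. f x * g x)" by (simp add: C_k_mult)

lemma smooth_cmult: "smooth f \<Longrightarrow> smooth (\<lambda>x. c * f x)"
  by (intro smooth_mult smooth_const)

lemma smooth_sum: "finite I \<Longrightarrow> (\<And>i. i \<in> I \<Longrightarrow> smooth (f i)) \<Longrightarrow> smooth (\<lambda>x. \<Sum>i\<in>I. f i x)"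
  by (induction rule: finite_induct) (auto simp: C_k_const intro!: C_k_add)

lemma smooth_prod: "finite I \<Longrightarrow> (\<And>i. i \<in> I \<Longrightarrow> smooth (f i)) \<Longrightarrow> smooth (\<lambda>x. \<Prod>i\<in>I. f i x)"
  by (induction rule: finite_induct) (auto simp: C_k_const intro!: C_k_mult)

lemma grad_cmult: "smooth f \<Longrightarrow> grad (\<lambda>x. c * f x) x = c *\<^sub>R grad f x"
  by (simp add: grad_mult smooth_differentiable)

lemma grad_add_smooth: "smooth f \<Longrightarrow> smooth g \<Longrightarrow> grad (\<lambda>x. f x + g x) x = grad f x + grad g x"
  by (simp add: grad_add smooth_differentiable)

lemma grad_mult_smooth:
  "smooth f \<Longrightarrow> smooth g \<Longrightarrow> grad (\<lambda>x. f x * g x) x = f x *\<^sub>R grad g x + g x *\<^sub>R grad f x"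
  by (simp add: grad_mult smooth_differentiable)

lemma grad_sum:
  "finite I \<Longrightarrow> (\<And>i. i \<in> I \<Longrightarrow> smooth (f i)) \<Longrightarrow> grad (\<lambda>x. \<Sum>i\<in>I. f i x) x = (\<Sum>i\<in>I. grad (f i) x)"
  by (induction rule: finite_induct) (auto simp: grad_add_smooth smooth_sum)

lemma ridge_has_derivative:
  fixes a :: "'a::euclidean_space"
  assumes "(h has_real_derivative h') (at (a \<bullet> x + b))"
  shows "((\<lambda>x. h (a \<bullet> x + b)) has_derivative (\<lambda>y. (h' *\<^sub>R a) \<bullet> y)) (at x)"
proof -
  have "((\<lambda>x. a \<bullet> x + b) has_derivative (\<lambda>y. a \<bullet> y)) (at x)"
    by (auto intro!: derivative_eq_intros)
  from has_derivative_compose[OF this assms[unfolded has_field_derivative_def]]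
  show ?thesis by simp
qed

text \<open>A family of functions on the line that is closed under differentiation gives smooth plane waves: the
  induction has to carry the whole family, since each derivative moves one member along.\<close>

lemma smooth_ridge:
  fixes H :: "nat \<Rightarrow> real \<Rightarrow> real" and a :: "real^'n"
  assumes "\<And>j t. (H j has_real_derivative H (Suc j) t) (at t)"
  shows "smooth (\<lambda>x. c * H j (a \<bullet> x + b))"
proof
  fix n
  have der: "((\<lambda>x. c * H j (a \<bullet> x + b)) has_derivative (\<lambda>y. ((c * H (Suc j) (a \<bullet> x + b)) *\<^sub>R a) \<bullet> y)) (at x)"
    for c j x
    using ridge_has_derivative[OF DERIV_cmult[OF assms]] .
  show "C_k n (\<lambda>x. c * H j (a \<bullet> x + b))"
  proof (induction n arbitrary: c j)
    case 0
    have "continuous_on UNIV (\<lambda>x. c * H j (a \<bullet> x + b))"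
      by (rule continuous_at_imp_continuous_on) (use has_derivative_continuous[OF der] in auto)
    then show ?case by simp
  next
    case (Suc n)
    have "grad (\<lambda>x. c * H j (a \<bullet> x + b)) x $ i = (c * a $ i) * H (Suc j) (a \<bullet> x + b)" for x i
      by (simp add: grad_eqI[OF der])
    moreover have "(\<lambda>x. c * H j (a \<bullet> x + b)) differentiable (at x)" for x
      using der unfolding differentiable_def by blast
    ultimately show ?case using Suc by simp
  qed
qed

lemma smooth_cos_ridge: "smooth (\<lambda>x. c * cos (a \<bullet> x + b))"
proof -
  have d: "((\<lambda>t. cos (t + real j * pi / 2)) has_real_derivative cos (t + real (Suc j) * pi / 2)) (at t)" for j t
  proof -
    have "cos (t + real (Suc j) * pi / 2) = cos ((t + real j * pi / 2) + pi / 2)"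
      by (simp add: field_simps)
    also have "\<dots> = - sin (t + real j * pi / 2)" by (simp add: cos_add)
    finally show ?thesis by (auto intro!: derivative_eq_intros)
  qed
  show ?thesis using smooth_ridge[where H = "\<lambda>j t. cos (t + real j * pi / 2)" and j = 0, OF d] by simp
qed

lemma grad_cos_ridge: "grad (\<lambda>x. c * cos (a \<bullet> x + b)) x = (c * cos (a \<bullet> x + (b + pi / 2))) *\<^sub>R a"
proof (rule grad_eqI)
  have "cos (a \<bullet> x + (b + pi / 2)) = - sin (a \<bullet> x + b)"
    by (simp add: cos_add sin_add)
  then have "((\<lambda>t. c * cos t) has_real_derivative c * cos (a \<bullet> x + (b + pi / 2))) (at (a \<bullet> x + b))"
    by (auto intro!: derivative_eq_intros)
  from ridge_has_derivative[OF this]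
  show "((\<lambda>x. c * cos (a \<bullet> x + b)) has_derivative
     (\<lambda>y. ((c * cos (a \<bullet> x + (b + pi / 2))) *\<^sub>R a) \<bullet> y)) (at x)" .
qed

text \<open>With \<open>p = 1\<close> this is the standard smooth function that vanishes exactly on
  \<open>t \<le> 0\<close>. The factor \<open>p\<close> makes the family closed under differentiation.\<close>

definition flat :: "real poly \<Rightarrow> real \<Rightarrow> real" where
  "flat p t = (if t \<le> 0 then 0 else poly p (1 / t) * exp (- (1 / t)))"

lemma poly_exp_tendsto_0: "((\<lambda>s. poly p s * exp (- s)) \<longlongrightarrow> (0::real)) at_top"
proof -
  have "((\<lambda>s. \<Sum>i\<le>degree p. coeff p i * (s ^ i / exp s)) \<longlongrightarrow> (\<Sum>i\<le>degree p. coeff p i * 0)) at_top"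
    by (intro tendsto_sum tendsto_mult tendsto_const tendsto_power_div_exp_0)
  moreover have "(\<Sum>i\<le>degree p. coeff p i * (s ^ i / exp s)) = poly p s * exp (- s)" for s
    by (simp add: poly_altdef sum_distrib_right exp_minus divide_inverse mult.assoc)
  ultimately show ?thesis by simp
qed

lemma flat_has_derivative:
  "(flat p has_real_derivative flat (monom 1 2 * (p - pderiv p)) t) (at t)"
proof (cases "t = 0")
  case False
  show ?thesis
  proof (cases "t < 0")
    case True
    have "((\<lambda>t. 0) has_real_derivative 0) (at t)" by simp
    then have "(flat p has_real_derivative 0) (at t)"
      by (rule DERIV_cong_ev[THEN iffD1, rotated -1])
        (use True eventually_nhds_in_open[of "{..<0}" t] in \<open>auto simp: flat_def elim!: eventually_mono\<close>)
    then show ?thesis using True by (simp add: flat_def)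
  next
    case False
    with \<open>t \<noteq> 0\<close> have "t > 0" by simp
    have "((\<lambda>t. poly p (1 / t) * exp (- (1 / t))) has_real_derivative
       poly (monom 1 2 * (p - pderiv p)) (1 / t) * exp (- (1 / t))) (at t)"
      using \<open>t > 0\<close>
      by (auto intro!: derivative_eq_intros DERIV_chain2[OF poly_DERIV]
          simp: poly_monom field_simps power2_eq_square)
    then have "(flat p has_real_derivative poly (monom 1 2 * (p - pderiv p)) (1 / t) * exp (- (1 / t))) (at t)"
      by (rule DERIV_cong_ev[THEN iffD1, rotated -1])
        (use \<open>t > 0\<close> eventually_nhds_in_open[of "{0<..}" t] in \<open>auto simp: flat_def elim!: eventually_mono\<close>)
    then show ?thesis using \<open>t > 0\<close> by (simp add: flat_def)
  qed
next
  case True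
  have "((\<lambda>h. flat p h / h) \<longlongrightarrow> 0) (at_right 0)"
  proof -
    have "((\<lambda>h. poly (monom 1 1 * p) (inverse h) * exp (- inverse h)) \<longlongrightarrow> 0) (at_right 0)"
      using filterlim_compose[OF poly_exp_tendsto_0 filterlim_inverse_at_top_right] .
    then show ?thesis
      by (rule Lim_transform_eventually)
        (auto simp: eventually_at_right_field flat_def poly_monom field_simps intro!: exI[of _ 1])
  qed
  moreover have "((\<lambda>h. flat p h / h) \<longlongrightarrow> 0) (at_left 0)"
    by (rule Lim_transform_eventually[of "\<lambda>_. 0"])
      (auto simp: eventually_at_left_field flat_def intro!: exI[of _ "-1"])
  ultimately have "((\<lambda>h. flat p h / h) \<longlongrightarrow> 0) (at 0)" by (simp add: filterlim_split_at)
  then have "(flat p has_real_derivative 0) (at 0)" by (simp add: DERIV_def flat_def)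
  then show ?thesis using True by (simp add: flat_def)
qed

lemma smooth_flat_ridge: "smooth (\<lambda>x. flat 1 (a \<bullet> x + b))"
proof -
  define P where "P j = ((\<lambda>p. monom 1 2 * (p - pderiv p)) ^^ j) (1 :: real poly)" for j
  have "(flat (P j) has_real_derivative flat (P (Suc j)) t) (at t)" for j t
    using flat_has_derivative[of "P j" t] by (simp add: P_def)
  from smooth_ridge[where H = "\<lambda>j. flat (P j)" and c = 1 and j = 0, OF this] show ?thesis by (simp add: P_def)
qed

lemma flat_bounds: "0 \<le> flat 1 t" "flat 1 t \<le> 1"
  by (auto simp: flat_def)

subsection \<open>Test functions\<close>

lemma test_function_smooth: "test_function U \<phi> \<Longrightarrow> smooth \<phi>"
  by (simp add: test_function_def)

lemma test_function_supp:
  assumes "test_function U \<phi>" "smooth \<psi>" "{x. \<psi> x \<noteq> 0} \<subseteq> closure {x. \<phi> x \<noteq> 0}"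
  shows "test_function U \<psi>"
proof -
  have sub: "closure {x. \<psi> x \<noteq> 0} \<subseteq> closure {x. \<phi> x \<noteq> 0}"
    using assms(3) by (simp add: closure_minimal)
  then have "compact (closure {x. \<psi> x \<noteq> 0})"
    using assms(1) closed_closure compact_closure compact_imp_bounded bounded_subset
    unfolding test_function_def by (metis bounded_closure_image closure_closure compact_eq_bounded_closed)
  with sub show ?thesis using assms unfolding test_function_def by blast
qed

lemma test_function_mult: "test_function U \<phi> \<Longrightarrow> smooth \<psi> \<Longrightarrow> test_function U (\<lambda>x. \<phi> x * \<psi> x)"
  by (rule test_function_supp[of U \<phi>])
    (auto simp: test_function_smooth intro!: C_k_mult closure_subset[THEN subsetD])

lemma test_function_mult_left: "test_function U \<phi> \<Longrightarrow> smooth \<psi> \<Longrightarrow> test_function U (\<lambda>x. \<psi> x * \<phi> x)"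
  using test_function_mult[of U \<phi> \<psi>] by (simp add: mult.commute)

lemma test_function_cmult: "test_function U \<phi> \<Longrightarrow> test_function U (\<lambda>x. c * \<phi> x)"
  by (simp add: test_function_mult_left C_k_const)

lemma test_function_zero: "test_function U (\<lambda>x. 0)"
  by (simp add: test_function_def C_k_const)

lemma test_function_add:
  assumes "test_function U \<phi>" "test_function U \<psi>"
  shows "test_function U (\<lambda>x. \<phi> x + \<psi> x)"
proof -
  have sub: "closure {x. \<phi> x + \<psi> x \<noteq> 0} \<subseteq> closure {x. \<phi> x \<noteq> 0} \<union> closure {x. \<psi> x \<noteq> 0}"
    unfolding closure_Un[symmetric] by (rule closure_mono) auto
  moreover have "compact (closure {x. \<phi> x \<noteq> 0} \<union> closure {x. \<psi> x \<noteq> 0})"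
    using assms by (auto simp: test_function_def)
  ultimately have "compact (closure {x. \<phi> x + \<psi> x \<noteq> 0})"
    by (meson bounded_subset closed_closure compact_eq_bounded_closed)
  with sub show ?thesis using assms unfolding test_function_def by (blast intro: C_k_add)
qed

lemma test_function_sum:
  "finite I \<Longrightarrow> (\<And>i. i \<in> I \<Longrightarrow> test_function U (f i)) \<Longrightarrow> test_function U (\<lambda>x. \<Sum>i\<in>I. f i x)"
  by (induction rule: finite_induct) (auto simp: test_function_zero intro!: test_function_add)

lemma test_function_vanishes: "test_function U \<phi> \<Longrightarrow> x \<notin> U \<Longrightarrow> \<phi> x = 0"
  using closure_subset[of "{x. \<phi> x \<noteq> 0}"] by (auto simp: test_function_def)

text \<open>Outside the closure of the support the function vanishes in a whole neighbourhood.\<close>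

lemma grad_zero_off_support:
  assumes "x \<notin> closure {x. \<phi> x \<noteq> 0}"
  shows "grad \<phi> x = 0"
proof (rule grad_eqI)
  have "((\<lambda>x. 0) has_derivative (\<lambda>h. 0 \<bullet> h)) (at x)" by simp
  then show "(\<phi> has_derivative (\<lambda>h. 0 \<bullet> h)) (at x)"
    by (rule has_derivative_transform_within_open[of _ _ _ _ "- closure {x. \<phi> x \<noteq> 0}"])
      (use assms closure_subset[of "{x. \<phi> x \<noteq> 0}"] in auto)
qed

lemma test_function_grad: "test_function U \<phi> \<Longrightarrow> test_function U (\<lambda>x. grad \<phi> x $ i)"
  by (rule test_function_supp[of U \<phi>])
    (auto simp: smooth_grad test_function_smooth intro: ccontr dest!: grad_zero_off_support)

lemma bounded_continuous_on_bounded: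
  fixes f :: "real^'n \<Rightarrow> 'b::euclidean_space"
  assumes "bounded U" "continuous_on UNIV f"
  obtains B where "B \<ge> 0" "\<And>x. x \<in> U \<Longrightarrow> norm (f x) \<le> B"
proof -
  have "compact (f ` closure U)"
    using assms by (meson compact_closure compact_continuous_image continuous_on_subset subset_UNIV)
  then have "bounded (f ` closure U)" by (rule compact_imp_bounded)
  then obtain B where "B > 0" "\<And>x. x \<in> closure U \<Longrightarrow> norm (f x) \<le> B" by (auto simp: bounded_pos)
  then show ?thesis using closure_subset that[of B] by (meson less_imp_le subset_iff)
qed

lemma bounded_open_lmeasurable: "open U \<Longrightarrow> bounded U \<Longrightarrow> U \<in> lmeasurable"
  by (simp add: bounded_set_imp_lmeasurable borel_open)

lemma continuous_borel_measurable_on: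
  "continuous_on UNIV f \<Longrightarrow> f \<in> borel_measurable (lebesgue_on S)"
  by (intro measurable_restrict_space1 measurable_completion)
    (simp add: borel_measurable_continuous_onI)

lemma L_two_continuous:
  fixes f :: "real^'n \<Rightarrow> 'b::euclidean_space"
  assumes "open U" "bounded U" "continuous_on UNIV f"
  shows "L_two U f"
proof -
  obtain B where "\<And>x. x \<in> U \<Longrightarrow> norm (f x) \<le> B" using bounded_continuous_on_bounded assms by blast
  then show ?thesis
    using assms by (intro L_two_bounded[of U f B]) (auto simp: bounded_open_lmeasurable continuous_borel_measurable_on)
qed

lemma test_function_bounded:
  assumes "test_function U \<phi>"
  obtains B where "B \<ge> 0" "\<And>x. \<bar>\<phi> x\<bar> \<le> B"
proof -
  have "bounded {x. \<phi> x \<noteq> 0}" using assms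
    by (auto simp: test_function_def intro: bounded_subset[OF compact_imp_bounded closure_subset])
  then obtain B where B: "B \<ge> 0" "\<And>x. x \<in> {x. \<phi> x \<noteq> 0} \<Longrightarrow> norm (\<phi> x) \<le> B"
    using bounded_continuous_on_bounded smooth_continuous[OF test_function_smooth[OF assms]] by metis
  have "\<bar>\<phi> x\<bar> \<le> B" for x using B by (cases "\<phi> x = 0") auto
  with B(1) show ?thesis by (rule that)
qed

section \<open>Approximate Lax--Milgram theorem\<close>

text \<open>The Lax--Milgram theorem is needed on two spaces of smooth functions, the test functions of a domain and the
  trigonometric polynomials on the torus, with seminorms for which neither space is complete. Without
  completeness the equation is still solvable up to an arbitrarily small residual, measured in the
  dual seminorm.\<close>

locale coercive_form =
  fixes S :: "('x \<Rightarrow> real) set" and b a :: "('x \<Rightarrow> real) \<Rightarrow> ('x \<Rightarrow> real) \<Rightarrow> real" and c M :: real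
  assumes zero_in: "(\<lambda>x. 0) \<in> S"
    and lin_in: "u \<in> S \<Longrightarrow> v \<in> S \<Longrightarrow> (\<lambda>x. u x + t * v x) \<in> S"
    and b_sym: "u \<in> S \<Longrightarrow> v \<in> S \<Longrightarrow> b u v = b v u"
    and b_lin: "u \<in> S \<Longrightarrow> v \<in> S \<Longrightarrow> w \<in> S \<Longrightarrow> b (\<lambda>x. u x + t * v x) w = b u w + t * b v w"
    and b_nonneg: "u \<in> S \<Longrightarrow> 0 \<le> b u u"
    and a_lin_left: "u \<in> S \<Longrightarrow> v \<in> S \<Longrightarrow> w \<in> S \<Longrightarrow> a (\<lambda>x. u x + t * v x) w = a u w + t * a v w"
    and a_lin_right: "u \<in> S \<Longrightarrow> v \<in> S \<Longrightarrow> w \<in> S \<Longrightarrow> a w (\<lambda>x. u x + t * v x) = a w u + t * a w v"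
    and a_bound: "u \<in> S \<Longrightarrow> v \<in> S \<Longrightarrow> \<bar>a u v\<bar> \<le> M * sqrt (b u u) * sqrt (b v v)"
    and coercive: "u \<in> S \<Longrightarrow> c * b u u \<le> a u u"
    and c_pos: "0 < c"
begin

abbreviation seminorm :: "('x \<Rightarrow> real) \<Rightarrow> real" where
  "seminorm u \<equiv> sqrt (b u u)"

lemma b_lin_right: "u \<in> S \<Longrightarrow> v \<in> S \<Longrightarrow> w \<in> S \<Longrightarrow> b w (\<lambda>x. u x + t * v x) = b w u + t * b w v"
  using b_lin[of u v w t] by (simp add: b_sym[of w] lin_in)

lemma b_expand:
  assumes "u \<in> S" "v \<in> S"
  shows "b (\<lambda>x. u x + t * v x) (\<lambda>x. u x + t * v x) = b u u + 2 * t * b u v + t\<^sup>2 * b v v"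
  using assms by (simp add: b_lin b_lin_right lin_in b_sym[of v u] power2_eq_square algebra_simps)

lemma b_Cauchy_Schwarz:
  assumes "u \<in> S" "v \<in> S"
  shows "\<bar>b u v\<bar> \<le> seminorm u * seminorm v"
proof -
  have "(b u v)\<^sup>2 \<le> b u u * b v v"
    using b_expand[OF assms] b_nonneg[OF lin_in[OF assms]] by (intro discriminant_nonneg_form) simp
  then have "sqrt ((b u v)\<^sup>2) \<le> sqrt (b u u * b v v)" by (rule real_sqrt_le_mono)
  then show ?thesis by (simp add: real_sqrt_mult)
qed

definition functional :: "(('x \<Rightarrow> real) \<Rightarrow> real) \<Rightarrow> real \<Rightarrow> bool" where
  "functional F K \<longleftrightarrow> (\<forall>u\<in>S. \<forall>v\<in>S. \<forall>t. F (\<lambda>x. u x + t * v x) = F u + t * F v) \<and>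
     (\<forall>v\<in>S. \<bar>F v\<bar> \<le> K * seminorm v)"

text \<open>A near-minimiser \<open>w\<close> of \<open>b v v / 2 - F v\<close> works: along every line through \<open>w\<close> the functional is a parabola
  that drops by at most \<open>d\<^sup>2 / 2\<close>, and this limits its slope at \<open>w\<close>.\<close>

lemma approximate_Riesz:
  assumes F: "functional F K" and d: "d > 0"
  shows "\<exists>w\<in>S. \<forall>v\<in>S. \<bar>b w v - F v\<bar> \<le> d * seminorm v"
proof -
  have Flin: "F (\<lambda>x. u x + t * v x) = F u + t * F v" if "u \<in> S" "v \<in> S" for u v t
    using F that by (simp add: functional_def)
  have Fb: "\<bar>F v\<bar> \<le> K * seminorm v" if "v \<in> S" for v using F that by (simp add: functional_def)
  define J where "J v = b v v / 2 - F v" for v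
  have lower: "- (K\<^sup>2 / 2) \<le> J v" if "v \<in> S" for v
  proof -
    have "0 \<le> (seminorm v - K)\<^sup>2" by simp
    then have "K * seminorm v \<le> b v v / 2 + K\<^sup>2 / 2"
      using b_nonneg[OF that] by (simp add: power2_diff algebra_simps)
    with Fb[OF that] show ?thesis by (simp add: J_def)
  qed
  have bdd: "bdd_below (J ` S)" using lower by (auto intro!: bdd_belowI)
  have ne: "J ` S \<noteq> {}" using zero_in by blast
  have "Inf (J ` S) < Inf (J ` S) + d\<^sup>2 / 2" using d by simp
  then obtain w where w: "w \<in> S" "J w < Inf (J ` S) + d\<^sup>2 / 2"
    using cInf_lessD[OF ne] by blast
  have "\<bar>b w v - F v\<bar> \<le> d * seminorm v" if v: "v \<in> S" for v
  proof -
    have "0 \<le> d\<^sup>2 + 2 * t * (b w v - F v) + t\<^sup>2 * b v v" for t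
    proof -
      have "Inf (J ` S) \<le> J (\<lambda>x. w x + t * v x)"
        using w v by (intro cInf_lower bdd) (auto intro: lin_in)
      also have "\<dots> = J w + t * (b w v - F v) + t\<^sup>2 / 2 * b v v"
        using w v by (simp add: J_def b_expand Flin field_simps)
      finally show ?thesis using w(2) by (simp add: field_simps)
    qed
    then have "(b w v - F v)\<^sup>2 \<le> d\<^sup>2 * b v v" by (rule discriminant_nonneg_form)
    then have "sqrt ((b w v - F v)\<^sup>2) \<le> sqrt (d\<^sup>2 * b v v)" by (rule real_sqrt_le_mono)
    then show ?thesis using d by (simp add: real_sqrt_mult)
  qed
  with w(1) show ?thesis by blast
qed

text \<open>In a Hilbert space, with \<open>A\<close> the operator of the form \<open>a\<close>, the map \<open>I - r A\<close> with \<open>r = c / M\<^sup>2\<close> has norm at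
  most \<open>k\<close>, where \<open>k\<^sup>2 = 1 - c\<^sup>2 / M\<^sup>2\<close>. Hence \<open>u = r w\<close>, with \<open>w\<close> representing \<open>F\<close>, leaves a residual smaller by the factor
  \<open>k\<close>. Approximate representatives \<open>w\<close> of \<open>F\<close> and \<open>z\<close> of \<open>a w\<close> cost an error that vanishes with their
  accuracy \<open>e\<close>, so any factor \<open>q\<close> between \<open>k\<close> and \<open>1\<close> can be reached.\<close>

lemma contraction_step:
  assumes "c \<le> M"
  shows "\<exists>q<1. 0 < q \<and> (\<forall>F K. K > 0 \<longrightarrow> functional F K \<longrightarrow>
    (\<exists>u\<in>S. \<forall>v\<in>S. \<bar>F v - a u v\<bar> \<le> q * K * seminorm v))"
proof -
  define r where "r = c / M\<^sup>2"
  define k where "k = sqrt (1 - 2 * r * c + r\<^sup>2 * M\<^sup>2)"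
  have M: "M > 0" using c_pos assms by simp
  have r: "r > 0" unfolding r_def using c_pos M by simp
  have k_eq: "1 - 2 * r * c + r\<^sup>2 * M\<^sup>2 = 1 - c\<^sup>2 / M\<^sup>2"
    unfolding r_def using M by (simp add: field_simps power2_eq_square)
  have "c\<^sup>2 \<le> M\<^sup>2" using assms c_pos by (intro power_mono) auto
  then have k_nn: "0 \<le> 1 - 2 * r * c + r\<^sup>2 * M\<^sup>2" unfolding k_eq using M by simp
  have k2: "k\<^sup>2 = 1 - 2 * r * c + r\<^sup>2 * M\<^sup>2" unfolding k_def using k_nn by simp
  have k0: "0 \<le> k" unfolding k_def using k_nn by simp
  have k1: "k < 1" unfolding k_def k_eq using c_pos M by (simp add: real_sqrt_lt_1_iff)
  define q where "q = (1 + k) / 2"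
  have q: "k < q" "q < 1" "0 < q" using k0 k1 by (auto simp: q_def)
  have "\<exists>u\<in>S. \<forall>v\<in>S. \<bar>F v - a u v\<bar> \<le> q * K * seminorm v" if K: "K > 0" and F: "functional F K" for F K
  proof -
    \<comment> \<open>\<open>E e\<close> bounds the dual seminorm of the new residual when the representatives have accuracy \<open>e\<close>\<close>
    define E where "E e = (1 + r) * e + sqrt (k\<^sup>2 * (K + e)\<^sup>2 + 2 * r * e * (K + e)
        + 2 * r\<^sup>2 * M * e * (K + e) + r\<^sup>2 * e\<^sup>2)" for e
    have "(E \<longlongrightarrow> (1 + r) * 0 + sqrt (k\<^sup>2 * (K + 0)\<^sup>2 + 2 * r * 0 * (K + 0)
        + 2 * r\<^sup>2 * M * 0 * (K + 0) + r\<^sup>2 * 0\<^sup>2)) (at_right 0)"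
      unfolding E_def by (intro tendsto_intros)
    then have "(E \<longlongrightarrow> k * K) (at_right 0)" using k0 K by (simp add: real_sqrt_mult)
    moreover have "k * K < q * K" using q K by simp
    ultimately have "eventually (\<lambda>e. E e < q * K) (at_right 0)" by (simp add: order_tendstoD(2))
    then obtain e where e: "e > 0" "E e < q * K"
      by (metis (no_types, lifting) eventually_at_right_field field_lbound_gt_zero dense)
    obtain w where w: "w \<in> S" and wF: "\<And>v. v \<in> S \<Longrightarrow> \<bar>b w v - F v\<bar> \<le> e * seminorm v"
      using approximate_Riesz[OF F e(1)] by blast
    have "functional (a w) (M * seminorm w)"
      unfolding functional_def using w a_lin_right a_bound by auto
    from approximate_Riesz[OF this e(1)]
    obtain z where z: "z \<in> S" and za: "\<And>v. v \<in> S \<Longrightarrow> \<bar>b z v - a w v\<bar> \<le> e * seminorm v" by blast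
    let ?W = "seminorm w" and ?Z = "seminorm z"
    have sq: "?W * ?W = b w w" "?Z * ?Z = b z z" using b_nonneg w z by auto
    have W0: "0 \<le> ?W" "0 \<le> ?Z" using b_nonneg w z by auto
    have Wle: "?W \<le> K + e"
    proof (cases "?W = 0")
      case False
      have "\<bar>F w\<bar> \<le> K * ?W" using F w by (simp add: functional_def)
      then have "?W * ?W \<le> (K + e) * ?W" using wF[OF w] sq(1) by (simp only: distrib_right)
      moreover have "0 < ?W" using False W0 by linarith
      ultimately show ?thesis by (rule mult_right_le_imp_le)
    qed (use K e in simp)
    have Zle: "?Z \<le> M * ?W + e"
    proof (cases "?Z = 0")
      case False
      have "\<bar>a w z\<bar> \<le> M * ?W * ?Z" using a_bound w z by simp
      then have "?Z * ?Z \<le> (M * ?W + e) * ?Z" using za[OF z] sq(2) by (simp only: distrib_right)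
      moreover have "0 < ?Z" using False W0 by linarith
      ultimately show ?thesis by (rule mult_right_le_imp_le)
    qed (use M W0 e in simp)
    define y where "y = (\<lambda>x. w x + (- r) * z x)"
    have y: "y \<in> S" unfolding y_def by (rule lin_in[OF w z])
    have "b y y = b w w - 2 * r * b z w + r\<^sup>2 * b z z"
      unfolding y_def b_expand[OF w z] using b_sym[OF w z] by simp
    also have "\<dots> \<le> ?W\<^sup>2 - 2 * r * (c * ?W\<^sup>2 - e * ?W) + r\<^sup>2 * (M * ?W + e)\<^sup>2"
    proof -
      have "c * ?W\<^sup>2 - e * ?W \<le> b z w" using za[OF w] coercive[OF w] sq by (simp add: power2_eq_square)
      moreover have "?Z\<^sup>2 \<le> (M * ?W + e)\<^sup>2" using Zle W0 by (intro power_mono)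
      moreover have "?Z\<^sup>2 = b z z" "?W\<^sup>2 = b w w" using sq by (auto simp: power2_eq_square)
      ultimately show ?thesis using r by (intro add_mono diff_mono mult_left_mono) auto
    qed
    also have "\<dots> = k\<^sup>2 * ?W\<^sup>2 + 2 * r * e * ?W + 2 * r\<^sup>2 * M * e * ?W + r\<^sup>2 * e\<^sup>2"
      unfolding k2 by (simp add: power2_eq_square algebra_simps)
    also have "\<dots> \<le> k\<^sup>2 * (K + e)\<^sup>2 + 2 * r * e * (K + e) + 2 * r\<^sup>2 * M * e * (K + e) + r\<^sup>2 * e\<^sup>2"
      using Wle W0 r M e by (intro add_mono mult_left_mono power_mono) auto
    finally have "seminorm y \<le> sqrt (k\<^sup>2 * (K + e)\<^sup>2 + 2 * r * e * (K + e) + 2 * r\<^sup>2 * M * e * (K + e) + r\<^sup>2 * e\<^sup>2)"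
      by (rule real_sqrt_le_mono)
    then have yE: "(1 + r) * e + seminorm y \<le> q * K" using e(2) unfolding E_def by linarith
    define u where "u = (\<lambda>x. 0 + r * w x)"
    have u: "u \<in> S" unfolding u_def by (rule lin_in[OF zero_in w])
    have "\<bar>F v - a u v\<bar> \<le> q * K * seminorm v" if v: "v \<in> S" for v
    proof -
      have az: "a (\<lambda>x. 0) v = 0"
        using a_lin_left[OF zero_in zero_in v, of 1] by simp
      have au: "a u v = r * a w v" unfolding u_def using a_lin_left[OF zero_in w v, of r] az by simp
      have by': "b y v = b w v - r * b z v" unfolding y_def using b_lin[OF w z v, of "- r"] by simp
      have "F v - a u v = (F v - b w v) + b y v + r * (b z v - a w v)"
        unfolding au by' by (simp add: algebra_simps)
      also have "\<bar>\<dots>\<bar> \<le> \<bar>F v - b w v\<bar> + \<bar>b y v\<bar> + r * \<bar>b z v - a w v\<bar>"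
        using r abs_triangle_ineq[of "(F v - b w v) + b y v" "r * (b z v - a w v)"]
          abs_triangle_ineq[of "F v - b w v" "b y v"] by (simp add: abs_mult)
      also have "\<dots> \<le> e * seminorm v + seminorm y * seminorm v + r * (e * seminorm v)"
        using wF[OF v] za[OF v] b_Cauchy_Schwarz[OF y v] r
        by (intro add_mono mult_left_mono) (auto simp: abs_minus_commute)
      also have "\<dots> = ((1 + r) * e + seminorm y) * seminorm v" by (simp add: algebra_simps)
      also have "\<dots> \<le> q * K * seminorm v" using yE b_nonneg[OF v] by (intro mult_right_mono) auto
      finally show ?thesis .
    qed
    with u show ?thesis by blast
  qed
  with q show ?thesis by blast
qed

text \<open>Each contraction step is applied to the residual of the previous one, so the residuals decay
  geometrically.\<close>

theorem approximate_Lax_Milgram: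
  assumes F: "functional F K" and d: "d > 0" and cM: "c \<le> M"
  shows "\<exists>u\<in>S. \<forall>v\<in>S. \<bar>F v - a u v\<bar> \<le> d * seminorm v"
proof -
  obtain q where q: "0 < q" "q < 1" and step: "\<And>F K. K > 0 \<Longrightarrow> functional F K \<Longrightarrow>
    \<exists>u\<in>S. \<forall>v\<in>S. \<bar>F v - a u v\<bar> \<le> q * K * seminorm v"
    using contraction_step[OF cM] by metis
  define L where "L = \<bar>K\<bar> + 1"
  have L: "L > 0" "K \<le> L" by (auto simp: L_def)
  have "\<exists>u\<in>S. \<forall>v\<in>S. \<bar>F v - a u v\<bar> \<le> q ^ n * L * seminorm v" for n
  proof (induction n)
    case 0
    have "\<bar>F v - a (\<lambda>x. 0) v\<bar> \<le> L * seminorm v" if v: "v \<in> S" for v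
    proof -
      have "a (\<lambda>x. 0) v = 0" using a_lin_left[OF zero_in zero_in v, of 1] by simp
      moreover have "\<bar>F v\<bar> \<le> K * seminorm v" using F v by (simp add: functional_def)
      moreover have "K * seminorm v \<le> L * seminorm v" using L b_nonneg[OF v] by (intro mult_right_mono) auto
      ultimately show ?thesis by simp
    qed
    then show ?case using zero_in by auto
  next
    case (Suc n)
    then obtain u where u: "u \<in> S" "\<And>v. v \<in> S \<Longrightarrow> \<bar>F v - a u v\<bar> \<le> q ^ n * L * seminorm v" by blast
    have "functional (\<lambda>v. F v - a u v) (q ^ n * L)"
      unfolding functional_def
      using F u a_lin_right by (simp add: functional_def algebra_simps)
    moreover have "q ^ n * L > 0" using q L by simp
    ultimately obtain u' where u': "u' \<in> S"
      "\<And>v. v \<in> S \<Longrightarrow> \<bar>F v - a u v - a u' v\<bar> \<le> q * (q ^ n * L) * seminorm v"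
      using step by meson
    have "\<bar>F v - a (\<lambda>x. u x + 1 * u' x) v\<bar> \<le> q ^ Suc n * L * seminorm v" if v: "v \<in> S" for v
      using u'(2)[OF v] a_lin_left[OF u(1) u'(1) v, of 1] by (simp add: algebra_simps)
    with lin_in[OF u(1) u'(1)] show ?case by blast
  qed
  note iter = this
  have "(\<lambda>n. q ^ n * L) \<longlonglongrightarrow> 0 * L" using q by (intro tendsto_intros LIMSEQ_power_zero) auto
  then have "eventually (\<lambda>n. q ^ n * L < d) sequentially" using d by (intro order_tendstoD) auto
  then obtain n where n: "q ^ n * L < d" by (auto simp: eventually_sequentially)
  from iter[of n] obtain u where u: "u \<in> S" "\<And>v. v \<in> S \<Longrightarrow> \<bar>F v - a u v\<bar> \<le> q ^ n * L * seminorm v" by blast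
  have "\<bar>F v - a u v\<bar> \<le> d * seminorm v" if v: "v \<in> S" for v
    by (rule order_trans[OF u(2)[OF v]]) (use n b_nonneg[OF v] in \<open>auto intro!: mult_right_mono\<close>)
  with u(1) show ?thesis by blast
qed

end

section \<open>Integration by parts and weak gradients\<close>

text \<open>Translations preserve the integral, so every difference quotient of \<open>h\<close> integrates to zero,
  and dominated convergence passes to the derivative.\<close>

lemma integral_grad_eq_0:
  fixes h :: "real^'n \<Rightarrow> real"
  assumes h: "smooth h" and bd: "bounded {x. h x \<noteq> 0}"
  shows "(LINT x|lebesgue. grad h x $ i) = 0"
proof -
  obtain r where r: "{x. h x \<noteq> 0} \<subseteq> cball 0 r"
    using bd by (auto simp: bounded_iff subset_iff)
  then have cl: "closure {x. h x \<noteq> 0} \<subseteq> cball 0 r" by (simp add: closure_minimal)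
  obtain B where B0: "B \<ge> 0" and B': "\<And>x. x \<in> cball 0 r \<Longrightarrow> norm (grad h x) \<le> B"
    by (rule bounded_continuous_on_bounded[OF bounded_cball[of 0 r] smooth_continuous_grad[OF h]]) blast
  have B: "norm (grad h x) \<le> B" for x
  proof (cases "x \<in> cball 0 r")
    case False
    then have "x \<notin> closure {x. h x \<noteq> 0}" using cl by blast
    then show ?thesis using grad_zero_off_support B0 by force
  qed (rule B')
  have lip: "\<bar>h x - h y\<bar> \<le> B * norm (x - y)" for x y
  proof -
    have "norm (h x - h y) \<le> B * norm (x - y)"
    proof (rule differentiable_bound[of UNIV h "\<lambda>x h'. grad h x \<bullet> h'"])
      show "onorm (\<lambda>h'. grad h x \<bullet> h') \<le> B" for x
      proof (rule onorm_bound[OF B0])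
        fix y
        have "\<bar>grad h x \<bullet> y\<bar> \<le> norm (grad h x) * norm y" by (rule Cauchy_Schwarz_ineq2)
        also have "\<dots> \<le> B * norm y" using B by (intro mult_right_mono) auto
        finally show "norm (grad h x \<bullet> y) \<le> B * norm y" by simp
      qed
    qed (auto intro: smooth_has_derivative[OF h])
    then show ?thesis by simp
  qed
  define e :: "real^'n" where "e = axis i 1"
  have ne: "norm e = 1" by (simp add: e_def norm_eq_sqrt_inner inner_axis_axis)
  define t :: "nat \<Rightarrow> real" where "t n = inverse (real (Suc n))" for n
  have t0: "0 < t n" "t n \<le> 1" for n unfolding t_def by (auto simp: field_simps)
  have tlim: "t \<longlonglongrightarrow> 0" unfolding t_def by (rule LIMSEQ_inverse_real_of_nat)
  have hm: "h \<in> borel_measurable borel" using smooth_continuous[OF h] by (rule borel_measurable_continuous_onI)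
  have hi: "integrable lborel h"
  proof -
    have "integrable lborel (\<lambda>x. indicator (cball 0 r) x *\<^sub>R h x)"
      by (rule borel_integrable_compact) (auto intro: smooth_continuous[OF h])
    moreover have "(\<lambda>x. indicator (cball 0 r) x *\<^sub>R h x) = h"
      using r by (auto simp: indicator_def fun_eq_iff)
    ultimately show ?thesis by simp
  qed
  have shift: "integrable lborel (\<lambda>x. h (v + x)) \<and> (LINT x|lborel. h (v + x)) = (LINT x|lborel. h x)" for v
  proof -
    have "integrable (distr lborel borel ((+) v)) h" using hi by (simp add: lborel_distr_plus)
    then have "integrable lborel (\<lambda>x. h (v + x))" by (subst (asm) integrable_distr_eq) (use hm in auto)
    moreover have "(LINT x|distr lborel borel ((+) v). h x) = (LINT x|lborel. h (v + x))"
      by (rule integral_distr) (use hm in auto)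
    ultimately show ?thesis by (simp add: lborel_distr_plus)
  qed
  define q where "q n x = (h (t n *\<^sub>R e + x) - h x) / t n" for n x
  have q0: "(LINT x|lborel. q n x) = 0" for n
    unfolding q_def using shift hi by simp
  have "(\<lambda>n. LINT x|lborel. q n x) \<longlonglongrightarrow> (LINT x|lborel. grad h x $ i)"
  proof (rule integral_dominated_convergence[where w = "\<lambda>x. indicator (cball 0 (r + 1)) x *\<^sub>R B"])
    show "(\<lambda>x. grad h x $ i) \<in> borel_measurable lborel"
      using smooth_continuous[OF smooth_grad[OF h]] by (simp add: borel_measurable_continuous_onI)
    show "q n \<in> borel_measurable lborel" for n unfolding q_def using hm by simp
    show "integrable lborel (\<lambda>x. indicator (cball 0 (r + 1)) x *\<^sub>R B)"
      by (rule borel_integrable_compact) auto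
    show "AE x in lborel. (\<lambda>n. q n x) \<longlonglongrightarrow> grad h x $ i"
    proof (rule AE_I2)
      fix x
      have "((\<lambda>s. s *\<^sub>R e + x) has_derivative (\<lambda>s. s *\<^sub>R e)) (at 0)"
        by (auto intro!: derivative_eq_intros)
      moreover have "(h has_derivative (\<lambda>y. grad h x \<bullet> y)) (at (0 *\<^sub>R e + x))"
        using smooth_has_derivative[OF h, of x] by simp
      ultimately have "((\<lambda>s. h (s *\<^sub>R e + x)) has_derivative (\<lambda>s. grad h x \<bullet> (s *\<^sub>R e))) (at 0)"
        by (rule has_derivative_compose)
      then have "((\<lambda>s. h (s *\<^sub>R e + x)) has_real_derivative (grad h x \<bullet> e)) (at 0)"
        by (simp add: has_field_derivative_def mult.commute[of _ "grad h x \<bullet> e"])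
      then have "((\<lambda>s. (h (s *\<^sub>R e + x) - h x) / s) \<longlongrightarrow> grad h x \<bullet> e) (at 0)"
        by (simp add: DERIV_def)
      moreover have "filterlim t (at 0) sequentially"
        using tlim t0(1) by (auto simp: filterlim_at intro!: always_eventually) (metis less_irrefl)
      ultimately have "(\<lambda>n. (h (t n *\<^sub>R e + x) - h x) / t n) \<longlonglongrightarrow> grad h x \<bullet> e"
        by (rule filterlim_compose)
      then show "(\<lambda>n. q n x) \<longlonglongrightarrow> grad h x $ i" by (simp add: q_def e_def inner_axis)
    qed
    show "AE x in lborel. norm (q n x) \<le> indicator (cball 0 (r + 1)) x *\<^sub>R B" for n
    proof (rule AE_I2)
      fix x
      show "norm (q n x) \<le> indicator (cball 0 (r + 1)) x *\<^sub>R B"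
      proof (cases "x \<in> cball 0 (r + 1)")
        case True
        have "\<bar>h (t n *\<^sub>R e + x) - h x\<bar> \<le> B * t n" using lip[of "t n *\<^sub>R e + x" x] t0[of n] ne by simp
        then have "\<bar>q n x\<bar> \<le> B" unfolding q_def using t0[of n] by (simp add: divide_le_eq)
        then show ?thesis using True by simp
      next
        case False
        have "norm x \<le> norm (t n *\<^sub>R e + x) + t n"
          using norm_triangle_ineq4[of "t n *\<^sub>R e + x" "t n *\<^sub>R e"] ne t0[of n] by simp
        then have "norm (t n *\<^sub>R e + x) > r" "norm x > r" using False t0[of n] by auto
        then have "h (t n *\<^sub>R e + x) = 0" "h x = 0" using r by (auto simp: subset_iff not_le[symmetric])
        then show ?thesis by (simp add: q_def B0)
      qed
    qed
  qed
  with q0 have "(LINT x|lborel. grad h x $ i) = 0" by (simp add: LIMSEQ_const_iff)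
  moreover have "(LINT x|lebesgue. grad h x $ i) = (LINT x|lborel. grad h x $ i)"
    using smooth_continuous[OF smooth_grad[OF h]]
    by (intro integral_completion) (simp add: borel_measurable_continuous_onI)
  ultimately show ?thesis by simp
qed

lemma test_function_integral_grad:
  assumes U: "open U" and \<phi>: "test_function U \<phi>"
  shows "(LINT x|lebesgue_on U. grad \<phi> x $ i) = 0"
proof -
  have "(LINT x|lebesgue_on U. grad \<phi> x $ i) = (LINT x|lebesgue. indicator U x *\<^sub>R grad \<phi> x $ i)"
    using U by (intro integral_restrict_space) auto
  also have "\<dots> = (LINT x|lebesgue. grad \<phi> x $ i)"
    using test_function_vanishes[OF test_function_grad[OF \<phi>]]
    by (intro Bochner_Integration.integral_cong) (auto simp: indicator_def)
  also have "\<dots> = 0"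
    using \<phi> by (intro integral_grad_eq_0)
      (auto simp: test_function_def intro: bounded_subset[OF compact_imp_bounded closure_subset])
  finally show ?thesis .
qed

text \<open>The derivative of the product with a test function integrates to zero.\<close>

lemma smooth_has_weak_grad:
  assumes U: "open U" "bounded U" and u: "smooth u"
  shows "has_weak_grad U u (grad u)"
  unfolding has_weak_grad_def
proof (intro conjI allI impI)
  show "L_two U u" "L_two U (grad u)"
    using U u by (auto intro!: L_two_continuous smooth_continuous smooth_continuous_grad)
  fix \<phi> i assume \<phi>: "test_function U \<phi>"
  have s\<phi>: "smooth \<phi>" using \<phi> by (rule test_function_smooth)
  have L: "L_two U f" if "smooth f" for f
    using U that by (auto intro!: L_two_continuous smooth_continuous)
  have i1: "integrable (lebesgue_on U) (\<lambda>x. u x * grad \<phi> x $ i)"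
    using L_two_integrable_inner[OF L[OF u] L[OF smooth_grad[OF s\<phi>]]] by simp
  have i2: "integrable (lebesgue_on U) (\<lambda>x. grad u x $ i * \<phi> x)"
    using L_two_integrable_inner[OF L[OF smooth_grad[OF u]] L[OF s\<phi>]] by simp
  have "0 = (LINT x|lebesgue_on U. grad (\<lambda>x. u x * \<phi> x) x $ i)"
    using test_function_integral_grad[OF U(1) test_function_mult_left[OF \<phi> u]] by simp
  also have "\<dots> = (LINT x|lebesgue_on U. u x * grad \<phi> x $ i + grad u x $ i * \<phi> x)"
    using u s\<phi> by (simp add: grad_mult_smooth mult.commute add.commute)
  also have "\<dots> = (LINT x|lebesgue_on U. u x * grad \<phi> x $ i) + (LINT x|lebesgue_on U. grad u x $ i * \<phi> x)"
    using i1 i2 by simp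
  finally show "(LINT x|lebesgue_on U. u x * grad \<phi> x $ i) = - (LINT x|lebesgue_on U. grad u x $ i * \<phi> x)"
    by simp
qed

text \<open>Products of one-dimensional cut-offs increase to the indicator of an open box; a function
  orthogonal to all test functions therefore has integral zero over every small box, and
  vanishes at its Lebesgue points.\<close>

lemma integral_box_eq_0:
  fixes h :: "real^'n \<Rightarrow> real"
  assumes U: "open U" and hi: "integrable (lebesgue_on U) h"
    and orth: "\<And>\<phi>. test_function U \<phi> \<Longrightarrow> (LINT x|lebesgue_on U. h x * \<phi> x) = 0"
    and sub: "cbox p q \<subseteq> U"
  shows "(LINT x|lebesgue_on (box p q). h x) = 0"
proof -
  define s where "s n x = (\<Prod>i\<in>UNIV. flat 1 (real n * (x $ i - p $ i)) * flat 1 (real n * (q $ i - x $ i)))"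
    for n and x :: "real^'n"
  have s_smooth: "smooth (s n)" for n
  proof -
    have "smooth (\<lambda>x::real^'n. flat 1 (real n * (x $ i - p $ i)))" for i
      using smooth_flat_ridge[of "axis i (real n)" "- real n * p $ i"]
      by (simp add: inner_axis' algebra_simps)
    moreover have "smooth (\<lambda>x::real^'n. flat 1 (real n * (q $ i - x $ i)))" for i
      using smooth_flat_ridge[of "axis i (- real n)" "real n * q $ i"]
      by (simp add: inner_axis' algebra_simps)
    ultimately show ?thesis unfolding s_def by (intro smooth_prod smooth_mult) auto
  qed
  have s_zero: "s n x = 0" if "x \<notin> box p q" for n x
  proof -
    from that obtain i where "x $ i \<le> p $ i \<or> q $ i \<le> x $ i"
      by (auto simp: mem_box_cart not_less)
    then have "flat 1 (real n * (x $ i - p $ i)) * flat 1 (real n * (q $ i - x $ i)) = 0"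
      by (auto simp: flat_def mult_le_0_iff)
    then show ?thesis unfolding s_def by (intro prod_zero) auto
  qed
  have s_bound: "0 \<le> s n x" "s n x \<le> 1" for n x
    unfolding s_def by (auto intro!: prod_nonneg prod_le_1 mult_le_one simp: flat_bounds)
  have s_test: "test_function U (s n)" for n
  proof -
    have "closure {x. s n x \<noteq> 0} \<subseteq> cbox p q"
      using s_zero box_subset_cbox[of p q] by (intro closure_minimal) blast+
    then show ?thesis unfolding test_function_def using s_smooth sub
      by (meson bounded_cbox bounded_subset closed_closure compact_eq_bounded_closed order_trans)
  qed
  have s_lim: "(\<lambda>n. s n x) \<longlonglongrightarrow> indicator (box p q) x" for x
  proof (cases "x \<in> box p q")
    case False
    then show ?thesis by (simp add: s_zero)
  next
    case True
    have one: "(\<lambda>n. flat 1 (real n * d)) \<longlonglongrightarrow> 1" if "d > 0" for d :: real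
    proof -
      have "(\<lambda>n. exp (- (1 / d * (1 / real n)))) \<longlonglongrightarrow> exp (- (1 / d * 0))"
        by (intro tendsto_intros lim_1_over_n)
      then have "(\<lambda>n. exp (- (1 / d * (1 / real n)))) \<longlonglongrightarrow> 1" by simp
      then show ?thesis
        by (rule Lim_transform_eventually)
          (use that in \<open>auto simp: eventually_sequentially flat_def mult_le_0_iff field_simps intro!: exI[of _ 1]\<close>)
    qed
    have "(\<lambda>n. s n x) \<longlonglongrightarrow> (\<Prod>i\<in>(UNIV::'n set). 1 * 1)"
      unfolding s_def using True by (intro tendsto_prod tendsto_mult one) (auto simp: mem_box_cart)
    then show ?thesis using True by simp
  qed
  have "(\<lambda>n. LINT x|lebesgue_on U. h x * s n x) \<longlonglongrightarrow> (LINT x|lebesgue_on U. h x * indicator (box p q) x)"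
  proof (rule integral_dominated_convergence[where w = "\<lambda>x. norm (h x)"])
    have bx: "box p q \<inter> U = box p q" using sub box_subset_cbox by blast
    show "(\<lambda>x. h x * indicator (box p q) x) \<in> borel_measurable (lebesgue_on U)"
      using hi U by (intro borel_measurable_times borel_measurable_indicator')
        (auto simp: sets_restrict_space_iff)
    show "(\<lambda>x. h x * s n x) \<in> borel_measurable (lebesgue_on U)" for n
      using hi continuous_borel_measurable_on[OF smooth_continuous[OF s_smooth]] by measurable
    show "integrable (lebesgue_on U) (\<lambda>x. norm (h x))" using hi by simp
    show "AE x in lebesgue_on U. (\<lambda>n. h x * s n x) \<longlonglongrightarrow> h x * indicator (box p q) x"
      by (intro AE_I2 tendsto_mult tendsto_const s_lim)
    show "AE x in lebesgue_on U. norm (h x * s n x) \<le> norm (h x)" for n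
      using s_bound by (intro AE_I2) (simp add: abs_mult mult_left_le)
  qed
  moreover have "(LINT x|lebesgue_on U. h x * s n x) = 0" for n by (rule orth[OF s_test])
  ultimately have "(LINT x|lebesgue_on U. h x * indicator (box p q) x) = 0" by (simp add: LIMSEQ_const_iff)
  moreover have "(LINT x|lebesgue_on U. h x * indicator (box p q) x) = (LINT x|lebesgue. indicator U x *\<^sub>R (h x * indicator (box p q) x))"
    using U by (intro integral_restrict_space) auto
  moreover have "(LINT x|lebesgue_on (box p q). h x) = (LINT x|lebesgue. indicator (box p q) x *\<^sub>R h x)"
    by (intro integral_restrict_space) auto
  moreover have "(\<lambda>x. indicator U x *\<^sub>R (h x * indicator (box p q) x)) = (\<lambda>x. indicator (box p q) x *\<^sub>R h x)"
    using sub box_subset_cbox by (auto simp: indicator_def fun_eq_iff)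
  ultimately show ?thesis by simp
qed

lemma AE_eq_0_if_orthogonal_to_test_functions:
  fixes h :: "real^'n \<Rightarrow> real"
  assumes U: "open U" and hi: "integrable (lebesgue_on U) h"
    and orth: "\<And>\<phi>. test_function U \<phi> \<Longrightarrow> (LINT x|lebesgue_on U. h x * \<phi> x) = 0"
  shows "AE x in lebesgue_on U. h x = 0"
proof -
  define f where "f x = (if x \<in> U then h x else 0)" for x
  have Um: "U \<in> sets lebesgue" using U by auto
  have "integrable lebesgue f"
  proof -
    have "integrable lebesgue (\<lambda>x. indicator U x *\<^sub>R h x)"
      using hi Um by (simp add: integrable_restrict_space)
    moreover have "(\<lambda>x. indicator U x *\<^sub>R h x) = f" by (auto simp: f_def fun_eq_iff)
    ultimately show ?thesis by simp
  qed
  then have fi: "integrable (lebesgue_on S) f" if "S \<in> sets lebesgue" for S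
    using that integrable_mult_indicator[OF that, of f] by (simp add: integrable_restrict_space)
  have int: "f integrable_on cbox a b" for a b by (rule integrable_on_lebesgue_on[OF fi]) auto
  obtain N where N: "negligible N" and
    leb: "\<And>x e. \<lbrakk>x \<notin> N; 0 < e\<rbrakk> \<Longrightarrow> \<exists>d>0. \<forall>h. 0 < h \<and> h < d \<longrightarrow>
      norm (integral (cbox x (x + h *\<^sub>R One)) f /\<^sub>R h ^ DIM(real^'n) - f x) < e"
    by (rule integrable_ccontinuous_explicit[OF int]) blast
  have "h x = 0" if x: "x \<in> U" "x \<notin> N" for x
  proof (rule ccontr)
    assume "h x \<noteq> 0"
    then have "0 < norm (f x)" using x by (simp add: f_def)
    from leb[OF x(2) this] obtain d where d: "d > 0" and
      D: "\<And>s. 0 < s \<Longrightarrow> s < d \<Longrightarrow> norm (integral (cbox x (x + s *\<^sub>R One)) f /\<^sub>R s ^ DIM(real^'n) - f x) < norm (f x)"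
      by blast
    obtain r where r: "r > 0" "ball x r \<subseteq> U" using U x(1) openE by blast
    \<comment> \<open>a cube of side \<open>s\<close> has diameter \<open>s * norm One\<close>; the summand \<open>1\<close> gives strict inequality below\<close>
    define K where "K = norm (One :: real^'n) + 1"
    have K: "K > 0" unfolding K_def by (simp add: add_nonneg_pos)
    define s where "s = min (d / 2) (r / (2 * K))"
    have s: "0 < s" "s < d" "s * K < r" using d r(1) K
      by (auto simp: s_def min_def field_simps)
    have sub: "cbox x (x + s *\<^sub>R One) \<subseteq> U"
    proof
      fix y assume y: "y \<in> cbox x (x + s *\<^sub>R One)"
      have "norm (y - x) \<le> norm (s *\<^sub>R One :: real^'n)"
        by (rule norm_le_componentwise) (use y s in \<open>auto simp: mem_box algebra_simps inner_add_left\<close>)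
      also have "\<dots> < s * K" using s by (simp add: K_def)
      also have "\<dots> < r" by (rule s)
      finally show "y \<in> U" using r(2) by (auto simp: dist_norm norm_minus_commute)
    qed
    have "integral (cbox x (x + s *\<^sub>R One)) f = integral (box x (x + s *\<^sub>R One)) f"
      by (rule integral_open_interval[symmetric])
    also have "\<dots> = (LINT y|lebesgue_on (box x (x + s *\<^sub>R One)). f y)"
      by (rule lebesgue_integral_eq_integral[symmetric]) (auto intro!: fi)
    also have "\<dots> = (LINT y|lebesgue_on (box x (x + s *\<^sub>R One)). h y)"
      using sub box_subset_cbox[of x "x + s *\<^sub>R One"]
      by (intro Bochner_Integration.integral_cong) (auto simp: f_def)
    also have "\<dots> = 0" by (rule integral_box_eq_0[OF U hi orth sub])
    finally show False using D[OF s(1,2)] by simp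
  qed
  then show ?thesis using N Um
    by (intro AE_I'[of "N \<inter> U"])
      (auto simp: negligible_iff_null_sets null_sets_restrict_space intro: null_set_Int2)
qed

text \<open>Weak gradients are chosen by \<open>SOME\<close>; this is what allows passing from the chosen representative to any
  other one, for instance the classical gradient of a smooth function.\<close>

lemma has_weak_grad_unique:
  fixes u :: "real^'n \<Rightarrow> real"
  assumes U: "open U" "bounded U" and g: "has_weak_grad U u g" and g': "has_weak_grad U u g'"
  shows "AE x in lebesgue_on U. g x = g' x"
proof -
  have one: "L_two U (\<lambda>x. 1::real)" using U by (intro L_two_continuous) auto
  have comp: "L_two U (\<lambda>x. v x $ i)" if "L_two U v" for v :: "real^'n \<Rightarrow> real^'n" and i
  proof (rule L_two_bound[OF that, of _ 1])
    have "(\<lambda>x. v x \<bullet> axis i 1) \<in> borel_measurable (lebesgue_on U)"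
      using L_two_measurable[OF that] by measurable
    then show "(\<lambda>x. v x $ i) \<in> borel_measurable (lebesgue_on U)" by (simp add: inner_axis)
  qed (simp add: component_le_norm_cart)
  have "AE x in lebesgue_on U. g x $ i - g' x $ i = 0" for i
  proof (rule AE_eq_0_if_orthogonal_to_test_functions[OF U(1)])
    have L: "L_two U (\<lambda>x. g x $ i)" "L_two U (\<lambda>x. g' x $ i)"
      using g g' comp by (auto simp: has_weak_grad_def)
    then show "integrable (lebesgue_on U) (\<lambda>x. g x $ i - g' x $ i)"
      using L_two_integrable_inner[OF one] L_two_diff by fastforce
    fix \<phi> assume \<phi>: "test_function U \<phi>"
    have L\<phi>: "L_two U \<phi>" using U smooth_continuous[OF test_function_smooth[OF \<phi>]] by (intro L_two_continuous)
    have "integrable (lebesgue_on U) (\<lambda>x. g x $ i * \<phi> x)" "integrable (lebesgue_on U) (\<lambda>x. g' x $ i * \<phi> x)"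
      using L_two_integrable_inner[OF L(1) L\<phi>] L_two_integrable_inner[OF L(2) L\<phi>] by auto
    moreover have "(LINT x|lebesgue_on U. g x $ i * \<phi> x) = (LINT x|lebesgue_on U. g' x $ i * \<phi> x)"
    proof -
      have "(LINT x|lebesgue_on U. u x * grad \<phi> x $ i) = - (LINT x|lebesgue_on U. g x $ i * \<phi> x)"
        "(LINT x|lebesgue_on U. u x * grad \<phi> x $ i) = - (LINT x|lebesgue_on U. g' x $ i * \<phi> x)"
        using g g' \<phi> unfolding has_weak_grad_def by blast+
      then show ?thesis by simp
    qed
    ultimately show "(LINT x|lebesgue_on U. (g x $ i - g' x $ i) * \<phi> x) = 0"
      by (simp add: left_diff_distrib)
  qed
  then have "AE x in lebesgue_on U. \<forall>i\<in>UNIV. g x $ i - g' x $ i = 0"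
    by (intro AE_finite_allI) auto
  then show ?thesis by eventually_elim (simp add: vec_eq_iff)
qed

lemma has_weak_grad_weak_grad:
  assumes "W12 U u" shows "has_weak_grad U u (weak_grad U u)"
proof -
  have "\<exists>g. has_weak_grad U u g" using assms by (simp add: W12_def)
  then show ?thesis unfolding weak_grad_def by (rule someI_ex)
qed

section \<open>Matrices acting on square integrable fields\<close>

lemma norm_matrix_vector_le:
  fixes A :: "real^'n^'m"
  shows "norm (A *v x) \<le> norm A * norm x"
proof -
  have "norm (A *v x) = L2_set (\<lambda>i. norm (A $ i \<bullet> x)) UNIV"
    by (simp add: norm_vec_def matrix_mult_dot)
  also have "\<dots> \<le> L2_set (\<lambda>i. norm (A $ i) * norm x) UNIV"
    by (rule L2_set_mono) (auto simp: Cauchy_Schwarz_ineq2)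
  also have "\<dots> = norm A * norm x"
    by (simp add: norm_vec_def L2_set_left_distrib)
  finally show ?thesis .
qed

lemma continuous_on_matrix_vector [continuous_intros]:
  fixes A :: "'a::topological_space \<Rightarrow> real^'n^'m"
  assumes "continuous_on S A" "continuous_on S g"
  shows "continuous_on S (\<lambda>x. A x *v g x)"
  unfolding matrix_vector_mult_def using assms
  by (intro continuous_on_vec_lambda continuous_on_sum continuous_on_mult continuous_on_component)

lemma borel_measurable_matrix_vector [measurable (raw)]:
  fixes A :: "'a \<Rightarrow> real^'n^'m"
  assumes "A \<in> borel_measurable M" "g \<in> borel_measurable M"
  shows "(\<lambda>x. A x *v g x) \<in> borel_measurable M"
  by (rule borel_measurable_continuous_Pair[OF assms])
    (intro continuous_intros continuous_on_fst continuous_on_snd continuous_on_id)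

lemma borel_measurable_vec_component:
  fixes g :: "'a \<Rightarrow> real^'n"
  assumes "g \<in> borel_measurable M"
  shows "(\<lambda>x. g x $ i) \<in> borel_measurable M"
proof -
  have "(\<lambda>x. g x \<bullet> axis i 1) \<in> borel_measurable M" using assms by measurable
  then show ?thesis by (simp add: inner_axis)
qed

lemma L_two_component:
  fixes g :: "real^'n \<Rightarrow> real^'k"
  assumes "L_two U g" shows "L_two U (\<lambda>x. g x $ i)"
  by (rule L_two_bound[OF assms, of _ 1])
    (use assms component_le_norm_cart in \<open>auto simp: L_two_def borel_measurable_vec_component\<close>)

lemma L_two_matrix:
  fixes A :: "real^'k^'l" and g :: "real^'n \<Rightarrow> real^'k"
  assumes "L_two U g"
  shows "L_two U (\<lambda>x. A *v g x)" "L_two_norm U (\<lambda>x. A *v g x) \<le> norm A * L_two_norm U g"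
  using assms L_two_measurable[OF assms]
  by (auto intro!: L_two_bound[OF assms, of _ "norm A"] L_two_norm_mono norm_matrix_vector_le
      borel_measurable_matrix_vector)

lemma inner_matrix_transpose:
  fixes A :: "real^'n^'m"
  shows "(A *v x) \<bullet> y = x \<bullet> (transpose A *v y)"
  by (simp add: inner_commute dot_lmul_matrix[symmetric] vector_transpose_matrix)

lemma L_two_inner_tendsto:
  assumes "\<And>n. L_two U (f n)" "L_two U g" "L_two U h"
    and "(\<lambda>n. L_two_norm U (\<lambda>x. f n x - g x)) \<longlonglongrightarrow> 0"
  shows "(\<lambda>n. L_two_inner U (f n) h) \<longlonglongrightarrow> L_two_inner U g h"
proof (rule LIM_zero_cancel, rule Lim_null_comparison)
  show "\<forall>\<^sub>F n in sequentially. norm (L_two_inner U (f n) h - L_two_inner U g h)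
      \<le> L_two_norm U (\<lambda>x. f n x - g x) * L_two_norm U h"
    using L_two_inner_le[OF L_two_diff[OF assms(1) assms(2)] assms(3)]
    by (simp add: L_two_inner_diff_left assms)
  show "(\<lambda>n. L_two_norm U (\<lambda>x. f n x - g x) * L_two_norm U h) \<longlonglongrightarrow> 0"
    using tendsto_mult[OF assms(4) tendsto_const] by simp
qed

section \<open>The Sobolev spaces\<close>

lemma weak_grad_AE:
  assumes "open U" "bounded U" "has_weak_grad U u g"
  shows "AE x in lebesgue_on U. weak_grad U u x = g x"
  by (rule has_weak_grad_unique[OF assms(1,2) has_weak_grad_weak_grad assms(3)])
    (use assms(3) in \<open>auto simp: W12_def\<close>)

lemma W12_L_two:
  assumes "W12 U u" shows "L_two U u" "L_two U (weak_grad U u)"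
  using has_weak_grad_weak_grad[OF assms] by (auto simp: has_weak_grad_def)

lemma W12_0_imp_W12: "W12_0 U u \<Longrightarrow> W12 U u"
  by (simp add: W12_0_def)

lemmas W12_0_L_two = W12_L_two[OF W12_0_imp_W12]

lemma weak_grad_inner_eq:
  assumes "open U" "bounded U" "has_weak_grad U u g" "L_two U q"
  shows "L_two_inner U q (weak_grad U u) = L_two_inner U q g"
    "L_two_inner U (weak_grad U u) q = L_two_inner U g q"
  using assms weak_grad_AE[OF assms(1-3)] W12_L_two[of U u]
  by (auto intro!: L_two_inner_cong_AE L_two_measurable simp: has_weak_grad_def W12_def)

lemma weak_grad_norm_eq:
  assumes "open U" "bounded U" "has_weak_grad U u g"
  shows "L_two_norm U (weak_grad U u) = L_two_norm U g"
  using assms weak_grad_AE[OF assms(1-3)] W12_L_two[of U u]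
  by (auto intro!: L_two_norm_cong_AE L_two_measurable simp: has_weak_grad_def W12_def)

lemma W12_norm_eq:
  assumes "open U" "bounded U" "has_weak_grad U u g"
  shows "W12_norm U u = sqrt ((L_two_norm U u)\<^sup>2 + (L_two_norm U g)\<^sup>2)"
  by (simp add: W12_norm_def weak_grad_norm_eq[OF assms])

lemma has_weak_grad_inner_iff:
  "has_weak_grad U u g \<longleftrightarrow> L_two U u \<and> L_two U g \<and>
     (\<forall>\<phi> i. test_function U \<phi> \<longrightarrow>
        L_two_inner U u (\<lambda>x. grad \<phi> x $ i) = - L_two_inner U g (\<lambda>x. \<phi> x *\<^sub>R axis i 1))"
  by (simp add: has_weak_grad_def L_two_inner_def inner_axis mult.commute)

lemma L_two_test:
  assumes "open U" "bounded U" "test_function U \<phi>"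
  shows "L_two U \<phi>" "L_two U (grad \<phi>)" "L_two U (\<lambda>x. grad \<phi> x $ i)" "L_two U (\<lambda>x. \<phi> x *\<^sub>R axis i 1)"
  using assms test_function_smooth[OF assms(3)]
  by (auto intro!: L_two_continuous smooth_continuous smooth_continuous_grad smooth_grad continuous_intros)

lemma has_weak_grad_lin:
  assumes U: "open U" "bounded U" and "has_weak_grad U u g" "has_weak_grad U v h"
  shows "has_weak_grad U (\<lambda>x. u x + t * v x) (\<lambda>x. g x + t *\<^sub>R h x)"
  using assms unfolding has_weak_grad_inner_iff
  using L_two_inner_scaleR_left[of U t v]
  by (auto simp: L_two_test[OF U] L_two_add L_two_scaleR L_two_cmult L_two_inner_add_left L_two_inner_scaleR_left)

lemma has_weak_grad_diff:
  assumes U: "open U" "bounded U" and "has_weak_grad U u g" "has_weak_grad U v h"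
  shows "has_weak_grad U (\<lambda>x. u x - v x) (\<lambda>x. g x - h x)"
  using has_weak_grad_lin[OF assms, of "-1"] by simp

lemma test_has_weak_grad: "open U \<Longrightarrow> bounded U \<Longrightarrow> test_function U \<phi> \<Longrightarrow> has_weak_grad U \<phi> (grad \<phi>)"
  by (simp add: smooth_has_weak_grad test_function_smooth)

lemma has_weak_grad_limit:
  assumes U: "open U" "bounded U" and \<phi>: "\<And>n. has_weak_grad U (\<phi> n) (\<gamma> n)"
    and "L_two U u" "L_two U g"
    and "(\<lambda>n. L_two_norm U (\<lambda>x. \<phi> n x - u x)) \<longlonglongrightarrow> 0"
    and "(\<lambda>n. L_two_norm U (\<lambda>x. \<gamma> n x - g x)) \<longlonglongrightarrow> 0"
  shows "has_weak_grad U u g"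
  unfolding has_weak_grad_inner_iff
proof (intro conjI allI impI)
  fix \<psi> i assume \<psi>: "test_function U \<psi>"
  have L: "L_two U (\<phi> n)" "L_two U (\<gamma> n)" for n using \<phi>[of n] by (auto simp: has_weak_grad_def)
  have "(\<lambda>n. L_two_inner U (\<phi> n) (\<lambda>x. grad \<psi> x $ i)) \<longlonglongrightarrow> L_two_inner U u (\<lambda>x. grad \<psi> x $ i)"
    by (rule L_two_inner_tendsto) (use assms L L_two_test[OF U \<psi>] in auto)
  moreover have "(\<lambda>n. - L_two_inner U (\<gamma> n) (\<lambda>x. \<psi> x *\<^sub>R axis i 1)) \<longlonglongrightarrow> - L_two_inner U g (\<lambda>x. \<psi> x *\<^sub>R axis i 1)"
    by (intro tendsto_minus L_two_inner_tendsto) (use assms L L_two_test[OF U \<psi>] in auto)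
  moreover have "L_two_inner U (\<phi> n) (\<lambda>x. grad \<psi> x $ i) = - L_two_inner U (\<gamma> n) (\<lambda>x. \<psi> x *\<^sub>R axis i 1)" for n
    using \<phi>[of n] \<psi> by (simp add: has_weak_grad_inner_iff)
  ultimately show "L_two_inner U u (\<lambda>x. grad \<psi> x $ i) = - L_two_inner U g (\<lambda>x. \<psi> x *\<^sub>R axis i 1)"
    using LIMSEQ_unique by simp
qed (use assms in auto)

text \<open>A limit of test functions in the graph norm is again in the space, and the limit of the gradients is its weak
  gradient. The pair \<open>(u, g)\<close> is given separately because \<open>weak_grad U u\<close> is meaningless before the conclusion
  is known.\<close>

lemma W12_0_limit:
  assumes U: "open U" "bounded U" and \<phi>: "\<And>n. test_function U (\<phi> n)"
    and L: "L_two U u" "L_two U g"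
    and lim: "(\<lambda>n. L_two_norm U (\<lambda>x. \<phi> n x - u x)) \<longlonglongrightarrow> 0"
      "(\<lambda>n. L_two_norm U (\<lambda>x. grad (\<phi> n) x - g x)) \<longlonglongrightarrow> 0"
  shows "has_weak_grad U u g" "W12_0 U u"
proof -
  have \<phi>w: "has_weak_grad U (\<phi> n) (grad (\<phi> n))" for n by (rule test_has_weak_grad[OF U \<phi>])
  show uw: "has_weak_grad U u g" by (rule has_weak_grad_limit[OF U \<phi>w L lim])
  have "W12_norm U (\<lambda>x. u x - \<phi> n x) = sqrt ((L_two_norm U (\<lambda>x. \<phi> n x - u x))\<^sup>2
      + (L_two_norm U (\<lambda>x. grad (\<phi> n) x - g x))\<^sup>2)" for n
    using W12_norm_eq[OF U has_weak_grad_diff[OF U uw \<phi>w, of n]]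
    by (simp add: L_two_norm_minus_commute[of U u] L_two_norm_minus_commute[of U g])
  moreover have "(\<lambda>n. sqrt ((L_two_norm U (\<lambda>x. \<phi> n x - u x))\<^sup>2
      + (L_two_norm U (\<lambda>x. grad (\<phi> n) x - g x))\<^sup>2)) \<longlonglongrightarrow> sqrt (0\<^sup>2 + 0\<^sup>2)"
    by (intro tendsto_intros lim)
  ultimately have "(\<lambda>n. W12_norm U (\<lambda>x. u x - \<phi> n x)) \<longlonglongrightarrow> 0" by simp
  then show "W12_0 U u" unfolding W12_0_def W12_def using uw \<phi> by blast
qed

lemma W12_0_test:
  assumes "open U" "bounded U" "test_function U \<phi>" shows "W12_0 U \<phi>"
  by (rule W12_0_limit[OF assms(1,2), of "\<lambda>_. \<phi>" \<phi> "grad \<phi>"])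
    (use assms L_two_test[OF assms] in \<open>auto simp: L_two_norm_def\<close>)

lemma W12_0_approx:
  assumes U: "open U" "bounded U" and u: "W12_0 U u" and e: "e > 0"
  obtains \<phi> where "test_function U \<phi>" "L_two_norm U (\<lambda>x. u x - \<phi> x) < e"
    "L_two_norm U (\<lambda>x. weak_grad U u x - grad \<phi> x) < e" "W12_norm U (\<lambda>x. u x - \<phi> x) < e"
proof -
  from u obtain \<phi> where \<phi>: "\<And>n. test_function U (\<phi> n)" "(\<lambda>n. W12_norm U (\<lambda>x. u x - \<phi> n x)) \<longlonglongrightarrow> 0"
    unfolding W12_0_def by blast
  from order_tendstoD(2)[OF \<phi>(2) e] obtain n where n: "W12_norm U (\<lambda>x. u x - \<phi> n x) < e"
    by (auto simp: eventually_sequentially)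
  have eq: "W12_norm U (\<lambda>x. u x - \<phi> n x) = sqrt ((L_two_norm U (\<lambda>x. u x - \<phi> n x))\<^sup>2
      + (L_two_norm U (\<lambda>x. weak_grad U u x - grad (\<phi> n) x))\<^sup>2)"
    by (rule W12_norm_eq[OF U has_weak_grad_diff[OF U has_weak_grad_weak_grad[OF W12_0_imp_W12[OF u]]
          test_has_weak_grad[OF U \<phi>(1)]]])
  have "L_two_norm U (\<lambda>x. u x - \<phi> n x) \<le> W12_norm U (\<lambda>x. u x - \<phi> n x)"
    "L_two_norm U (\<lambda>x. weak_grad U u x - grad (\<phi> n) x) \<le> W12_norm U (\<lambda>x. u x - \<phi> n x)"
    unfolding eq by (auto intro!: real_le_rsqrt)
  with n that[OF \<phi>(1)] show ?thesis by force
qed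

lemma W12_0_lin:
  assumes U: "open U" "bounded U" and u: "W12_0 U u" and v: "W12_0 U v"
  shows "W12_0 U (\<lambda>x. u x + t * v x)"
proof -
  define e where "e n = inverse (real (Suc n))" for n
  have e: "e n > 0" for n by (simp add: e_def)
  have e0: "e \<longlonglongrightarrow> 0" unfolding e_def by (rule LIMSEQ_inverse_real_of_nat)
  have "\<forall>n. \<exists>\<phi>. test_function U \<phi> \<and> L_two_norm U (\<lambda>x. u x - \<phi> x) < e n \<and>
      L_two_norm U (\<lambda>x. weak_grad U u x - grad \<phi> x) < e n"
    using W12_0_approx[OF U u e] by metis
  then obtain \<phi> where \<phi>: "\<And>n. test_function U (\<phi> n)" "\<And>n. L_two_norm U (\<lambda>x. u x - \<phi> n x) < e n"
    "\<And>n. L_two_norm U (\<lambda>x. weak_grad U u x - grad (\<phi> n) x) < e n" by metis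
  have "\<forall>n. \<exists>\<phi>. test_function U \<phi> \<and> L_two_norm U (\<lambda>x. v x - \<phi> x) < e n \<and>
      L_two_norm U (\<lambda>x. weak_grad U v x - grad \<phi> x) < e n"
    using W12_0_approx[OF U v e] by metis
  then obtain \<psi> where \<psi>: "\<And>n. test_function U (\<psi> n)" "\<And>n. L_two_norm U (\<lambda>x. v x - \<psi> n x) < e n"
    "\<And>n. L_two_norm U (\<lambda>x. weak_grad U v x - grad (\<psi> n) x) < e n" by metis
  have sm: "smooth (\<phi> n)" "smooth (\<psi> n)" for n using \<phi>(1) \<psi>(1) test_function_smooth by blast+
  have lim: "(\<lambda>n. e n + \<bar>t\<bar> * e n) \<longlonglongrightarrow> 0"
    using tendsto_add[OF e0 tendsto_mult[OF tendsto_const[of "\<bar>t\<bar>"] e0]] by simp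
  show ?thesis
  proof (rule W12_0_limit(2)[OF U, of "\<lambda>n x. \<phi> n x + t * \<psi> n x" _ "\<lambda>x. weak_grad U u x + t *\<^sub>R weak_grad U v x"])
    show "test_function U (\<lambda>x. \<phi> n x + t * \<psi> n x)" for n
      using \<phi> \<psi> by (intro test_function_add test_function_cmult)
    show "L_two U (\<lambda>x. u x + t * v x)" "L_two U (\<lambda>x. weak_grad U u x + t *\<^sub>R weak_grad U v x)"
      using W12_0_L_two[OF u] W12_0_L_two[OF v] by (auto intro!: L_two_add L_two_scaleR L_two_cmult)
    show "(\<lambda>n. L_two_norm U (\<lambda>x. \<phi> n x + t * \<psi> n x - (u x + t * v x))) \<longlonglongrightarrow> 0"
    proof (rule tendsto_sandwich[OF _ _ tendsto_const lim]; intro always_eventually allI)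
      fix n
      have L: "L_two U (\<lambda>x. \<phi> n x - u x)" "L_two U (\<lambda>x. \<psi> n x - v x)"
        using W12_0_L_two[OF u] W12_0_L_two[OF v] L_two_test[OF U \<phi>(1)] L_two_test[OF U \<psi>(1)]
        by (auto intro!: L_two_diff)
      have "L_two_norm U (\<lambda>x. \<phi> n x + t * \<psi> n x - (u x + t * v x))
          = L_two_norm U (\<lambda>x. (\<phi> n x - u x) + t *\<^sub>R (\<psi> n x - v x))"
        by (simp add: algebra_simps)
      also have "\<dots> \<le> L_two_norm U (\<lambda>x. \<phi> n x - u x) + \<bar>t\<bar> * L_two_norm U (\<lambda>x. \<psi> n x - v x)"
        using L_two_norm_triangle[OF L(1) L_two_scaleR[OF L(2)], of t] by (simp add: L_two_norm_scaleR del: real_scaleR_def)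
      also have "\<dots> \<le> e n + \<bar>t\<bar> * e n"
        using \<phi>(2)[of n] \<psi>(2)[of n]
        by (intro add_mono mult_left_mono) (auto simp: L_two_norm_minus_commute[of U _ u] L_two_norm_minus_commute[of U _ v])
      finally show "L_two_norm U (\<lambda>x. \<phi> n x + t * \<psi> n x - (u x + t * v x)) \<le> e n + \<bar>t\<bar> * e n" .
    qed (simp add: L_two_norm_nonneg)
    show "(\<lambda>n. L_two_norm U (\<lambda>x. grad (\<lambda>x. \<phi> n x + t * \<psi> n x) x - (weak_grad U u x + t *\<^sub>R weak_grad U v x))) \<longlonglongrightarrow> 0"
    proof (rule tendsto_sandwich[OF _ _ tendsto_const lim]; intro always_eventually allI)
      fix n
      have L: "L_two U (\<lambda>x. grad (\<phi> n) x - weak_grad U u x)" "L_two U (\<lambda>x. grad (\<psi> n) x - weak_grad U v x)"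
        using W12_0_L_two[OF u] W12_0_L_two[OF v] L_two_test[OF U \<phi>(1)] L_two_test[OF U \<psi>(1)]
        by (auto intro!: L_two_diff)
      have "L_two_norm U (\<lambda>x. grad (\<lambda>x. \<phi> n x + t * \<psi> n x) x - (weak_grad U u x + t *\<^sub>R weak_grad U v x))
          = L_two_norm U (\<lambda>x. (grad (\<phi> n) x - weak_grad U u x) + t *\<^sub>R (grad (\<psi> n) x - weak_grad U v x))"
        using sm by (simp add: algebra_simps grad_add_smooth grad_cmult smooth_cmult)
      also have "\<dots> \<le> L_two_norm U (\<lambda>x. grad (\<phi> n) x - weak_grad U u x) + \<bar>t\<bar> * L_two_norm U (\<lambda>x. grad (\<psi> n) x - weak_grad U v x)"
        using L_two_norm_triangle[OF L(1) L_two_scaleR[OF L(2)], of t] by (simp add: L_two_norm_scaleR)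
      also have "\<dots> \<le> e n + \<bar>t\<bar> * e n"
        using \<phi>(3)[of n] \<psi>(3)[of n]
        by (intro add_mono mult_left_mono)
          (auto simp: L_two_norm_minus_commute[of U _ "weak_grad U u"] L_two_norm_minus_commute[of U _ "weak_grad U v"])
      finally show "L_two_norm U (\<lambda>x. grad (\<lambda>x. \<phi> n x + t * \<psi> n x) x - (weak_grad U u x + t *\<^sub>R weak_grad U v x)) \<le> e n + \<bar>t\<bar> * e n" .
    qed (simp add: L_two_norm_nonneg)
  qed
qed

lemma W12_0_diff: "open U \<Longrightarrow> bounded U \<Longrightarrow> W12_0 U u \<Longrightarrow> W12_0 U v \<Longrightarrow> W12_0 U (\<lambda>x. u x - v x)"
  using W12_0_lin[of U u v "-1"] by simp

lemma smooth_inner: "smooth (\<lambda>x. a \<bullet> x)"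
  and grad_inner: "grad (\<lambda>x. a \<bullet> x) x = a"
proof -
  have d: "((\<lambda>x. a \<bullet> x) has_derivative (\<lambda>h. a \<bullet> h)) (at x)" for x by (auto intro!: derivative_eq_intros)
  show g: "grad (\<lambda>x. a \<bullet> x) x = a" for x by (rule grad_eqI[OF d])
  show "smooth (\<lambda>x. a \<bullet> x)"
  proof
    fix n show "C_k n (\<lambda>x. a \<bullet> x)"
      using d by (cases n) (auto simp: g C_k_const differentiable_def intro: continuous_intros)
  qed
qed

text \<open>The Poincare inequality comes from integrating the derivative of \<open>x\<^sub>i \<phi>\<^sup>2\<close>, where \<open>x\<^sub>i\<close> is
  bounded on the domain.\<close>

lemma Poincare_test:
  fixes U :: "(real^'n) set"
  assumes U: "open U" "bounded U"
  obtains P where "P > 0" "\<And>\<phi>. test_function U \<phi> \<Longrightarrow> L_two_norm U \<phi> \<le> P * L_two_norm U (grad \<phi>)"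
proof -
  obtain D where D: "D > 0" "\<And>x. x \<in> U \<Longrightarrow> norm x \<le> D" using U(2) by (auto simp: bounded_pos)
  have "L_two_norm U \<phi> \<le> (2 * D) * L_two_norm U (grad \<phi>)" if \<phi>: "test_function U \<phi>" for \<phi>
  proof -
    fix i :: 'n
    have s: "smooth \<phi>" using \<phi> by (rule test_function_smooth)
    let ?x = "\<lambda>x::real^'n. axis i 1 \<bullet> x"
    have sx: "smooth ?x" by (rule smooth_inner)
    have g: "grad (\<lambda>x. ?x x * (\<phi> x * \<phi> x)) x $ i = \<phi> x * \<phi> x + 2 * \<phi> x * (?x x * grad \<phi> x $ i)" for x
      using s sx by (simp add: grad_mult_smooth smooth_mult grad_inner axis_def algebra_simps)
    define q where "q x = ?x x * grad \<phi> x $ i" for x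
    have L\<phi>: "L_two U \<phi>" "L_two U (grad \<phi>)" using L_two_test[OF U \<phi>] by auto
    have qc: "continuous_on UNIV q" unfolding q_def using smooth_continuous[OF sx] smooth_continuous[OF smooth_grad[OF s]]
      by (intro continuous_on_mult)
    have Lq: "L_two U q" using U qc by (intro L_two_continuous)
    have "L_two_norm U q \<le> D * L_two_norm U (grad \<phi>)"
    proof (rule L_two_norm_mono[OF L\<phi>(2)])
      show "AE x in lebesgue_on U. norm (q x) \<le> D * norm (grad \<phi> x)"
      proof (rule AE_I2)
        fix x assume "x \<in> space (lebesgue_on U)"
        then have "norm x \<le> D" using D by simp
        then have "\<bar>?x x\<bar> \<le> D" using component_le_norm_cart[of x i] by (simp add: inner_axis')
        then show "norm (q x) \<le> D * norm (grad \<phi> x)"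
          unfolding q_def using D by (auto simp: abs_mult intro!: mult_mono component_le_norm_cart)
      qed
    qed (use D qc in \<open>auto simp: continuous_borel_measurable_on\<close>)
    have "0 = (LINT x|lebesgue_on U. grad (\<lambda>x. ?x x * (\<phi> x * \<phi> x)) x $ i)"
      by (rule test_function_integral_grad[symmetric, OF U(1)])
        (intro test_function_mult_left[OF test_function_mult_left[OF \<phi> s] sx])
    also have "\<dots> = L_two_inner U \<phi> \<phi> + 2 * L_two_inner U \<phi> q"
      using L_two_integrable_inner[OF L\<phi>(1) L\<phi>(1)] L_two_integrable_inner[OF L\<phi>(1) Lq]
      unfolding g by (simp add: L_two_inner_def q_def mult.assoc)
    finally have "(L_two_norm U \<phi>)\<^sup>2 = - 2 * L_two_inner U \<phi> q" by (simp add: L_two_norm_power2)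
    also have "\<dots> \<le> 2 * (L_two_norm U \<phi> * L_two_norm U q)" using L_two_inner_le[OF L\<phi>(1) Lq] by simp
    also have "\<dots> \<le> 2 * (L_two_norm U \<phi> * (D * L_two_norm U (grad \<phi>)))"
      using \<open>L_two_norm U q \<le> _\<close> by (intro mult_left_mono) (auto simp: L_two_norm_nonneg)
    finally have "L_two_norm U \<phi> * L_two_norm U \<phi> \<le> L_two_norm U \<phi> * (2 * D * L_two_norm U (grad \<phi>))"
      by (simp add: power2_eq_square algebra_simps)
    moreover have "0 \<le> 2 * D * L_two_norm U (grad \<phi>)" using D by (simp add: L_two_norm_nonneg)
    ultimately show ?thesis
      using L_two_norm_nonneg[of U \<phi>] mult_left_le_imp_le[of "L_two_norm U \<phi>" "L_two_norm U \<phi>"]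
      by (cases "L_two_norm U \<phi> = 0") auto
  qed
  then show ?thesis using that[of "2 * D"] D by simp
qed

lemma W12_norm_le_grad:
  fixes U :: "(real^'n) set"
  assumes U: "open U" "bounded U"
  obtains P where "P > 0" "\<And>u. W12_0 U u \<Longrightarrow> L_two_norm U u \<le> P * L_two_norm U (weak_grad U u)"
    "\<And>u. W12_0 U u \<Longrightarrow> W12_norm U u \<le> P * L_two_norm U (weak_grad U u)"
proof -
  obtain P where P: "P > 0" "\<And>\<phi>. test_function U \<phi> \<Longrightarrow> L_two_norm U \<phi> \<le> P * L_two_norm U (grad \<phi>)"
    using Poincare_test[OF U] by blast
  have *: "L_two_norm U u \<le> P * L_two_norm U (weak_grad U u)" if u: "W12_0 U u" for u
  proof (rule field_le_epsilon)
    fix e :: real assume e: "e > 0"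
    define d where "d = e / (1 + P)"
    have d: "d > 0" "d * (1 + P) = e" using e P by (auto simp: d_def)
    obtain \<phi> where \<phi>: "test_function U \<phi>" "L_two_norm U (\<lambda>x. u x - \<phi> x) < d"
      "L_two_norm U (\<lambda>x. weak_grad U u x - grad \<phi> x) < d" using W12_0_approx[OF U u d(1)] by metis
    note L = W12_0_L_two[OF u] L_two_test[OF U \<phi>(1)]
    have "L_two_norm U u \<le> L_two_norm U (\<lambda>x. u x - \<phi> x) + L_two_norm U \<phi>"
      using L_two_norm_triangle[OF L_two_diff[OF L(1) L(3)] L(3)] by simp
    also have "\<dots> \<le> d + P * L_two_norm U (grad \<phi>)" using \<phi> P by (intro add_mono) auto
    also have "L_two_norm U (grad \<phi>) \<le> L_two_norm U (\<lambda>x. grad \<phi> x - weak_grad U u x) + L_two_norm U (weak_grad U u)"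
      using L_two_norm_triangle[OF L_two_diff[OF L(4) L(2)] L(2)] by simp
    also have "\<dots> \<le> d + L_two_norm U (weak_grad U u)"
      using \<phi>(3) by (simp add: L_two_norm_minus_commute[of U "grad \<phi>"])
    finally show "L_two_norm U u \<le> P * L_two_norm U (weak_grad U u) + e"
      using P d by (simp add: algebra_simps)
  qed
  have "W12_norm U u \<le> (P + 1) * L_two_norm U (weak_grad U u)" if u: "W12_0 U u" for u
  proof -
    have "W12_norm U u \<le> \<bar>L_two_norm U u\<bar> + \<bar>L_two_norm U (weak_grad U u)\<bar>"
      unfolding W12_norm_def by (rule sqrt_sum_squares_le_sum_abs)
    then show ?thesis using *[OF u] by (simp add: L_two_norm_nonneg algebra_simps)
  qed
  moreover have "L_two_norm U u \<le> (P + 1) * L_two_norm U (weak_grad U u)" if u: "W12_0 U u" for u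
    using *[OF u] L_two_norm_nonneg[of U "weak_grad U u"] by (simp add: algebra_simps)
  ultimately show ?thesis using that[of "P + 1"] P by simp
qed

section \<open>The Dirichlet problem with constant coefficients\<close>

lemma W12_dual_diff:
  assumes U: "open U" "bounded U" and F: "W12_dual U F" and "W12_0 U u" "W12_0 U v"
  shows "F (\<lambda>x. u x - v x) = F u - F v"
proof -
  have "F (\<lambda>x. 1 * u x + (-1) * v x) = 1 * F u + (-1) * F v"
    using assms unfolding W12_dual_def by blast
  then show ?thesis by simp
qed

lemma W12_dual_bound:
  assumes "open U" "bounded U" "W12_dual U F"
  obtains C where "C > 0" "\<And>u. W12_0 U u \<Longrightarrow> \<bar>F u\<bar> \<le> C * W12_norm U u"
proof -
  obtain C where C: "\<And>u. W12_0 U u \<Longrightarrow> \<bar>F u\<bar> \<le> C * W12_norm U u"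
    using assms(3) unfolding W12_dual_def by blast
  have "\<bar>F u\<bar> \<le> (\<bar>C\<bar> + 1) * W12_norm U u" if "W12_0 U u" for u
  proof -
    have "C * W12_norm U u \<le> (\<bar>C\<bar> + 1) * W12_norm U u"
      by (intro mult_right_mono) (auto simp: W12_norm_def)
    with C[OF that] show ?thesis by linarith
  qed
  then show ?thesis using that[of "\<bar>C\<bar> + 1"] by simp
qed

text \<open>Both sides are continuous in the energy norm, in which test functions are dense.\<close>

lemma weak_equation_from_test_functions:
  assumes U: "open U" "bounded U" and F: "W12_dual U F" and q: "L_two U q"
    and eq: "\<And>\<psi>. test_function U \<psi> \<Longrightarrow> L_two_inner U q (grad \<psi>) = F \<psi>"
    and v: "W12_0 U v"
  shows "L_two_inner U q (weak_grad U v) = F v"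
proof -
  obtain C where C: "C > 0" "\<And>u. W12_0 U u \<Longrightarrow> \<bar>F u\<bar> \<le> C * W12_norm U u"
    using W12_dual_bound[OF U F] by blast
  have "\<bar>L_two_inner U q (weak_grad U v) - F v\<bar> \<le> e" if e: "e > 0" for e
  proof -
    let ?N = "L_two_norm U q"
    define d where "d = e / (?N + C)"
    have pos: "?N + C > 0" using C L_two_norm_nonneg[of U q] by linarith
    then have d: "d > 0" "d * (?N + C) = e" using e by (auto simp: d_def)
    obtain \<phi> where \<phi>: "test_function U \<phi>" "L_two_norm U (\<lambda>x. weak_grad U v x - grad \<phi> x) < d"
      "W12_norm U (\<lambda>x. v x - \<phi> x) < d" using W12_0_approx[OF U v d(1)] by metis
    have \<phi>0: "W12_0 U \<phi>" by (rule W12_0_test[OF U \<phi>(1)])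
    note L = W12_0_L_two[OF v] L_two_test[OF U \<phi>(1)]
    have "L_two_inner U q (weak_grad U v) - F v
        = L_two_inner U q (\<lambda>x. weak_grad U v x - grad \<phi> x) - F (\<lambda>x. v x - \<phi> x)"
      using eq[OF \<phi>(1)] W12_dual_diff[OF U F v \<phi>0] L q by (simp add: L_two_inner_diff_right)
    also have "\<bar>\<dots>\<bar> \<le> \<bar>L_two_inner U q (\<lambda>x. weak_grad U v x - grad \<phi> x)\<bar> + \<bar>F (\<lambda>x. v x - \<phi> x)\<bar>" by simp
    also have "\<dots> \<le> ?N * d + C * d"
    proof (rule add_mono)
      show "\<bar>L_two_inner U q (\<lambda>x. weak_grad U v x - grad \<phi> x)\<bar> \<le> ?N * d"
        by (rule order_trans[OF L_two_inner_le[OF q L_two_diff[OF L(2) L(4)]]])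
          (use \<phi> in \<open>auto intro!: mult_left_mono simp: L_two_norm_nonneg\<close>)
      show "\<bar>F (\<lambda>x. v x - \<phi> x)\<bar> \<le> C * d"
        by (rule order_trans[OF C(2)[OF W12_0_diff[OF U v \<phi>0]]])
          (use \<phi> C in \<open>auto intro!: mult_left_mono\<close>)
    qed
    also have "\<dots> = e" using d by (simp add: algebra_simps)
    finally show ?thesis .
  qed
  then have "\<bar>L_two_inner U q (weak_grad U v) - F v\<bar> \<le> 0" by (rule field_le_epsilon) simp
  then show ?thesis by simp
qed

text \<open>Approximate solutions among the test functions form a Cauchy sequence: for two of them, coercivity bounds the
  square of the difference of gradients by the sum of the residuals times that difference. Poincare's inequality and the
  completeness of \<open>L\<^sup>2\<close> provide the limit.\<close>

theorem dirichlet_solution_exists: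
  fixes A :: "real^'n^'n"
  assumes U: "open U" "bounded U" and c: "c > 0" and A: "\<And>\<xi>. c * (norm \<xi>)\<^sup>2 \<le> (A *v \<xi>) \<bullet> \<xi>"
    and F: "W12_dual U F"
  obtains u where "dirichlet_solution U (\<lambda>_. A) F u"
proof -
  let ?b = "\<lambda>\<phi> \<psi>. L_two_inner U (grad \<phi>) (grad \<psi>)"
  let ?a = "\<lambda>\<phi> \<psi>. L_two_inner U (\<lambda>x. A *v grad \<phi> x) (grad \<psi>)"
  define M where "M = max c (norm A)"
  have nrm: "sqrt (L_two_inner U (grad \<phi>) (grad \<phi>)) = L_two_norm U (grad \<phi>)" for \<phi> :: "real^'n \<Rightarrow> real"
    using L_two_norm_nonneg[of U "grad \<phi>"] by (simp flip: L_two_norm_power2)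
  have lin: "grad (\<lambda>x. \<phi> x + t * \<psi> x) = (\<lambda>x. grad \<phi> x + t *\<^sub>R grad \<psi> x)"
    if "test_function U \<phi>" "test_function U \<psi>" for \<phi> \<psi> t
    using that by (auto simp: grad_add_smooth grad_cmult test_function_smooth smooth_cmult)
  have L: "L_two U (grad \<phi>)" "L_two U (\<lambda>x. A *v grad \<phi> x)" if "test_function U \<phi>" for \<phi>
    using L_two_test[OF U that] L_two_matrix by auto
  have coer: "c * L_two_inner U (grad \<phi>) (grad \<phi>) \<le> L_two_inner U (\<lambda>x. A *v grad \<phi> x) (grad \<phi>)"
    if \<phi>: "test_function U \<phi>" for \<phi>
  proof -
    have "(LINT x|lebesgue_on U. c * (grad \<phi> x \<bullet> grad \<phi> x)) \<le> (LINT x|lebesgue_on U. (A *v grad \<phi> x) \<bullet> grad \<phi> x)"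
      using L[OF \<phi>] A L_two_integrable_inner
      by (intro integral_mono) (auto simp: power2_norm_eq_inner)
    then show ?thesis by (simp add: L_two_inner_def)
  qed
  interpret coercive_form "{\<phi>. test_function U \<phi>}" ?b ?a c M
  proof
    show "\<bar>?a \<phi> \<psi>\<bar> \<le> M * sqrt (?b \<phi> \<phi>) * sqrt (?b \<psi> \<psi>)" if "\<phi> \<in> {\<phi>. test_function U \<phi>}" "\<psi> \<in> {\<phi>. test_function U \<phi>}" for \<phi> \<psi>
    proof -
      have "\<bar>?a \<phi> \<psi>\<bar> \<le> L_two_norm U (\<lambda>x. A *v grad \<phi> x) * L_two_norm U (grad \<psi>)"
        using that L by (intro L_two_inner_le) auto
      also have "\<dots> \<le> (M * L_two_norm U (grad \<phi>)) * L_two_norm U (grad \<psi>)"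
      proof (rule mult_right_mono)
        have "L_two_norm U (\<lambda>x. A *v grad \<phi> x) \<le> norm A * L_two_norm U (grad \<phi>)"
          using that L by (intro L_two_matrix(2)) auto
        also have "\<dots> \<le> M * L_two_norm U (grad \<phi>)"
          by (intro mult_right_mono) (auto simp: M_def L_two_norm_nonneg)
        finally show "L_two_norm U (\<lambda>x. A *v grad \<phi> x) \<le> M * L_two_norm U (grad \<phi>)" .
      qed (rule L_two_norm_nonneg)
      finally show ?thesis by (simp add: nrm)
    qed
    show "0 \<le> ?b \<phi> \<phi>" for \<phi> by (simp flip: L_two_norm_power2)
  qed (use L coer c in \<open>auto simp: test_function_zero lin matrix_vector_right_distrib
      matrix_vector_mult_scaleR L_two_scaleR
      L_two_inner_add_left L_two_inner_add_right L_two_inner_scaleR_left L_two_inner_scaleR_right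
      intro!: test_function_add test_function_cmult L_two_inner_commute\<close>)
  obtain C where C: "C > 0" "\<And>u. W12_0 U u \<Longrightarrow> \<bar>F u\<bar> \<le> C * W12_norm U u"
    using W12_dual_bound[OF U F] by blast
  obtain P where P: "P > 0" "\<And>u. W12_0 U u \<Longrightarrow> L_two_norm U u \<le> P * L_two_norm U (weak_grad U u)"
    "\<And>u. W12_0 U u \<Longrightarrow> W12_norm U u \<le> P * L_two_norm U (weak_grad U u)"
    using W12_norm_le_grad[OF U] by blast
  have wg: "L_two_norm U (weak_grad U \<phi>) = L_two_norm U (grad \<phi>)" if "test_function U \<phi>" for \<phi>
    by (rule weak_grad_norm_eq[OF U test_has_weak_grad[OF U that]])
  have "functional F (C * P)"
    unfolding functional_def
  proof (intro conjI ballI allI)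
    fix \<phi> \<psi> :: "real^'n \<Rightarrow> real" and t assume "\<phi> \<in> {\<phi>. test_function U \<phi>}" "\<psi> \<in> {\<phi>. test_function U \<phi>}"
    then have "F (\<lambda>x. 1 * \<phi> x + t * \<psi> x) = 1 * F \<phi> + t * F \<psi>"
      using F W12_0_test[OF U] unfolding W12_dual_def by blast
    then show "F (\<lambda>x. \<phi> x + t * \<psi> x) = F \<phi> + t * F \<psi>" by simp
  next
    fix \<phi> :: "real^'n \<Rightarrow> real" assume "\<phi> \<in> {\<phi>. test_function U \<phi>}"
    then have \<phi>: "test_function U \<phi>" "W12_0 U \<phi>" using W12_0_test[OF U] by auto
    have "\<bar>F \<phi>\<bar> \<le> C * W12_norm U \<phi>" by (rule C(2)[OF \<phi>(2)])
    also have "\<dots> \<le> C * (P * L_two_norm U (weak_grad U \<phi>))" using C P(3)[OF \<phi>(2)] by (intro mult_left_mono) auto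
    finally show "\<bar>F \<phi>\<bar> \<le> C * P * sqrt (?b \<phi> \<phi>)" by (simp add: nrm wg[OF \<phi>(1)])
  qed
  note LM = approximate_Lax_Milgram[OF this, unfolded nrm]
  define e where "e n = inverse (real (Suc n))" for n
  have e: "e n > 0" for n by (simp add: e_def)
  have e0: "e \<longlonglongrightarrow> 0" unfolding e_def by (rule LIMSEQ_inverse_real_of_nat)
  have "\<forall>n. \<exists>\<phi>. test_function U \<phi> \<and> (\<forall>\<psi>. test_function U \<psi> \<longrightarrow> \<bar>F \<psi> - ?a \<phi> \<psi>\<bar> \<le> e n * L_two_norm U (grad \<psi>))"
    using LM[OF e] by (auto simp: M_def)
  then obtain \<phi> where \<phi>: "\<And>n. test_function U (\<phi> n)"
    and res: "\<And>n \<psi>. test_function U \<psi> \<Longrightarrow> \<bar>F \<psi> - ?a (\<phi> n) \<psi>\<bar> \<le> e n * L_two_norm U (grad \<psi>)" by metis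
  have dtest: "test_function U (\<lambda>x. \<phi> m x + (-1) * \<phi> n x)" for m n
    using \<phi> by (intro test_function_add test_function_cmult)
  have dgrad: "grad (\<lambda>x. \<phi> m x + (-1) * \<phi> n x) = (\<lambda>x. grad (\<phi> m) x - grad (\<phi> n) x)" for m n
    by (simp only: lin[OF \<phi> \<phi>]) simp
  have cau: "L_two_norm U (\<lambda>x. grad (\<phi> m) x - grad (\<phi> n) x) \<le> (e m + e n) / c" for m n
  proof -
    let ?w = "\<lambda>x. \<phi> m x + (-1) * \<phi> n x"
    let ?W = "L_two_norm U (grad ?w)"
    have "c * ?W\<^sup>2 \<le> ?a ?w ?w" using coer[OF dtest] by (simp add: L_two_norm_power2)
    also have "\<dots> = ?a (\<phi> m) ?w + (-1) * ?a (\<phi> n) ?w" by (rule a_lin_left) (use \<phi> dtest in auto)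
    also have "\<dots> \<le> (e m + e n) * ?W"
      using res[OF dtest, of m n m] res[OF dtest, of m n n] by (simp add: distrib_right)
    finally have "(c * ?W) * ?W \<le> (e m + e n) * ?W" by (simp add: power2_eq_square mult.assoc)
    then have "c * ?W \<le> e m + e n" using L_two_norm_nonneg[of U "grad ?w"] e[of m] e[of n] c
        mult_right_le_imp_le[of "c * ?W" ?W "e m + e n"] by (cases "?W = 0") auto
    then show ?thesis using c unfolding dgrad by (simp add: field_simps)
  qed
  have cauchy: "\<exists>N. \<forall>m\<ge>N. \<forall>n\<ge>N. K * ((e m + e n) / c) < d" if "d > 0" "K > 0" for d K
  proof -
    have "(\<lambda>n. 2 * K / c * e n) \<longlonglongrightarrow> 2 * K / c * 0" by (intro tendsto_intros e0)
    then have "eventually (\<lambda>n. 2 * K / c * e n < d) sequentially"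
      using \<open>d > 0\<close> by (intro order_tendstoD(2)) auto
    then obtain N where N: "2 * K / c * e N < d" by (auto simp: eventually_sequentially)
    have "K * ((e m + e n) / c) < d" if "m \<ge> N" "n \<ge> N" for m n
    proof -
      have "e j \<le> e N" if "j \<ge> N" for j using that unfolding e_def by (intro le_imp_inverse_le) auto
      then have "e m + e n \<le> 2 * e N" using that by (metis add_mono mult_2)
      then have "K * ((e m + e n) / c) \<le> K * (2 * e N / c)"
        using c \<open>K > 0\<close> by (intro mult_left_mono divide_right_mono) auto
      then show ?thesis using N by (simp add: mult.commute mult.left_commute)
    qed
    then show ?thesis by blast
  qed
  have Um: "U \<in> lmeasurable" using U by (rule bounded_open_lmeasurable)
  have "\<exists>g. L_two U g \<and> (\<lambda>n. L_two_norm U (\<lambda>x. grad (\<phi> n) x - g x)) \<longlonglongrightarrow> 0"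
  proof (rule L_two_complete[OF Um L(1)[OF \<phi>]])
    fix d :: real assume "d > 0"
    from cauchy[OF this zero_less_one] obtain N where N: "\<forall>m\<ge>N. \<forall>n\<ge>N. 1 * ((e m + e n) / c) < d" ..
    show "\<exists>N. \<forall>m\<ge>N. \<forall>n\<ge>N. L_two_norm U (\<lambda>x. grad (\<phi> m) x - grad (\<phi> n) x) < d"
      by (intro exI[of _ N] allI impI order_le_less_trans[OF cau]) (use N in auto)
  qed
  then obtain g where g: "L_two U g" "(\<lambda>n. L_two_norm U (\<lambda>x. grad (\<phi> n) x - g x)) \<longlonglongrightarrow> 0" by blast
  have "\<exists>u. L_two U u \<and> (\<lambda>n. L_two_norm U (\<lambda>x. \<phi> n x - u x)) \<longlonglongrightarrow> 0"
  proof (rule L_two_complete[OF Um])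
    show "L_two U (\<phi> n)" for n using L_two_test[OF U \<phi>] by auto
    fix d :: real assume "d > 0"
    have est: "L_two_norm U (\<lambda>x. \<phi> m x - \<phi> n x) \<le> P * ((e m + e n) / c)" for m n
    proof -
      have "L_two_norm U (\<lambda>x. \<phi> m x + (-1) * \<phi> n x) \<le> P * L_two_norm U (grad (\<lambda>x. \<phi> m x + (-1) * \<phi> n x))"
        using P(2)[OF W12_0_test[OF U dtest]] wg[OF dtest] by simp
      also have "\<dots> \<le> P * ((e m + e n) / c)" unfolding dgrad using cau P by (intro mult_left_mono) auto
      finally show ?thesis by simp
    qed
    obtain N where N: "\<forall>m\<ge>N. \<forall>n\<ge>N. P * ((e m + e n) / c) < d" using cauchy[OF \<open>d > 0\<close> P(1)] ..
    show "\<exists>N. \<forall>m\<ge>N. \<forall>n\<ge>N. L_two_norm U (\<lambda>x. \<phi> m x - \<phi> n x) < d"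
      by (intro exI[of _ N] allI impI order_le_less_trans[OF est]) (use N in auto)
  qed
  then obtain u where u: "L_two U u" "(\<lambda>n. L_two_norm U (\<lambda>x. \<phi> n x - u x)) \<longlonglongrightarrow> 0" by blast
  have uw: "has_weak_grad U u g" and u0: "W12_0 U u" using W12_0_limit[OF U \<phi> u(1) g(1) u(2) g(2)] by auto
  have Ag: "L_two U (\<lambda>x. A *v g x)" by (rule L_two_matrix(1)[OF g(1)])
  have eqt: "L_two_inner U (\<lambda>x. A *v g x) (grad \<psi>) = F \<psi>" if \<psi>: "test_function U \<psi>" for \<psi>
  proof -
    have "(\<lambda>n. ?a (\<phi> n) \<psi>) \<longlonglongrightarrow> L_two_inner U (\<lambda>x. A *v g x) (grad \<psi>)"
    proof (rule L_two_inner_tendsto[OF L(2)[OF \<phi>] Ag L(1)[OF \<psi>]], rule Lim_null_comparison)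
      show "\<forall>\<^sub>F n in sequentially. norm (L_two_norm U (\<lambda>x. A *v grad (\<phi> n) x - A *v g x)) \<le> norm A * L_two_norm U (\<lambda>x. grad (\<phi> n) x - g x)"
        using L_two_matrix(2)[OF L_two_diff[OF L(1)[OF \<phi>] g(1)], of A]
        by (simp add: matrix_vector_mult_diff_distrib L_two_norm_nonneg)
      show "(\<lambda>n. norm A * L_two_norm U (\<lambda>x. grad (\<phi> n) x - g x)) \<longlonglongrightarrow> 0"
        using tendsto_mult[OF tendsto_const g(2), of "norm A"] by simp
    qed
    moreover have "(\<lambda>n. ?a (\<phi> n) \<psi>) \<longlonglongrightarrow> F \<psi>"
    proof (rule LIM_zero_cancel, rule Lim_null_comparison)
      show "\<forall>\<^sub>F n in sequentially. norm (?a (\<phi> n) \<psi> - F \<psi>) \<le> e n * L_two_norm U (grad \<psi>)"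
        using res[OF \<psi>] by (simp add: abs_minus_commute)
      show "(\<lambda>n. e n * L_two_norm U (grad \<psi>)) \<longlonglongrightarrow> 0" using tendsto_mult[OF e0 tendsto_const] by simp
    qed
    ultimately show ?thesis by (rule LIMSEQ_unique)
  qed
  have "L_two_inner U (\<lambda>x. A *v weak_grad U u x) (weak_grad U v) = F v" if v: "W12_0 U v" for v
  proof -
    have "L_two_inner U (\<lambda>x. A *v weak_grad U u x) (weak_grad U v) = L_two_inner U (weak_grad U u) (\<lambda>x. transpose A *v weak_grad U v x)"
      by (simp add: L_two_inner_def inner_matrix_transpose)
    also have "\<dots> = L_two_inner U g (\<lambda>x. transpose A *v weak_grad U v x)"
      by (rule weak_grad_inner_eq(2)[OF U uw L_two_matrix(1)[OF W12_0_L_two(2)[OF v]]])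
    also have "\<dots> = L_two_inner U (\<lambda>x. A *v g x) (weak_grad U v)"
      by (simp add: L_two_inner_def inner_matrix_transpose)
    also have "\<dots> = F v" by (rule weak_equation_from_test_functions[OF U F Ag eqt v])
    finally show ?thesis .
  qed
  then have "dirichlet_solution U (\<lambda>_. A) F u"
    using u0 by (simp add: dirichlet_solution_def L_two_inner_def)
  then show ?thesis by (rule that)
qed

section \<open>Trigonometric polynomials\<close>

text \<open>The phase \<open>\<theta>\<close> makes a single generator suffice: sines are cosines with a shifted phase, a derivative shifts the
  phase by \<open>pi / 2\<close>, and a product of two generators is a sum of two generators. Everything stays real,
  as test functions of the local problem have to be.\<close>

inductive trig_poly :: "(real^'m \<Rightarrow> real) \<Rightarrow> bool" where
  trig_poly_cos: "trig_poly (\<lambda>y. a * cos (((2 * pi) *\<^sub>R int_vec l) \<bullet> y + \<theta>))"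
| trig_poly_add: "trig_poly f \<Longrightarrow> trig_poly g \<Longrightarrow> trig_poly (\<lambda>y. f y + g y)"

lemma int_vec_0 [simp]: "int_vec 0 = 0"
  by (simp add: int_vec_def vec_eq_iff)

lemma int_vec_add: "int_vec (k + l) = int_vec k + int_vec l"
  and int_vec_diff: "int_vec (k - l) = int_vec k - int_vec l"
  and int_vec_minus: "int_vec (- l) = - int_vec l"
  by (simp_all add: int_vec_def vec_eq_iff)

lemma int_vec_axis: "int_vec (axis i 1) = axis i 1"
  by (simp add: int_vec_def vec_eq_iff axis_def)

lemma trig_poly_const: "trig_poly (\<lambda>y. c)"
  using trig_poly_cos[of c 0 0] by simp

lemma trig_poly_cmult: "trig_poly f \<Longrightarrow> trig_poly (\<lambda>y. c * f y)"
proof (induction rule: trig_poly.induct)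
  case (trig_poly_cos a l \<theta>)
  show ?case using trig_poly.trig_poly_cos[of "c * a" l \<theta>] by (simp add: mult.assoc)
next
  case (trig_poly_add f g)
  then show ?case using trig_poly.trig_poly_add by (simp add: distrib_left)
qed

lemma trig_poly_cos_mult:
  assumes "trig_poly g"
  shows "trig_poly (\<lambda>y. (a * cos (((2 * pi) *\<^sub>R int_vec l) \<bullet> y + \<theta>)) * g y)"
  using assms
proof (induction rule: trig_poly.induct)
  case (trig_poly_cos b k \<rho>)
  let ?A = "\<lambda>y. ((2 * pi) *\<^sub>R int_vec l) \<bullet> y + \<theta>" and ?B = "\<lambda>y. ((2 * pi) *\<^sub>R int_vec k) \<bullet> y + \<rho>"
  have "trig_poly (\<lambda>y. a * b / 2 * cos (((2 * pi) *\<^sub>R int_vec (l - k)) \<bullet> y + (\<theta> - \<rho>))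
      + a * b / 2 * cos (((2 * pi) *\<^sub>R int_vec (l + k)) \<bullet> y + (\<theta> + \<rho>)))"
    by (intro trig_poly.intros)
  moreover have "a * b / 2 * cos (((2 * pi) *\<^sub>R int_vec (l - k)) \<bullet> y + (\<theta> - \<rho>))
      + a * b / 2 * cos (((2 * pi) *\<^sub>R int_vec (l + k)) \<bullet> y + (\<theta> + \<rho>))
      = (a * cos (?A y)) * (b * cos (?B y))" for y
  proof -
    have "((2 * pi) *\<^sub>R int_vec (l - k)) \<bullet> y + (\<theta> - \<rho>) = ?A y - ?B y"
      "((2 * pi) *\<^sub>R int_vec (l + k)) \<bullet> y + (\<theta> + \<rho>) = ?A y + ?B y"
      by (simp_all add: int_vec_diff int_vec_add inner_diff_left inner_add_left algebra_simps)
    moreover have "a * b / 2 * cos (A - B) + a * b / 2 * cos (A + B) = (a * cos A) * (b * cos B)" for A B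
      by (simp add: cos_add cos_diff field_simps)
    ultimately show ?thesis by (simp only:)
  qed
  ultimately show ?case by simp
next
  case (trig_poly_add f g)
  then show ?case using trig_poly.trig_poly_add by (simp add: distrib_left)
qed

lemma trig_poly_mult: "trig_poly f \<Longrightarrow> trig_poly g \<Longrightarrow> trig_poly (\<lambda>y. f y * g y)"
proof (induction rule: trig_poly.induct)
  case (trig_poly_cos a l \<theta>)
  then show ?case by (rule trig_poly_cos_mult)
next
  case (trig_poly_add f f')
  then show ?case using trig_poly.trig_poly_add by (simp add: distrib_right)
qed

lemma trig_poly_sum: "finite I \<Longrightarrow> (\<And>i. i \<in> I \<Longrightarrow> trig_poly (f i)) \<Longrightarrow> trig_poly (\<lambda>y. \<Sum>i\<in>I. f i y)"
  by (induction rule: finite_induct) (auto simp: trig_poly_const intro!: trig_poly_add)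

lemma trig_poly_smooth: "trig_poly f \<Longrightarrow> smooth f"
proof (induction rule: trig_poly.induct)
  case (trig_poly_cos a l \<theta>)
  show ?case by (rule smooth_cos_ridge)
qed (rule smooth_add)

lemma trig_poly_grad: "trig_poly f \<Longrightarrow> trig_poly (\<lambda>y. grad f y $ i)"
proof (induction rule: trig_poly.induct)
  case (trig_poly_cos a l \<theta>)
  show ?case
    using trig_poly.trig_poly_cos[of "a * (2 * pi * int_vec l $ i)" l "\<theta> + pi / 2"]
    unfolding grad_cos_ridge by (simp add: mult_ac add.assoc)
next
  case (trig_poly_add f g)
  then show ?case using trig_poly.trig_poly_add by (simp add: grad_add_smooth trig_poly_smooth)
qed

lemma trig_poly_periodic: "trig_poly f \<Longrightarrow> f (y + int_vec k) = f y"
proof (induction rule: trig_poly.induct)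
  case (trig_poly_cos a l \<theta>)
  have "int_vec l \<bullet> int_vec k = of_int (\<Sum>i\<in>UNIV. l $ i * k $ i)"
    by (simp add: int_vec_def inner_vec_def)
  then have "((2 * pi) *\<^sub>R int_vec l) \<bullet> (y + int_vec k) + \<theta>
      = (((2 * pi) *\<^sub>R int_vec l) \<bullet> y + \<theta>) + 2 * pi * of_int (\<Sum>i\<in>UNIV. l $ i * k $ i)"
    by (simp add: inner_add_right algebra_simps)
  then show ?case by (simp only: cos_add sin_int_2pin cos_int_2pin) simp
qed auto

lemma trig_poly_W12_per:
  assumes "trig_poly f" shows "W12_per f"
  unfolding W12_per_def periodic_def W12_def
  using trig_poly_periodic[OF assms] smooth_has_weak_grad[OF _ _ trig_poly_smooth[OF assms]] by blast

subsection \<open>Mean values over the cell\<close>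

lemma One_nth: "(One :: real^'m) $ i = 1"
  using inner_sum_left_Basis[of "axis i 1 :: real^'m" "\<lambda>_. 1"]
  by (simp add: axis_in_Basis_iff inner_axis)

lemma unit_cell_eq: "unit_cell = box 0 One"
  by (rule set_eqI) (simp only: unit_cell_def mem_box_cart One_nth zero_index mem_Collect_eq)

lemma unit_cell_open: "open unit_cell" and unit_cell_bounded: "bounded unit_cell"
  unfolding unit_cell_eq by (rule open_box, rule bounded_box)

lemma unit_cell_sets: "unit_cell \<in> sets lebesgue"
  unfolding unit_cell_eq by simp

lemma measure_unit_cell: "measure lebesgue (unit_cell :: (real^'m) set) = 1"
  by (simp add: unit_cell_eq)

lemma integral_cis_unit_interval:
  fixes k :: int
  assumes "k \<noteq> 0"
  shows "(LINT s|lborel. indicator {0..1} s *\<^sub>R cis (2 * pi * of_int k * s)) = 0"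
proof -
  define w where "w = 2 * pi * of_int k"
  have w: "w \<noteq> 0" using assms by (simp add: w_def)
  have d: "((\<lambda>s. cis (w * s) / (\<i> * w)) has_vector_derivative cis (w * s)) (at s within {0..1})" for s
    unfolding has_vector_derivative_complex_iff using w
    by (auto intro!: derivative_eq_intros simp: cis.code complex_eq_iff Re_divide Im_divide power2_eq_square)
  have "((\<lambda>s. cis (w * s)) has_integral (cis (w * 1) / (\<i> * w) - cis (w * 0) / (\<i> * w))) {0..1}"
    by (rule fundamental_theorem_of_calculus) (use d in auto)
  moreover have "cis (w * 1) = 1" by (simp add: w_def cis.code complex_eq_iff sin_int_2pin cos_int_2pin)
  ultimately have "integral {0..1} (\<lambda>s. cis (w * s)) = 0" by (simp add: integral_unique)
  moreover have "set_integrable lborel {0..1} (\<lambda>s. cis (w * s))"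
    unfolding set_integrable_def by (rule borel_integrable_compact) (auto intro!: continuous_intros)
  then have "(LINT s:{0..1}|lborel. cis (w * s)) = integral {0..1} (\<lambda>s. cis (w * s))"
    by (rule set_borel_integral_eq_integral)
  ultimately show ?thesis by (simp add: set_lebesgue_integral_def w_def)
qed

text \<open>The complex exponential is a product of functions of one coordinate each, and the factor belonging to a nonzero
  frequency integrates to zero.\<close>

lemma integral_cis_unit_cube:
  fixes l :: "int^'m"
  assumes "l \<noteq> 0"
  shows "(LINT y|lborel. indicator (cbox 0 One) y *\<^sub>R cis (2 * pi * (int_vec l \<bullet> y))) = 0"
proof -
  let ?B = "Basis :: (real^'m) set"
  define F where "F b s = indicator {0..1} s *\<^sub>R cis (2 * pi * (int_vec l \<bullet> b) * s)" for b :: "real^'m" and s :: real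
  interpret product_sigma_finite "\<lambda>_::real^'m. lborel :: real measure" ..
  have Fi: "integrable lborel (F b)" for b
    unfolding F_def by (rule borel_integrable_compact) (auto intro!: continuous_intros)
  obtain i where i: "l $ i \<noteq> 0" using assms by (auto simp: vec_eq_iff)
  have prod: "indicator (cbox 0 One) y *\<^sub>R cis (2 * pi * (int_vec l \<bullet> y)) = (\<Prod>b\<in>?B. F b (f b))"
    if y: "y = (\<Sum>b\<in>?B. f b *\<^sub>R b)" for y f
  proof -
    have yb: "y \<bullet> b = f b" if "b \<in> ?B" for b unfolding y using that by (rule inner_sum_left_Basis)
    show ?thesis
    proof (cases "y \<in> cbox 0 One")
      case True
      then have "F b (f b) = cis (2 * pi * (int_vec l \<bullet> b) * f b)" if "b \<in> ?B" for b
        using that by (auto simp: F_def mem_box yb)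
      then have "(\<Prod>b\<in>?B. F b (f b)) = (\<Prod>b\<in>?B. exp (\<i> * complex_of_real (2 * pi * (int_vec l \<bullet> b) * f b)))"
        by (intro prod.cong) (auto simp: cis_conv_exp)
      also have "\<dots> = exp (\<i> * complex_of_real (2 * pi * (int_vec l \<bullet> y)))"
        unfolding exp_sum[OF finite_Basis, symmetric] y
        by (simp add: inner_sum_right sum_distrib_left mult_ac)
      finally show ?thesis using True by (simp add: cis_conv_exp)
    next
      case False
      then obtain b where b: "b \<in> ?B" "f b \<notin> {0..1}" by (auto simp: mem_box yb)
      then have "F b (f b) = 0" by (simp add: F_def)
      then have "(\<Prod>b'\<in>?B. F b' (f b')) = 0" using b(1) by (intro prod_zero) auto
      then show ?thesis using False by simp
    qed
  qed
  have m: "(\<lambda>y. indicator (cbox 0 One) y *\<^sub>R cis (2 * pi * (int_vec l \<bullet> y))) \<in> borel_measurable borel"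
    by (intro borel_measurable_scaleR borel_measurable_indicator borel_measurable_continuous_onI continuous_intros) auto
  have "(LINT y|lborel. indicator (cbox 0 One) y *\<^sub>R cis (2 * pi * (int_vec l \<bullet> y)))
      = (LINT f|(\<Pi>\<^sub>M b\<in>?B. lborel). (\<Prod>b\<in>?B. F b (f b)))"
    by (subst lborel_eq, subst integral_distr) (use m in \<open>auto simp: prod\<close>)
  also have "\<dots> = (\<Prod>b\<in>?B. LINT s|lborel. F b s)"
    by (rule product_integral_prod) (use Fi in auto)
  also have "\<dots> = 0"
  proof (rule prod_zero)
    have "(LINT s|lborel. F (axis i 1) s) = 0"
      using integral_cis_unit_interval[OF i] by (simp add: F_def inner_axis int_vec_def)
    then show "\<exists>b\<in>?B. (LINT s|lborel. F b s) = 0" by (intro bexI[of _ "axis i 1"]) (auto simp: axis_in_Basis_iff)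
  qed simp
  finally show ?thesis .
qed

lemma integral_unit_cell_continuous:
  fixes h :: "real^'m \<Rightarrow> real"
  assumes "continuous_on UNIV h"
  shows "(LINT y|lebesgue_on unit_cell. h y) = (LINT y|lborel. indicator (cbox 0 One) y *\<^sub>R h y)"
proof -
  have i: "integrable lborel (\<lambda>y. indicator (cbox 0 One) y *\<^sub>R h y)"
    by (rule borel_integrable_compact) (auto intro: continuous_on_subset[OF assms])
  have "L_two unit_cell h" "L_two unit_cell (\<lambda>y::real^'m. 1::real)"
    using assms by (auto intro!: L_two_continuous unit_cell_open unit_cell_bounded)
  from L_two_integrable_inner[OF this] have "(LINT y|lebesgue_on unit_cell. h y) = integral unit_cell h"
    by (intro lebesgue_integral_eq_integral unit_cell_sets) auto
  also have "\<dots> = integral (cbox 0 One) h" unfolding unit_cell_eq by (rule integral_open_interval)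
  also have "\<dots> = (LINT y:cbox 0 One|lborel. h y)"
    using i by (intro set_borel_integral_eq_integral(2)[symmetric]) (simp add: set_integrable_def)
  finally show ?thesis by (simp add: set_lebesgue_integral_def)
qed

lemma integral_cos_unit_cell:
  fixes l :: "int^'m"
  assumes "l \<noteq> 0"
  shows "(LINT y|lebesgue_on unit_cell. cos (((2 * pi) *\<^sub>R int_vec l) \<bullet> y + \<theta>)) = 0"
proof -
  let ?E = "\<lambda>y. indicator (cbox 0 One) y *\<^sub>R cis (2 * pi * (int_vec l \<bullet> y))"
  have Ei: "integrable lborel ?E"
    by (rule borel_integrable_compact) (auto intro!: continuous_intros)
  have "(LINT y|lebesgue_on unit_cell. cos (((2 * pi) *\<^sub>R int_vec l) \<bullet> y + \<theta>))
      = (LINT y|lborel. indicator (cbox 0 One) y *\<^sub>R cos (((2 * pi) *\<^sub>R int_vec l) \<bullet> y + \<theta>))"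
    by (rule integral_unit_cell_continuous) (intro continuous_intros)
  also have "\<dots> = (LINT y|lborel. Re (cis \<theta> * ?E y))"
    by (intro Bochner_Integration.integral_cong) (auto simp: indicator_def cos_add mult_ac)
  also have "\<dots> = Re (LINT y|lborel. cis \<theta> * ?E y)"
    by (rule integral_Re[OF integrable_mult_right[OF Ei]])
  also have "(LINT y|lborel. cis \<theta> * ?E y) = cis \<theta> * (LINT y|lborel. ?E y)" by (rule integral_mult_right_zero)
  also have "Re \<dots> = 0" unfolding integral_cis_unit_cube[OF assms] by simp
  finally show ?thesis .
qed

lemma unit_cell_integrable_continuous:
  fixes h :: "real^'m \<Rightarrow> real"
  assumes "continuous_on UNIV h" shows "integrable (lebesgue_on unit_cell) h"
  using L_two_integrable_inner[OF L_two_continuous[OF unit_cell_open unit_cell_bounded assms]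
      L_two_continuous[OF unit_cell_open unit_cell_bounded continuous_on_const[of _ "1::real"]]] by simp

subsection \<open>Density among the continuous periodic functions\<close>

text \<open>A continuous periodic function is a continuous function on the torus, realised as a compact
  subset of a Euclidean space, and the polynomials in the coordinates of this embedding pull back to
  trigonometric polynomials.\<close>

lemma trig_poly_approx:
  fixes p :: "real^'m \<Rightarrow> real"
  assumes per: "periodic p" and cont: "continuous_on UNIV p" and e: "e > 0"
  obtains q where "trig_poly q" "\<And>y. \<bar>p y - q y\<bar> < e"
proof -
  define K where "K = cbox 0 (One :: real^'m)"
  define f :: "real^'m \<Rightarrow> (real^'m) \<times> (real^'m)"
    where "f y = ((\<chi> i. cos (2 * pi * y $ i)), (\<chi> i. sin (2 * pi * y $ i)))" for y
  define T where "T = f ` K"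
  have fc: "continuous_on S f" for S unfolding f_def
    by (intro continuous_on_Pair continuous_on_vec_lambda continuous_intros continuous_on_component)
  have f_eq: "p y = p z" if "f y = f z" for y z
  proof -
    \<comment> \<open>points with the same image on the torus differ by an integer vector\<close>
    have "\<exists>k::int. y $ i - z $ i = of_int k" for i
    proof -
      have "cos (2 * pi * y $ i) = cos (2 * pi * z $ i)" "sin (2 * pi * y $ i) = sin (2 * pi * z $ i)"
        using that by (auto simp: f_def vec_eq_iff)
      then have "sin (2 * pi * y $ i) = sin (2 * pi * z $ i) \<and> cos (2 * pi * y $ i) = cos (2 * pi * z $ i)" by simp
      then obtain n :: int where "2 * pi * y $ i = 2 * pi * z $ i + 2 * pi * n" unfolding sin_cos_eq_iff by blast
      then have "2 * pi * (y $ i - z $ i) = 2 * pi * n" by (simp add: algebra_simps)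
      then have "y $ i - z $ i = n" by simp
      then show ?thesis by blast
    qed
    then obtain k where "\<And>i. y $ i - z $ i = of_int (k i)" by metis
    then have "y = z + int_vec (\<chi> i. k i)" by (simp add: vec_eq_iff int_vec_def algebra_simps) 
    then show ?thesis using per by (simp add: periodic_def)
  qed
  define P where "P w = p (SOME y. y \<in> K \<and> f y = w)" for w
  have P: "P (f y) = p y" if "y \<in> K" for y
  proof -
    have "\<exists>z. z \<in> K \<and> f z = f y" using that by blast
    then have "f (SOME z. z \<in> K \<and> f z = f y) = f y" by (rule someI2_ex) simp
    then show ?thesis unfolding P_def by (rule f_eq)
  qed
  have quot: "quotient_map (top_of_set K) (top_of_set T) f"
    by (rule T1_Spaces.continuous_imp_quotient_map)
      (auto simp: fc T_def K_def compact_space_subtopology Hausdorff_space_subtopology)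
  have "continuous_map (top_of_set K) euclidean (P \<circ> f)"
  proof -
    have "continuous_on K (P \<circ> f)"
      by (rule continuous_on_eq[OF continuous_on_subset[OF cont]]) (auto simp: P)
    then show ?thesis by simp
  qed
  then have "continuous_map (top_of_set T) euclidean P"
    by (rule continuous_compose_quotient_map_eq[OF quot, THEN iffD1])
  then have "continuous_on T P" by simp
  moreover have "compact T" unfolding T_def K_def by (intro compact_continuous_image fc compact_cbox)
  ultimately obtain G where G: "real_polynomial_function G" "\<And>w. w \<in> T \<Longrightarrow> \<bar>P w - G w\<bar> < e"
    using Stone_Weierstrass_real_polynomial_function[of T P e] e by metis
  have coord: "trig_poly (\<lambda>y. f y \<bullet> b)" if "b \<in> Basis" for b
  proof -
    from that obtain i where "b = (axis i 1, 0) \<or> b = (0, axis i 1)"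
      by (auto simp: Basis_prod_def Basis_vec_def)
    moreover have "trig_poly (\<lambda>y. cos (2 * pi * y $ i))"
      using trig_poly_cos[of 1 "axis i 1" 0] by (simp add: int_vec_axis inner_axis')
    moreover have "trig_poly (\<lambda>y. sin (2 * pi * y $ i))"
      using trig_poly_cos[of 1 "axis i 1" "- (pi / 2)"]
      by (simp add: int_vec_axis inner_axis' cos_diff)
    ultimately show ?thesis by (auto simp: f_def inner_prod_def inner_axis)
  qed
  have trig: "trig_poly (\<lambda>y. G (f y))"
    using G(1)
  proof (induction rule: real_polynomial_function.induct)
    case (linear h)
    then interpret h: bounded_linear h .
    have "h (f y) = (\<Sum>b\<in>Basis. h b * (f y \<bullet> b))" for y
      by (subst euclidean_representation[of "f y", symmetric]) (simp add: h.sum h.scaleR mult.commute)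
    then show ?case by (auto intro!: trig_poly_sum trig_poly_cmult coord)
  qed (auto intro: trig_poly_const trig_poly_add trig_poly_mult)
  have "\<bar>p y - G (f y)\<bar> < e" for y
  proof -
    define k where "k = (\<chi> i. - \<lfloor>y $ i\<rfloor>)"
    define z where "z = y + int_vec k"
    have "0 \<le> z $ i \<and> z $ i \<le> 1" for i
      unfolding z_def k_def int_vec_def by simp linarith
    then have "z \<in> K" by (simp only: K_def mem_box_cart One_nth zero_index) simp
    then have "\<bar>p z - G (f z)\<bar> < e" using G(2)[of "f z"] P by (auto simp: T_def)
    moreover have "p z = p y" using per by (simp add: z_def periodic_def)
    moreover have "G (f z) = G (f y)" using trig_poly_periodic[OF trig] by (simp add: z_def)
    ultimately show ?thesis by simp
  qed
  with trig show ?thesis by (rule that)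
qed

definition trig_matrix :: "(real^'m \<Rightarrow> real^'a^'b) \<Rightarrow> bool" where
  "trig_matrix P \<longleftrightarrow> (\<forall>i j. trig_poly (\<lambda>y. P y $ i $ j))"

definition trig_vector :: "(real^'m \<Rightarrow> real^'b) \<Rightarrow> bool" where
  "trig_vector T \<longleftrightarrow> (\<forall>j. trig_poly (\<lambda>y. T y $ j))"

lemma trig_vector_continuous: "trig_vector T \<Longrightarrow> continuous_on S T"
proof -
  assume "trig_vector T"
  then have "continuous_on S (\<lambda>y. \<chi> j. T y $ j)"
    unfolding trig_vector_def by (intro continuous_on_vec_lambda smooth_continuous trig_poly_smooth) auto
  then show ?thesis by simp
qed

lemma trig_matrix_continuous: "trig_matrix P \<Longrightarrow> continuous_on S P"
proof -
  assume "trig_matrix P"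
  then have "continuous_on S (\<lambda>y. \<chi> i j. P y $ i $ j)"
    unfolding trig_matrix_def by (intro continuous_on_vec_lambda smooth_continuous trig_poly_smooth) auto
  then show ?thesis by simp
qed

lemma trig_matrix_approx:
  fixes p :: "real^'m \<Rightarrow> real^'a^'b"
  assumes per: "periodic p" and cont: "continuous_on UNIV p" and e: "e > 0"
  obtains P where "trig_matrix P" "\<And>y. norm (p y - P y) < e"
proof -
  define d where "d = e / (2 * real CARD('a) * real CARD('b))"
  have d: "d > 0" unfolding d_def using e by simp
  have "\<forall>i j. \<exists>q. trig_poly q \<and> (\<forall>y. \<bar>p y $ i $ j - q y\<bar> < d)"
  proof (intro allI)
    fix i j
    have "periodic (\<lambda>y. p y $ i $ j)" using per by (simp add: periodic_def)
    moreover have "continuous_on UNIV (\<lambda>y. p y $ i $ j)" using cont by (intro continuous_on_component)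
    ultimately obtain q where "trig_poly q" "\<And>y. \<bar>p y $ i $ j - q y\<bar> < d"
      using trig_poly_approx[OF _ _ d] by metis
    then show "\<exists>q. trig_poly q \<and> (\<forall>y. \<bar>p y $ i $ j - q y\<bar> < d)" by blast
  qed
  then obtain Q where Q: "\<And>i j. trig_poly (Q i j)" "\<And>i j y. \<bar>p y $ i $ j - Q i j y\<bar> < d" by metis
  define P where "P y = (\<chi> i j. Q i j y)" for y
  have "trig_matrix P" unfolding trig_matrix_def P_def using Q(1) by simp
  moreover have "norm (p y - P y) < e" for y
  proof -
    have "norm (p y - P y) \<le> (\<Sum>i\<in>UNIV. norm ((p y - P y) $ i))"
      unfolding norm_vec_def by (rule L2_set_le_sum) simp
    also have "\<dots> \<le> (\<Sum>i\<in>(UNIV::'b set). \<Sum>j\<in>(UNIV::'a set). d)"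
    proof (rule sum_mono)
      fix i
      have "norm ((p y - P y) $ i) \<le> (\<Sum>j\<in>UNIV. \<bar>(p y - P y) $ i $ j\<bar>)" by (rule norm_le_l1_cart)
      also have "\<dots> \<le> (\<Sum>j\<in>(UNIV::'a set). d)"
        using Q(2) by (intro sum_mono) (simp add: P_def less_imp_le)
      finally show "norm ((p y - P y) $ i) \<le> (\<Sum>j\<in>(UNIV::'a set). d)" .
    qed
    also have "\<dots> = e / 2" by (simp add: d_def)
    also have "\<dots> < e" using e by simp
    finally show ?thesis .
  qed
  ultimately show ?thesis by (rule that)
qed

section \<open>Gradients along the cut\<close>

definition R_grad :: "real^3^'m \<Rightarrow> (real^'m \<Rightarrow> real) \<Rightarrow> real^'m \<Rightarrow> real^3" where
  "R_grad R \<phi> y = transpose R *v grad \<phi> y"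

definition freq :: "real^3^'m \<Rightarrow> int^'m \<Rightarrow> real^3" where
  "freq R l = transpose R *v int_vec l"

definition wave :: "int^'m \<Rightarrow> real \<Rightarrow> real^'m \<Rightarrow> real" where
  "wave l \<theta> y = cos (((2 * pi) *\<^sub>R int_vec l) \<bullet> y + \<theta>)"

lemma freq_0 [simp]: "freq R 0 = 0"
  by (simp add: freq_def)

lemma matrix_vector_mult_minus: "(A :: real^'n^'k) *v (- x) = - (A *v x)"
  using matrix_vector_mult_scaleR[of A "-1" x] by simp

lemma freq_minus: "freq R (- l) = - freq R l"
  unfolding freq_def int_vec_minus by (rule matrix_vector_mult_minus)

lemma wave_0_0 [simp]: "wave 0 0 y = 1"
  by (simp add: wave_def)

lemma wave_continuous [continuous_intros]: "continuous_on S (wave l \<theta>)"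
  unfolding wave_def by (intro continuous_intros)

lemma trig_poly_wave: "trig_poly (\<lambda>y. a * wave l \<theta> y)"
  unfolding wave_def by (rule trig_poly_cos)

lemma R_grad_add:
  "smooth f \<Longrightarrow> smooth g \<Longrightarrow> R_grad R (\<lambda>y. f y + g y) y = R_grad R f y + R_grad R g y"
  by (simp add: R_grad_def grad_add_smooth matrix_vector_right_distrib)

lemma R_grad_cmult: "smooth f \<Longrightarrow> R_grad R (\<lambda>y. t * f y) y = t *\<^sub>R R_grad R f y"
  by (simp add: R_grad_def grad_cmult matrix_vector_mult_scaleR)

lemma R_grad_wave: "R_grad R (\<lambda>y. a * wave l \<theta> y) y = (2 * pi * a * wave l (\<theta> + pi / 2) y) *\<^sub>R freq R l"
  unfolding R_grad_def wave_def grad_cos_ridge freq_def matrix_vector_mult_scaleR by (simp add: mult_ac)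

lemma trig_vector_R_grad:
  fixes R :: "real^3^'m"
  assumes "trig_poly \<phi>" shows "trig_vector (R_grad R \<phi>)"
  unfolding trig_vector_def R_grad_def matrix_vector_mult_def
  by (auto intro!: trig_poly_sum trig_poly_cmult trig_poly_grad assms)

lemma trig_vector_L_two: "trig_vector T \<Longrightarrow> L_two unit_cell T"
  by (intro L_two_continuous unit_cell_open unit_cell_bounded trig_vector_continuous)

lemma R_grad_L_two: "trig_poly \<phi> \<Longrightarrow> L_two unit_cell (R_grad R \<phi>)"
  by (intro trig_vector_L_two trig_vector_R_grad)

lemma wave_scaleR_L_two: "L_two unit_cell (\<lambda>y. wave l \<theta> y *\<^sub>R (b::'b::euclidean_space))"
  by (intro L_two_continuous unit_cell_open unit_cell_bounded continuous_intros)

text \<open>A wave \<open>wave l \<theta> y *\<^sub>R b\<close> read along the cut \<open>y = R x / \<eta>\<close> is divergence free when \<open>b\<close> is orthogonal to the frequency \<open>freq R l\<close>.\<close>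

inductive solenoidal :: "real^3^'m \<Rightarrow> (real^'m \<Rightarrow> real^3) \<Rightarrow> bool" for R where
  solenoidal_zero: "solenoidal R (\<lambda>y. 0)"
| solenoidal_wave: "l \<noteq> 0 \<Longrightarrow> b \<bullet> freq R l = 0 \<Longrightarrow> solenoidal R (\<lambda>y. wave l \<theta> y *\<^sub>R b)"
| solenoidal_add: "solenoidal R B \<Longrightarrow> solenoidal R B' \<Longrightarrow> solenoidal R (\<lambda>y. B y + B' y)"

lemma solenoidal_continuous: "solenoidal R B \<Longrightarrow> continuous_on S B"
  by (induction rule: solenoidal.induct) (auto intro!: continuous_intros)

lemma solenoidal_L_two: "solenoidal R B \<Longrightarrow> L_two unit_cell B"
  by (intro L_two_continuous unit_cell_open unit_cell_bounded solenoidal_continuous)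

text \<open>A gradient along the cut, even one whose potential is not square integrable, is orthogonal to
  constants and to solenoidal waves. Through this property the corrector fields and the gradients of trigonometric
  polynomials are treated alike. Constants are the case \<open>l = 0\<close>.\<close>

definition gradient_like :: "real^3^'m \<Rightarrow> (real^'m \<Rightarrow> real^3) \<Rightarrow> bool" where
  "gradient_like R g \<longleftrightarrow> L_two unit_cell g \<and>
     (\<forall>l \<theta> b. b \<bullet> freq R l = 0 \<longrightarrow> L_two_inner unit_cell g (\<lambda>y. wave l \<theta> y *\<^sub>R b) = 0)"

lemma gradient_like_L_two: "gradient_like R g \<Longrightarrow> L_two unit_cell g"
  by (simp add: gradient_like_def)

lemma gradient_likeD:
  "gradient_like R g \<Longrightarrow> b \<bullet> freq R l = 0 \<Longrightarrow> L_two_inner unit_cell g (\<lambda>y. wave l \<theta> y *\<^sub>R b) = 0"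
  by (simp add: gradient_like_def)

lemma gradient_like_const:
  assumes "gradient_like R g" shows "L_two_inner unit_cell g (\<lambda>y. b) = 0"
  using gradient_likeD[OF assms, of b 0 0] by simp

lemma gradient_like_solenoidal:
  assumes g: "gradient_like R g" and "solenoidal R B"
  shows "L_two_inner unit_cell g B = 0"
  using assms(2)
proof (induction rule: solenoidal.induct)
  case solenoidal_zero
  then show ?case by (simp add: L_two_inner_def)
next
  case (solenoidal_wave l b \<theta>)
  then show ?case using g by (simp add: gradient_like_def)
next
  case (solenoidal_add B B')
  then show ?case
    by (simp add: L_two_inner_add_right[OF solenoidal_L_two solenoidal_L_two gradient_like_L_two[OF g]])
qed

lemma gradient_like_add:
  assumes "gradient_like R g" "gradient_like R h"
  shows "gradient_like R (\<lambda>y. g y + h y)"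
  using assms unfolding gradient_like_def
  by (auto simp: L_two_add L_two_inner_add_left[OF _ _ wave_scaleR_L_two])

lemma gradient_like_scaleR: "gradient_like R g \<Longrightarrow> gradient_like R (\<lambda>y. t *\<^sub>R g y)"
  unfolding gradient_like_def by (auto simp: L_two_scaleR L_two_inner_scaleR_left)

lemma gradient_like_zero: "gradient_like R (\<lambda>y. 0)"
  by (simp add: gradient_like_def L_two_zero L_two_inner_def)

lemma gradient_like_sum:
  "finite I \<Longrightarrow> (\<And>i. i \<in> I \<Longrightarrow> gradient_like R (g i)) \<Longrightarrow> gradient_like R (\<lambda>y. \<Sum>i\<in>I. g i y)"
  by (induction rule: finite_induct) (auto simp: gradient_like_zero intro!: gradient_like_add)

lemma integral_wave_mult:
  assumes "k \<noteq> l" "k \<noteq> - l"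
  shows "(LINT y|lebesgue_on unit_cell. wave k \<rho> y * wave l \<theta> y) = 0"
proof -
  have ne: "k - l \<noteq> 0" "k + l \<noteq> 0" using assms by (auto simp: eq_neg_iff_add_eq_0)
  have c: "continuous_on UNIV (wave j \<alpha>)" for j :: "int^'a" and \<alpha> by (intro continuous_intros)
  have cosmul: "cos A * cos B = cos (A - B) / 2 + cos (A + B) / 2" for A B :: real
    by (simp add: cos_add cos_diff field_simps)
  have "wave k \<rho> y * wave l \<theta> y = wave (k - l) (\<rho> - \<theta>) y / 2 + wave (k + l) (\<rho> + \<theta>) y / 2" for y
    unfolding wave_def cosmul by (simp add: int_vec_diff int_vec_add inner_diff_left inner_add_left algebra_simps)
  then have "(LINT y|lebesgue_on unit_cell. wave k \<rho> y * wave l \<theta> y)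
      = (LINT y|lebesgue_on unit_cell. wave (k - l) (\<rho> - \<theta>) y / 2 + wave (k + l) (\<rho> + \<theta>) y / 2)"
    by presburger
  also have "\<dots> = (LINT y|lebesgue_on unit_cell. wave (k - l) (\<rho> - \<theta>) y) / 2
      + (LINT y|lebesgue_on unit_cell. wave (k + l) (\<rho> + \<theta>) y) / 2"
    using unit_cell_integrable_continuous[OF c] by simp
  also have "\<dots> = 0" unfolding wave_def integral_cos_unit_cell[OF ne(1)] integral_cos_unit_cell[OF ne(2)] by simp
  finally show ?thesis .
qed

lemma gradient_like_R_grad:
  assumes "trig_poly \<phi>" shows "gradient_like R (R_grad R \<phi>)"
  using assms
proof (induction rule: trig_poly.induct)
  case (trig_poly_cos a k \<rho>)
  have ortho: "L_two_inner unit_cell (R_grad R (\<lambda>y. a * wave k \<rho> y)) (\<lambda>y. wave l \<theta> y *\<^sub>R b) = 0"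
    if b: "b \<bullet> freq R l = 0" for l \<theta> b
  proof (cases "k = l \<or> k = - l")
    case True
    then have "b \<bullet> freq R k = 0" using b
      by (auto simp: freq_minus)
    then show ?thesis unfolding L_two_inner_def R_grad_wave by (simp add: inner_commute)
  next
    case False
    have "L_two_inner unit_cell (R_grad R (\<lambda>y. a * wave k \<rho> y)) (\<lambda>y. wave l \<theta> y *\<^sub>R b)
        = (LINT y|lebesgue_on unit_cell. (2 * pi * a * (freq R k \<bullet> b)) * (wave k (\<rho> + pi / 2) y * wave l \<theta> y))"
      unfolding L_two_inner_def R_grad_wave by (intro Bochner_Integration.integral_cong) (auto simp: mult_ac)
    also have "\<dots> = 0" using False integral_wave_mult[of k l "\<rho> + pi / 2" \<theta>]
      by (subst integral_mult_right_zero) simp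
    finally show ?thesis .
  qed
  show ?case unfolding gradient_like_def wave_def[symmetric]
    using ortho R_grad_L_two[OF trig_poly_wave] by auto
next
  case (trig_poly_add f g)
  have "R_grad R (\<lambda>y. f y + g y) = (\<lambda>y. R_grad R f y + R_grad R g y)"
    using trig_poly_add.hyps by (intro ext R_grad_add trig_poly_smooth)
  then show ?case using gradient_like_add[OF trig_poly_add.IH] by simp
qed

text \<open>The Fourier coefficients of \<open>g\<close> are parallel to the frequencies, so the one at frequency \<open>l\<close> is orthogonal to \<open>b\<close>; the real wave is the real
  part of the exponential that defines the coefficient.\<close>

lemma gradient_like_if_is_R_gradient:
  assumes "is_R_gradient R g" shows "gradient_like R g"
proof -
  from assms obtain X where gL: "L_two unit_cell g" and X: "\<And>k j. fourier_coeff (\<lambda>y. g y $ j) k =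
        2 * complex_of_real pi * \<i> * complex_of_real (freq R k $ j) * X k"
    unfolding is_R_gradient_def freq_def by blast
  have "L_two_inner unit_cell g (\<lambda>y. wave l \<theta> y *\<^sub>R b) = 0" if b: "b \<bullet> freq R l = 0" for l \<theta> b
  proof -
    let ?c = "\<lambda>y. cis (- 2 * pi * (int_vec l \<bullet> y))"
    have one: "L_two unit_cell (\<lambda>y::real^'a. 1::real)"
      by (intro L_two_continuous unit_cell_open unit_cell_bounded continuous_intros)
    have gi: "integrable (lebesgue_on unit_cell) (\<lambda>y. complex_of_real (g y $ j) * ?c y)" for j
    proof (rule Bochner_Integration.integrable_bound)
      show "integrable (lebesgue_on unit_cell) (\<lambda>y. g y $ j)"
        using L_two_integrable_inner[OF L_two_component[OF gL, of j] one] by simp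
      have "?c \<in> borel_measurable (lebesgue_on unit_cell)"
        by (intro continuous_borel_measurable_on continuous_intros)
      moreover have "(\<lambda>y. complex_of_real (g y $ j)) \<in> borel_measurable (lebesgue_on unit_cell)"
        using L_two_measurable[OF L_two_component[OF gL, of j]] by measurable
      ultimately show "(\<lambda>y. complex_of_real (g y $ j) * ?c y) \<in> borel_measurable (lebesgue_on unit_cell)"
        by (intro borel_measurable_times)
    qed (simp add: norm_mult)
    have "(\<Sum>j\<in>UNIV. of_real (b $ j) * fourier_coeff (\<lambda>y. g y $ j) l)
        = 2 * complex_of_real pi * \<i> * X l * of_real (\<Sum>j\<in>UNIV. b $ j * freq R l $ j)"
      unfolding X by (simp add: sum_distrib_left mult_ac)
    also have "(\<Sum>j\<in>UNIV. b $ j * freq R l $ j) = 0" using b by (simp add: inner_vec_def)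
    finally have s0: "(\<Sum>j\<in>UNIV. of_real (b $ j) * fourier_coeff (\<lambda>y. g y $ j) l) = 0" by simp
    have si: "integrable (lebesgue_on unit_cell) (\<lambda>y. (\<Sum>j\<in>UNIV. of_real (b $ j) * (complex_of_real (g y $ j) * ?c y)))"
      using gi by (intro Bochner_Integration.integrable_sum integrable_mult_right) auto
    have "L_two_inner unit_cell g (\<lambda>y. wave l \<theta> y *\<^sub>R b)
        = (LINT y|lebesgue_on unit_cell. Re (cis (- \<theta>) * (\<Sum>j\<in>UNIV. of_real (b $ j) * (complex_of_real (g y $ j) * ?c y))))"
      unfolding L_two_inner_def
    proof (rule Bochner_Integration.integral_cong[OF refl])
      fix y
      have "(\<Sum>j\<in>UNIV. of_real (b $ j) * (complex_of_real (g y $ j) * ?c y)) = of_real (g y \<bullet> b) * ?c y"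
        by (simp add: inner_vec_def sum_distrib_right mult_ac)
      moreover have "Re (cis (- \<theta>) * (of_real t * ?c y)) = wave l \<theta> y * t" for t
        by (simp add: wave_def cos_add algebra_simps)
      ultimately show "g y \<bullet> (wave l \<theta> y *\<^sub>R b) = Re (cis (- \<theta>) * (\<Sum>j\<in>UNIV. of_real (b $ j) * (complex_of_real (g y $ j) * ?c y)))"
        by simp
    qed
    also have "\<dots> = Re (cis (- \<theta>) * (LINT y|lebesgue_on unit_cell. (\<Sum>j\<in>UNIV. of_real (b $ j) * (complex_of_real (g y $ j) * ?c y))))"
      using integral_Re[OF integrable_mult_right[OF si, of "cis (- \<theta>)"]] by (simp only: integral_mult_right_zero)
    also have "(LINT y|lebesgue_on unit_cell. (\<Sum>j\<in>UNIV. of_real (b $ j) * (complex_of_real (g y $ j) * ?c y)))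
        = (\<Sum>j\<in>UNIV. of_real (b $ j) * fourier_coeff (\<lambda>y. g y $ j) l)"
      unfolding fourier_coeff_def using gi
      by (subst Bochner_Integration.integral_sum) (auto intro!: integrable_mult_right simp: integral_mult_right_zero simp del: of_real_mult)
    finally show ?thesis unfolding s0 by simp
  qed
  with gL show ?thesis unfolding gradient_like_def by blast
qed

subsection \<open>Splitting trigonometric fields\<close>

text \<open>The Helmholtz decomposition into a constant, a solenoidal and a gradient part.\<close>

definition splits :: "real^3^'m \<Rightarrow> (real^'m \<Rightarrow> real^3) \<Rightarrow> bool" where
  "splits R T \<longleftrightarrow> (\<exists>a B \<psi>. solenoidal R B \<and> trig_poly \<psi> \<and> (\<forall>y. T y = a + B y + R_grad R \<psi> y))"

lemma splits_add:
  assumes "splits R T" "splits R T'" shows "splits R (\<lambda>y. T y + T' y)"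
proof -
  from assms obtain a B \<psi> a' B' \<psi>' where
    "solenoidal R B" "trig_poly \<psi>" "\<And>y. T y = a + B y + R_grad R \<psi> y"
    "solenoidal R B'" "trig_poly \<psi>'" "\<And>y. T' y = a' + B' y + R_grad R \<psi>' y"
    unfolding splits_def by blast
  then show ?thesis unfolding splits_def
    by (intro exI[of _ "a + a'"] exI[of _ "\<lambda>y. B y + B' y"] exI[of _ "\<lambda>y. \<psi> y + \<psi>' y"])
      (auto simp: R_grad_add trig_poly_smooth intro: solenoidal_add trig_poly_add)
qed

lemma splits_sum:
  "finite I \<Longrightarrow> I \<noteq> {} \<Longrightarrow> (\<And>i. i \<in> I \<Longrightarrow> splits R (T i)) \<Longrightarrow> splits R (\<lambda>y. \<Sum>i\<in>I. T i y)"
  by (induction rule: finite_ne_induct) (auto intro!: splits_add)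

text \<open>In each Fourier mode the vector is projected onto the frequency and onto its orthogonal complement. This is where
  \<open>R\<^sup>T k \<noteq> 0\<close> is used; the division by \<open>R\<^sup>T k\<close>, which may be arbitrarily small, is harmless because a trigonometric
  polynomial has finitely many modes.\<close>

lemma splits_trig_poly_scaleR:
  assumes nonres: "\<And>k. k \<noteq> 0 \<Longrightarrow> freq R k \<noteq> 0" and "trig_poly t"
  shows "splits R (\<lambda>y. t y *\<^sub>R e)"
  using assms(2)
proof (induction rule: trig_poly.induct)
  case (trig_poly_cos a l \<theta>)
  have "splits R (\<lambda>y. (a * wave l \<theta> y) *\<^sub>R e)"
  proof (cases "l = 0")
    case True
    have "R_grad R (\<lambda>y. 0) y = 0" for y by (simp add: R_grad_def)
    then show ?thesis unfolding splits_def using True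
      by (intro exI[of _ "(a * cos \<theta>) *\<^sub>R e"] exI[of _ "\<lambda>y. 0"] exI[of _ "\<lambda>y. 0"])
        (auto simp: wave_def intro: solenoidal_zero trig_poly_const)
  next
    case False
    let ?\<xi> = "freq R l"
    define s where "s = e \<bullet> ?\<xi> / (?\<xi> \<bullet> ?\<xi>)"
    define b where "b = a *\<^sub>R (e - s *\<^sub>R ?\<xi>)"
    have "?\<xi> \<bullet> ?\<xi> \<noteq> 0" using nonres[OF False] by simp
    then have "b \<bullet> ?\<xi> = 0" by (simp add: b_def s_def inner_diff_left)
    then have "solenoidal R (\<lambda>y. wave l \<theta> y *\<^sub>R b)" using False by (rule solenoidal_wave[rotated])
    moreover have "trig_poly (\<lambda>y. (a * s / (2 * pi)) * wave l (\<theta> - pi / 2) y)" by (rule trig_poly_wave)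
    moreover have "(a * wave l \<theta> y) *\<^sub>R e = 0 + wave l \<theta> y *\<^sub>R b + R_grad R (\<lambda>y. (a * s / (2 * pi)) * wave l (\<theta> - pi / 2) y) y" for y
      unfolding R_grad_wave b_def by (simp add: algebra_simps)
    ultimately show ?thesis unfolding splits_def by blast
  qed
  then show ?case unfolding wave_def .
next
  case (trig_poly_add f g)
  then show ?case using splits_add by (simp add: scaleR_add_left)
qed

lemma splits_trig_vector:
  fixes R :: "real^3^'m"
  assumes nonres: "\<And>k. k \<noteq> 0 \<Longrightarrow> freq R k \<noteq> 0" and T: "trig_vector T"
  shows "splits R T"
proof -
  have "splits R (\<lambda>y. \<Sum>j\<in>(UNIV::3 set). T y $ j *\<^sub>R axis j 1)"
    using T by (intro splits_sum splits_trig_poly_scaleR nonres) (auto simp: trig_vector_def)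
  moreover have "(\<Sum>j\<in>(UNIV::3 set). T y $ j *\<^sub>R axis j 1) = T y" for y
    using basis_expansion[of "T y"] by (simp add: scalar_mult_eq_scaleR)
  ultimately show ?thesis by simp
qed

section \<open>The local problem and its adjoint\<close>

lemma norm_transpose_vector_le:
  fixes A :: "real^'n^'m"
  shows "norm (transpose A *v x) \<le> norm A * norm x"
proof -
  let ?z = "transpose A *v x"
  have "norm ?z * norm ?z = (A *v ?z) \<bullet> x"
    by (simp add: inner_matrix_transpose dot_square_norm power2_eq_square)
  also have "\<dots> \<le> norm (A *v ?z) * norm x" by (rule norm_cauchy_schwarz)
  also have "\<dots> \<le> (norm A * norm ?z) * norm x" by (intro mult_right_mono norm_matrix_vector_le) simp
  finally have "norm ?z * norm ?z \<le> (norm A * norm x) * norm ?z" by (simp add: mult_ac)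
  then show ?thesis by (cases "norm ?z = 0") (auto simp: mult_le_cancel_right)
qed

lemma continuous_on_transpose [continuous_intros]:
  fixes A :: "'a::topological_space \<Rightarrow> real^'n^'m"
  assumes "continuous_on S A"
  shows "continuous_on S (\<lambda>x. transpose (A x))"
  unfolding transpose_def using assms by (intro continuous_on_vec_lambda continuous_on_component)

lemma borel_measurable_transpose [measurable (raw)]:
  fixes A :: "'a \<Rightarrow> real^'n^'m"
  assumes "A \<in> borel_measurable M"
  shows "(\<lambda>x. transpose (A x)) \<in> borel_measurable M"
  by (rule borel_measurable_continuous_on[OF _ assms]) (intro continuous_intros)

lemma L_two_const_cell: "L_two unit_cell (\<lambda>y. b)"
  by (intro L_two_continuous unit_cell_open unit_cell_bounded continuous_intros)

lemma measure_lebesgue_on_unit_cell: "measure (lebesgue_on unit_cell) (unit_cell :: (real^'m) set) = 1"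
  by (simp add: measure_restrict_space unit_cell_sets measure_unit_cell)

lemma L_two_inner_const_cell: "L_two_inner unit_cell (\<lambda>y::real^'m. a) (\<lambda>y. b) = a \<bullet> b"
  by (simp add: L_two_inner_def measure_lebesgue_on_unit_cell)

lemma L_two_norm_const_cell: "L_two_norm unit_cell (\<lambda>y::real^'m. a) = norm a"
  by (simp add: L_two_norm_def measure_lebesgue_on_unit_cell)

lemma solenoidal_const: "solenoidal R B \<Longrightarrow> L_two_inner unit_cell B (\<lambda>y. b) = 0"
proof (induction rule: solenoidal.induct)
  case (solenoidal_wave l b' \<theta>)
  have "L_two_inner unit_cell (\<lambda>y. wave l \<theta> y *\<^sub>R b') (\<lambda>y. b) = (LINT y|lebesgue_on unit_cell. wave l \<theta> y * (b' \<bullet> b))"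
    by (simp add: L_two_inner_def)
  also have "\<dots> = 0" unfolding wave_def using integral_cos_unit_cell[OF solenoidal_wave(1)] by simp
  finally show ?case .
next
  case (solenoidal_add B B')
  then show ?case by (simp add: L_two_inner_add_left[OF solenoidal_L_two solenoidal_L_two L_two_const_cell])
qed (simp add: L_two_inner_def)

lemma gradient_like_split:
  assumes g: "gradient_like R g" and B: "solenoidal R B" and \<psi>: "trig_poly \<psi>"
  shows "L_two_inner unit_cell g (\<lambda>y. a + B y + R_grad R \<psi> y) = L_two_inner unit_cell g (R_grad R \<psi>)"
  using gradient_like_L_two[OF g] solenoidal_L_two[OF B] R_grad_L_two[OF \<psi>]
  by (simp add: L_two_inner_add_right L_two_add L_two_const_cell gradient_like_const[OF g]
      gradient_like_solenoidal[OF g B])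

lemma const_split:
  assumes B: "solenoidal R B" and \<psi>: "trig_poly \<psi>"
  shows "L_two_inner unit_cell (\<lambda>y. b) (\<lambda>y. a + B y + R_grad R \<psi> y) = b \<bullet> a"
proof -
  have "L_two_inner unit_cell (\<lambda>y. b) B = 0" "L_two_inner unit_cell (\<lambda>y. b) (R_grad R \<psi>) = 0"
    using solenoidal_const[OF B, of b] gradient_like_const[OF gradient_like_R_grad[OF \<psi>], of R b]
    by (simp_all add: L_two_inner_commute)
  then show ?thesis
    using solenoidal_L_two[OF B] R_grad_L_two[OF \<psi>]
    by (simp add: L_two_inner_add_right L_two_add L_two_const_cell L_two_inner_const_cell)
qed

lemma trig_matrix_transpose_vector:
  fixes P :: "real^'m \<Rightarrow> real^'a^'b"
  assumes "trig_matrix P" "trig_vector w"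
  shows "trig_vector (\<lambda>y. transpose (P y) *v w y)"
  using assms unfolding trig_vector_def trig_matrix_def transpose_def matrix_vector_mult_def
  by (auto intro!: trig_poly_sum trig_poly_mult)

text \<open>The approximation of \<open>\<sigma>\<close> by trigonometric matrices stands in for the density of trigonometric
  polynomials in \<open>L\<^sup>2\<close> of the cell.\<close>

locale quasiperiodic_cell =
  fixes R :: "real^3^'m" and \<sigma> :: "real^'m \<Rightarrow> real^3^3" and c M :: real
  assumes nonresonant: "k \<noteq> 0 \<Longrightarrow> freq R k \<noteq> 0"
    and \<sigma>_measurable: "\<sigma> \<in> borel_measurable (lebesgue_on unit_cell)"
    and \<sigma>_bounded: "AE y in lebesgue_on unit_cell. norm (\<sigma> y) \<le> M"
    and \<sigma>_coercive: "coercive_on unit_cell c \<sigma>"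
    and c_pos: "c > 0"
    and \<sigma>_approx: "e > 0 \<Longrightarrow> \<exists>P. trig_matrix P \<and> L_two_norm unit_cell (\<lambda>y. \<sigma> y - P y) < e"
begin

lemma \<sigma>_L_two:
  assumes "L_two unit_cell w"
  shows "L_two unit_cell (\<lambda>y. \<sigma> y *v w y)"
proof (rule L_two_bound[OF assms])
  show "AE y in lebesgue_on unit_cell. norm (\<sigma> y *v w y) \<le> M * norm (w y)"
    using \<sigma>_bounded by eventually_elim (meson mult_right_mono norm_ge_zero norm_matrix_vector_le order_trans)
qed (use L_two_measurable[OF assms] \<sigma>_measurable in measurable)

lemma \<sigma>_transpose_L_two:
  assumes "L_two unit_cell w"
  shows "L_two unit_cell (\<lambda>y. transpose (\<sigma> y) *v w y)"
    "L_two_norm unit_cell (\<lambda>y. transpose (\<sigma> y) *v w y) \<le> \<bar>M\<bar> * L_two_norm unit_cell w"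
proof -
  have le: "AE y in lebesgue_on unit_cell. norm (transpose (\<sigma> y) *v w y) \<le> \<bar>M\<bar> * norm (w y)"
    using \<sigma>_bounded
  proof eventually_elim
    case (elim y)
    have "norm (transpose (\<sigma> y) *v w y) \<le> norm (\<sigma> y) * norm (w y)" by (rule norm_transpose_vector_le)
    also have "\<dots> \<le> \<bar>M\<bar> * norm (w y)" using elim by (intro mult_right_mono) auto
    finally show ?case .
  qed
  have m: "(\<lambda>y. transpose (\<sigma> y) *v w y) \<in> borel_measurable (lebesgue_on unit_cell)"
    using L_two_measurable[OF assms] \<sigma>_measurable by measurable
  show "L_two unit_cell (\<lambda>y. transpose (\<sigma> y) *v w y)" by (rule L_two_bound[OF assms m le])
  show "L_two_norm unit_cell (\<lambda>y. transpose (\<sigma> y) *v w y) \<le> \<bar>M\<bar> * L_two_norm unit_cell w"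
    by (rule L_two_norm_mono[OF assms m _ le]) simp
qed

lemma \<sigma>_transpose_coercive:
  assumes "L_two unit_cell w"
  shows "c * (L_two_norm unit_cell w)\<^sup>2 \<le> L_two_inner unit_cell w (\<lambda>y. transpose (\<sigma> y) *v w y)"
proof -
  have "(LINT y|lebesgue_on unit_cell. c * (norm (w y))\<^sup>2) \<le> (LINT y|lebesgue_on unit_cell. w y \<bullet> (transpose (\<sigma> y) *v w y))"
  proof (rule integral_mono_AE)
    show "AE y in lebesgue_on unit_cell. c * (norm (w y))\<^sup>2 \<le> w y \<bullet> (transpose (\<sigma> y) *v w y)"
      using \<sigma>_coercive unfolding coercive_on_def inner_matrix_transpose[symmetric] by eventually_elim blast
  qed (use assms \<sigma>_transpose_L_two(1)[OF assms] in \<open>auto simp: L_two_def intro: L_two_integrable_inner\<close>)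
  then show ?thesis by (simp add: L_two_norm_power2 L_two_inner_def power2_norm_eq_inner)
qed

text \<open>The flux of the adjoint local problem: the coefficient is transposed because this field will be paired with the
  gradient of the solution.\<close>

definition flux :: "real^3 \<Rightarrow> (real^'m \<Rightarrow> real) \<Rightarrow> real^'m \<Rightarrow> real^3" where
  "flux \<xi> \<phi> y = transpose (\<sigma> y) *v (\<xi> + R_grad R \<phi> y)"

lemma field_L_two: "trig_poly \<phi> \<Longrightarrow> L_two unit_cell (\<lambda>y. \<xi> + R_grad R \<phi> y)"
  by (intro L_two_add L_two_const_cell R_grad_L_two)

lemma flux_L_two: "trig_poly \<phi> \<Longrightarrow> L_two unit_cell (flux \<xi> \<phi>)"
  unfolding flux_def by (intro \<sigma>_transpose_L_two(1) field_L_two)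

text \<open>An approximate solution of the adjoint local problem by a trigonometric polynomial. An exact adjoint corrector would
  only be square integrable, and then meaningless along the cut, which is a null set of the torus.\<close>

definition approximate_corrector :: "real \<Rightarrow> real^3 \<Rightarrow> (real^'m \<Rightarrow> real) \<Rightarrow> bool" where
  "approximate_corrector d \<xi> \<phi> \<longleftrightarrow> trig_poly \<phi> \<and>
     (\<forall>\<psi>. trig_poly \<psi> \<longrightarrow> \<bar>L_two_inner unit_cell (flux \<xi> \<phi>) (R_grad R \<psi>)\<bar> \<le> d * L_two_norm unit_cell (R_grad R \<psi>))"

lemma approximate_corrector_exists:
  assumes d: "d > 0"
  obtains \<phi> where "approximate_corrector d \<xi> \<phi>"
proof -
  let ?b = "\<lambda>\<phi> \<psi>. L_two_inner unit_cell (R_grad R \<phi>) (R_grad R \<psi>)"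
  let ?a = "\<lambda>\<phi> \<psi>. L_two_inner unit_cell (\<lambda>y. transpose (\<sigma> y) *v R_grad R \<phi> y) (R_grad R \<psi>)"
  define K where "K = max c \<bar>M\<bar>"
  have nrm: "sqrt (L_two_inner unit_cell (R_grad R \<phi>) (R_grad R \<phi>)) = L_two_norm unit_cell (R_grad R \<phi>)" for \<phi>
    using L_two_norm_nonneg[of unit_cell "R_grad R \<phi>"] by (simp flip: L_two_norm_power2)
  have lin: "R_grad R (\<lambda>x. \<phi> x + t * \<psi> x) = (\<lambda>y. R_grad R \<phi> y + t *\<^sub>R R_grad R \<psi> y)"
    if "trig_poly \<phi>" "trig_poly \<psi>" for \<phi> \<psi> t
    using that by (auto simp: R_grad_add R_grad_cmult trig_poly_smooth smooth_cmult)
  note L = R_grad_L_two \<sigma>_transpose_L_two(1)[OF R_grad_L_two]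
  interpret coercive_form "{\<phi>. trig_poly \<phi>}" ?b ?a c K
  proof
    show "\<bar>?a \<phi> \<psi>\<bar> \<le> K * sqrt (?b \<phi> \<phi>) * sqrt (?b \<psi> \<psi>)" if "\<phi> \<in> {\<phi>. trig_poly \<phi>}" "\<psi> \<in> {\<phi>. trig_poly \<phi>}" for \<phi> \<psi>
    proof -
      have t: "trig_poly \<phi>" "trig_poly \<psi>" using that by auto
      have "\<bar>?a \<phi> \<psi>\<bar> \<le> L_two_norm unit_cell (\<lambda>y. transpose (\<sigma> y) *v R_grad R \<phi> y) * L_two_norm unit_cell (R_grad R \<psi>)"
        using t by (intro L_two_inner_le L)
      also have "\<dots> \<le> (K * L_two_norm unit_cell (R_grad R \<phi>)) * L_two_norm unit_cell (R_grad R \<psi>)"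
      proof (rule mult_right_mono)
        have "L_two_norm unit_cell (\<lambda>y. transpose (\<sigma> y) *v R_grad R \<phi> y) \<le> \<bar>M\<bar> * L_two_norm unit_cell (R_grad R \<phi>)"
          using t by (intro \<sigma>_transpose_L_two(2) L)
        also have "\<dots> \<le> K * L_two_norm unit_cell (R_grad R \<phi>)"
          by (intro mult_right_mono) (auto simp: K_def L_two_norm_nonneg)
        finally show "L_two_norm unit_cell (\<lambda>y. transpose (\<sigma> y) *v R_grad R \<phi> y) \<le> K * L_two_norm unit_cell (R_grad R \<phi>)" .
      qed (rule L_two_norm_nonneg)
      finally show ?thesis by (simp add: nrm)
    qed
    show "0 \<le> ?b \<phi> \<phi>" for \<phi> by (simp flip: L_two_norm_power2)
    show "c * ?b \<phi> \<phi> \<le> ?a \<phi> \<phi>" if "\<phi> \<in> {\<phi>. trig_poly \<phi>}" for \<phi>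
      using \<sigma>_transpose_coercive[OF R_grad_L_two, of \<phi>] that by (simp add: L_two_norm_power2 L_two_inner_commute)
    show "c > 0" by (rule c_pos)
    show "(\<lambda>x. 0) \<in> {\<phi>. trig_poly \<phi>}" by (simp add: trig_poly_const)
    show "(\<lambda>x::real^'m. u x + t * v x) \<in> {\<phi>. trig_poly \<phi>}" if "u \<in> {\<phi>. trig_poly \<phi>}" "v \<in> {\<phi>. trig_poly \<phi>}" for u v :: "real^'m \<Rightarrow> real" and t
      using that by (auto intro: trig_poly_add trig_poly_cmult)
    show "?b u v = ?b v u" for u v :: "real^'m \<Rightarrow> real" by (rule L_two_inner_commute)
  qed (simp_all only: mem_Collect_eq lin L L_two_scaleR matrix_vector_right_distrib matrix_vector_mult_scaleR
      L_two_inner_add_left L_two_inner_add_right L_two_inner_scaleR_left L_two_inner_scaleR_right)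
  have "functional (\<lambda>\<psi>. - L_two_inner unit_cell (\<lambda>y. transpose (\<sigma> y) *v \<xi>) (R_grad R \<psi>))
      (L_two_norm unit_cell (\<lambda>y. transpose (\<sigma> y) *v \<xi>))"
    unfolding functional_def nrm
  proof (intro conjI ballI allI)
    fix u v :: "real^'m \<Rightarrow> real" and t assume "u \<in> {\<phi>. trig_poly \<phi>}" "v \<in> {\<phi>. trig_poly \<phi>}"
    then have u: "trig_poly u" and v: "trig_poly v" by auto
    show "- L_two_inner unit_cell (\<lambda>y. transpose (\<sigma> y) *v \<xi>) (R_grad R (\<lambda>x. u x + t * v x))
        = - L_two_inner unit_cell (\<lambda>y. transpose (\<sigma> y) *v \<xi>) (R_grad R u)
          + t * - L_two_inner unit_cell (\<lambda>y. transpose (\<sigma> y) *v \<xi>) (R_grad R v)"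
      unfolding lin[OF u v]
      by (simp only: L_two_inner_add_right[OF L(1)[OF u] L_two_scaleR[OF L(1)[OF v]]
            \<sigma>_transpose_L_two(1)[OF L_two_const_cell]] L_two_inner_scaleR_right)
  next
    fix v :: "real^'m \<Rightarrow> real" assume "v \<in> {\<phi>. trig_poly \<phi>}"
    then show "\<bar>- L_two_inner unit_cell (\<lambda>y. transpose (\<sigma> y) *v \<xi>) (R_grad R v)\<bar>
        \<le> L_two_norm unit_cell (\<lambda>y. transpose (\<sigma> y) *v \<xi>) * L_two_norm unit_cell (R_grad R v)"
      using L_two_inner_le[OF \<sigma>_transpose_L_two(1)[OF L_two_const_cell] R_grad_L_two] by simp
  qed
  from approximate_Lax_Milgram[OF this d, unfolded nrm]
  obtain \<phi> where \<phi>: "trig_poly \<phi>" and res: "\<And>\<psi>. trig_poly \<psi> \<Longrightarrow>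
     \<bar>- L_two_inner unit_cell (\<lambda>y. transpose (\<sigma> y) *v \<xi>) (R_grad R \<psi>) - ?a \<phi> \<psi>\<bar> \<le> d * L_two_norm unit_cell (R_grad R \<psi>)"
    by (auto simp: K_def)
  have eq: "L_two_inner unit_cell (flux \<xi> \<phi>) (R_grad R \<psi>)
      = L_two_inner unit_cell (\<lambda>y. transpose (\<sigma> y) *v \<xi>) (R_grad R \<psi>) + ?a \<phi> \<psi>" if "trig_poly \<psi>" for \<psi>
    unfolding flux_def matrix_vector_right_distrib
    by (rule L_two_inner_add_left[OF \<sigma>_transpose_L_two(1)[OF L_two_const_cell] L(2)[OF \<phi>] L(1)[OF that]])
  have "\<bar>L_two_inner unit_cell (flux \<xi> \<phi>) (R_grad R \<psi>)\<bar> \<le> d * L_two_norm unit_cell (R_grad R \<psi>)"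
    if "trig_poly \<psi>" for \<psi>
    unfolding eq[OF that] using res[OF that] by linarith
  then have "approximate_corrector d \<xi> \<phi>" unfolding approximate_corrector_def
    using \<phi> by blast
  then show ?thesis by (rule that)
qed

lemma field_bounded:
  assumes "trig_poly \<phi>"
  obtains E where "E \<ge> 0" "\<And>y. y \<in> unit_cell \<Longrightarrow> norm (\<xi> + R_grad R \<phi> y) \<le> E"
proof -
  have "continuous_on UNIV (\<lambda>y. \<xi> + R_grad R \<phi> y)"
    by (intro continuous_intros trig_vector_continuous trig_vector_R_grad assms)
  from bounded_continuous_on_bounded[OF unit_cell_bounded this] show ?thesis using that by blast
qed

text \<open>Replacing the coefficient by a trigonometric one turns the flux into a trigonometric field,
  whose gradient part is small because the corrector makes the flux almost orthogonal to gradients.\<close>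

lemma trigonometric_flux:
  assumes \<phi>: "approximate_corrector d \<xi> \<phi>" and d: "d \<ge> 0" and P: "trig_matrix P"
    and E: "E \<ge> 0" "\<And>y. y \<in> unit_cell \<Longrightarrow> norm (\<xi> + R_grad R \<phi> y) \<le> E"
    and e: "L_two_norm unit_cell (\<lambda>y. \<sigma> y - P y) \<le> e"
  shows "\<exists>a B \<psi>. solenoidal R B \<and> trig_poly \<psi> \<and>
    (\<forall>y. transpose (P y) *v (\<xi> + R_grad R \<phi> y) = a + B y + R_grad R \<psi> y) \<and>
    L_two_norm unit_cell (R_grad R \<psi>) \<le> d + E * e \<and>
    L_two_norm unit_cell (\<lambda>y. flux \<xi> \<phi> y - (a + B y + R_grad R \<psi> y)) \<le> E * e"
proof -
  have trig: "trig_poly \<phi>" using \<phi> by (simp add: approximate_corrector_def)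
  define T where "T y = transpose (P y) *v (\<xi> + R_grad R \<phi> y)" for y
  have "trig_vector (\<lambda>y. \<xi> + R_grad R \<phi> y)"
    using trig_vector_R_grad[OF trig, of R] by (auto simp: trig_vector_def intro!: trig_poly_add trig_poly_const)
  then have T: "trig_vector T" unfolding T_def by (rule trig_matrix_transpose_vector[OF P])
  from splits_trig_vector[OF nonresonant T] obtain a B \<psi>
    where s: "solenoidal R B" "trig_poly \<psi>" "\<And>y. T y = a + B y + R_grad R \<psi> y"
    unfolding splits_def by blast
  have T_eq: "T = (\<lambda>y. a + B y + R_grad R \<psi> y)" using s(3) by auto
  have TL: "L_two unit_cell T" by (rule trig_vector_L_two[OF T])
  note fL = flux_L_two[OF trig, of \<xi>]
  note gL = R_grad_L_two[OF s(2), of R]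
  have \<sigma>PL: "L_two unit_cell (\<lambda>y. \<sigma> y - P y)"
  proof (rule L_two_diff)
    show "L_two unit_cell \<sigma>"
      using \<sigma>_measurable \<sigma>_bounded bounded_open_lmeasurable[OF unit_cell_open unit_cell_bounded] by (rule L_two_bounded[rotated])
    show "L_two unit_cell P"
      by (intro L_two_continuous unit_cell_open unit_cell_bounded trig_matrix_continuous P)
  qed
  have diff: "L_two_norm unit_cell (\<lambda>y. flux \<xi> \<phi> y - T y) \<le> E * e"
  proof -
    have "L_two_norm unit_cell (\<lambda>y. flux \<xi> \<phi> y - T y) \<le> E * L_two_norm unit_cell (\<lambda>y. \<sigma> y - P y)"
    proof (rule L_two_norm_mono[OF \<sigma>PL _ E(1)])
      show "AE y in lebesgue_on unit_cell. norm (flux \<xi> \<phi> y - T y) \<le> E * norm (\<sigma> y - P y)"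
      proof (rule AE_I2)
        fix y :: "real^'m" assume "y \<in> space (lebesgue_on unit_cell)"
        then have y: "y \<in> unit_cell" by simp
        have "flux \<xi> \<phi> y - T y = transpose (\<sigma> y - P y) *v (\<xi> + R_grad R \<phi> y)"
          by (simp add: flux_def T_def transpose_def matrix_vector_mult_def vec_eq_iff sum_subtractf left_diff_distrib)
        also have "norm \<dots> \<le> norm (\<sigma> y - P y) * norm (\<xi> + R_grad R \<phi> y)" by (rule norm_transpose_vector_le)
        also have "\<dots> \<le> norm (\<sigma> y - P y) * E" by (intro mult_left_mono E(2) y) simp
        finally show "norm (flux \<xi> \<phi> y - T y) \<le> E * norm (\<sigma> y - P y)" by (simp add: mult.commute)
      qed
      show "(\<lambda>y. flux \<xi> \<phi> y - T y) \<in> borel_measurable (lebesgue_on unit_cell)"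
        using L_two_diff[OF fL TL] by (rule L_two_measurable)
    qed
    also have "\<dots> \<le> E * e" by (intro mult_left_mono e E)
    finally show ?thesis .
  qed
  let ?G = "R_grad R \<psi>" and ?N = "L_two_norm unit_cell (R_grad R \<psi>)"
  have "?N * ?N = L_two_inner unit_cell ?G ?G" by (simp flip: L_two_norm_power2 add: power2_eq_square)
  also have "\<dots> = L_two_inner unit_cell ?G T"
    unfolding T_eq by (rule gradient_like_split[OF gradient_like_R_grad[OF s(2)] s(1) s(2), symmetric])
  also have "\<dots> = L_two_inner unit_cell ?G (flux \<xi> \<phi>) - L_two_inner unit_cell ?G (\<lambda>y. flux \<xi> \<phi> y - T y)"
    using L_two_inner_diff_right[OF fL TL gL] by simp
  also have "\<dots> \<le> d * ?N + ?N * (E * e)"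
  proof -
    have "L_two_inner unit_cell ?G (flux \<xi> \<phi>) \<le> d * ?N"
      using \<phi> s(2) unfolding approximate_corrector_def by (auto simp: L_two_inner_commute[of _ ?G])
    moreover have "\<bar>L_two_inner unit_cell ?G (\<lambda>y. flux \<xi> \<phi> y - T y)\<bar> \<le> ?N * (E * e)"
      by (rule order_trans[OF L_two_inner_le[OF gL L_two_diff[OF fL TL]]])
        (intro mult_left_mono diff L_two_norm_nonneg)
    ultimately show ?thesis by linarith
  qed
  also have "\<dots> = (d + E * e) * ?N" by (simp add: algebra_simps)
  finally have sq: "?N * ?N \<le> (d + E * e) * ?N" .
  have "?N \<le> d + E * e"
  proof (cases "?N = 0")
    case True
    have "0 \<le> e" using e L_two_norm_nonneg[of unit_cell "\<lambda>y. \<sigma> y - P y"] by linarith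
    then show ?thesis using True d E(1) by simp
  next
    case False
    then have "0 < ?N" using L_two_norm_nonneg[of unit_cell ?G] by simp
    with sq show ?thesis by (rule mult_right_le_imp_le)
  qed
  moreover have "L_two_norm unit_cell (\<lambda>y. flux \<xi> \<phi> y - (a + B y + R_grad R \<psi> y)) \<le> E * e"
    using diff unfolding T_eq .
  moreover have "\<forall>y. transpose (P y) *v (\<xi> + R_grad R \<phi> y) = a + B y + R_grad R \<psi> y"
    using s(3) by (simp only: T_def) simp
  ultimately show ?thesis using s(1,2) by blast
qed

text \<open>The corrector property carries over from trigonometric gradients to all gradients: up to a
  small error the flux is a trigonometric field, and such a field sees only finitely many Fourier
  coefficients of its partner.\<close>

lemma approximate_corrector_gradient_like:
  assumes \<phi>: "approximate_corrector d \<xi> \<phi>" and d: "d \<ge> 0" and g: "gradient_like R g"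
  shows "\<bar>L_two_inner unit_cell g (flux \<xi> \<phi>)\<bar> \<le> d * L_two_norm unit_cell g"
proof (rule field_le_epsilon)
  fix r :: real assume r: "r > 0"
  have trig: "trig_poly \<phi>" using \<phi> by (simp add: approximate_corrector_def)
  obtain E where E: "E \<ge> 0" "\<And>y. y \<in> unit_cell \<Longrightarrow> norm (\<xi> + R_grad R \<phi> y) \<le> E"
    using field_bounded[OF trig] by blast
  let ?n = "L_two_norm unit_cell g"
  have n: "0 \<le> ?n" by (rule L_two_norm_nonneg)
  define K where "K = 2 * (E + 1) * (?n + 1)"
  have K: "K > 0" unfolding K_def using E(1) n by simp
  define e where "e = r / K"
  have e: "e > 0" unfolding e_def using r K by simp
  have en: "2 * (E * e) * ?n \<le> r"
  proof -
    have "2 * (E * e) * ?n \<le> 2 * ((E + 1) * e) * (?n + 1)"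
      using E(1) n e by (intro mult_mono) auto
    also have "\<dots> = K * e" by (simp add: K_def mult_ac)
    also have "\<dots> = r" unfolding e_def using K by simp
    finally show ?thesis .
  qed
  obtain P where P: "trig_matrix P" "L_two_norm unit_cell (\<lambda>y. \<sigma> y - P y) < e" using \<sigma>_approx[OF e] by blast
  obtain a B \<psi> where s: "solenoidal R B" "trig_poly \<psi>"
    "L_two_norm unit_cell (R_grad R \<psi>) \<le> d + E * e"
    "L_two_norm unit_cell (\<lambda>y. flux \<xi> \<phi> y - (a + B y + R_grad R \<psi> y)) \<le> E * e"
    using trigonometric_flux[OF \<phi> d P(1) E less_imp_le[OF P(2)]] by blast
  let ?T = "\<lambda>y. a + B y + R_grad R \<psi> y"
  have TL: "L_two unit_cell ?T"
    by (intro L_two_add L_two_const_cell solenoidal_L_two[OF s(1)] R_grad_L_two[OF s(2)])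
  note gL = gradient_like_L_two[OF g]
  note fL = flux_L_two[OF trig, of \<xi>]
  have "\<bar>L_two_inner unit_cell g (flux \<xi> \<phi>)\<bar>
      = \<bar>L_two_inner unit_cell g (\<lambda>y. flux \<xi> \<phi> y - ?T y) + L_two_inner unit_cell g (R_grad R \<psi>)\<bar>"
    using L_two_inner_diff_right[OF fL TL gL] gradient_like_split[OF g s(1,2), of a] by simp
  also have "\<dots> \<le> ?n * (E * e) + ?n * (d + E * e)"
  proof -
    have "\<bar>L_two_inner unit_cell g (\<lambda>y. flux \<xi> \<phi> y - ?T y)\<bar> \<le> ?n * (E * e)"
      by (rule order_trans[OF L_two_inner_le[OF gL L_two_diff[OF fL TL]]]) (intro mult_left_mono s n)
    moreover have "\<bar>L_two_inner unit_cell g (R_grad R \<psi>)\<bar> \<le> ?n * (d + E * e)"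
      by (rule order_trans[OF L_two_inner_le[OF gL R_grad_L_two[OF s(2)]]]) (intro mult_left_mono s n)
    ultimately show ?thesis by linarith
  qed
  also have "\<dots> = d * ?n + 2 * (E * e) * ?n" by (simp add: algebra_simps)
  also have "\<dots> \<le> d * ?n + r" using en by simp
  finally show "\<bar>L_two_inner unit_cell g (flux \<xi> \<phi>)\<bar> \<le> d * ?n + r" .
qed

end

section \<open>The homogenized matrix\<close>

locale homogenization_cell = quasiperiodic_cell R \<sigma> c M
  for R :: "real^3^'m" and \<sigma> c M +
  fixes g :: "3 \<Rightarrow> real^'m \<Rightarrow> real^3"
  assumes g_local: "local_solution R \<sigma> k (g k)"
begin

text \<open>The gradient of the corrector in direction \<open>\<eta>\<close>; the given solutions belong to the unit vectors.\<close>

definition g_dir :: "real^3 \<Rightarrow> real^'m \<Rightarrow> real^3" where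
  "g_dir \<eta> y = (\<Sum>i\<in>UNIV. \<eta> $ i *\<^sub>R g i y)"

lemma gradient_like_g: "gradient_like R (g k)"
  using g_local[of k] by (simp add: local_solution_def gradient_like_if_is_R_gradient)

lemma gradient_like_g_dir: "gradient_like R (g_dir \<eta>)"
  unfolding g_dir_def by (intro gradient_like_sum gradient_like_scaleR gradient_like_g) simp

lemma g_dir_norm: "L_two_norm unit_cell (g_dir \<eta>) \<le> norm \<eta> * (\<Sum>i\<in>UNIV. L_two_norm unit_cell (g i))"
proof -
  have "L_two_norm unit_cell (\<lambda>y. \<Sum>i\<in>I. \<eta> $ i *\<^sub>R g i y) \<le> (\<Sum>i\<in>I. norm \<eta> * L_two_norm unit_cell (g i))"
    if "finite I" for I
    using that
  proof (induction rule: finite_induct)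
    case empty
    then show ?case by (simp add: L_two_norm_def)
  next
    case (insert i I)
    have L: "L_two unit_cell (\<lambda>y. \<eta> $ i *\<^sub>R g i y)" for i
      by (intro L_two_scaleR gradient_like_L_two[OF gradient_like_g])
    have "L_two_norm unit_cell (\<lambda>y. \<eta> $ i *\<^sub>R g i y + (\<Sum>i\<in>I. \<eta> $ i *\<^sub>R g i y))
        \<le> \<bar>\<eta> $ i\<bar> * L_two_norm unit_cell (g i) + L_two_norm unit_cell (\<lambda>y. \<Sum>i\<in>I. \<eta> $ i *\<^sub>R g i y)"
      using L_two_norm_triangle[OF L L_two_sum[OF insert(1) L]] by (simp add: L_two_norm_scaleR)
    also have "\<dots> \<le> norm \<eta> * L_two_norm unit_cell (g i) + (\<Sum>i\<in>I. norm \<eta> * L_two_norm unit_cell (g i))"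
      using insert(3) by (intro add_mono mult_right_mono component_le_norm_cart L_two_norm_nonneg) auto
    finally show ?case using insert by simp
  qed
  from this[of UNIV] show ?thesis by (simp add: g_dir_def[abs_def] sum_distrib_left)
qed

text \<open>The bridge between the local problem, which defines the homogenized matrix, and the adjoint flux, which
  appears in the limit. Both sides equal the mean of \<open>\<sigma> (\<eta> - g_dir \<eta>) \<bullet> (\<xi> + R_grad R \<phi>)\<close>, where the local
  equation removes the term with \<open>R_grad R \<phi>\<close>; hence \<open>\<phi>\<close> is arbitrary.\<close>

lemma homogenized_inner:
  assumes \<phi>: "trig_poly \<phi>"
  shows "(homogenized \<sigma> g *v \<eta>) \<bullet> \<xi> = L_two_inner unit_cell (\<lambda>y. \<eta> - g_dir \<eta> y) (flux \<xi> \<phi>)"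
proof -
  define s where "s i y = \<sigma> y *v (axis i 1 - g i y)" for i y
  have sL: "L_two unit_cell (s i)" for i
    unfolding s_def by (intro \<sigma>_L_two L_two_diff L_two_const_cell gradient_like_L_two[OF gradient_like_g])
  have s_nth: "s k y $ i = (\<Sum>j\<in>UNIV. \<sigma> y $ i $ j * (of_bool (j = k) - g k y $ j))" for k i y
    unfolding s_def matrix_vector_mult_def by (auto simp: axis_def intro!: sum.cong)
  have hom: "homogenized \<sigma> g $ i $ k = L_two_inner unit_cell (s k) (\<lambda>y. axis i 1)" for i k
    by (simp add: homogenized_def L_two_inner_def inner_axis s_nth)
  define S where "S y = (\<Sum>i\<in>UNIV. \<eta> $ i *\<^sub>R s i y)" for y
  have SL: "L_two unit_cell S" unfolding S_def by (intro L_two_sum L_two_scaleR sL) simp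
  have S_eq: "S y = \<sigma> y *v (\<eta> - g_dir \<eta> y)" for y
  proof -
    have "\<eta> - g_dir \<eta> y = (\<Sum>i\<in>UNIV. \<eta> $ i *\<^sub>R (axis i 1 - g i y))"
      using basis_expansion[of \<eta>] by (simp add: g_dir_def scaleR_diff_right sum_subtractf scalar_mult_eq_scaleR)
    then show ?thesis by (simp add: S_def s_def matrix_vector_mult_scaleR linear_sum[OF matrix_vector_mul_linear])
  qed
  have inner_S: "L_two_inner unit_cell S w = (\<Sum>i\<in>UNIV. \<eta> $ i * L_two_inner unit_cell (s i) w)"
    if "L_two unit_cell w" for w
    using L_two_inner_sum_right[where I = UNIV and f = "\<lambda>i y. \<eta> $ i *\<^sub>R s i y" and S = unit_cell and h = w] that sL
    by (simp add: S_def[abs_def] L_two_scaleR L_two_inner_scaleR_right L_two_inner_commute[of _ _ w])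
  have s_const: "L_two_inner unit_cell (s k) (\<lambda>y. \<xi>) = (\<Sum>i\<in>UNIV. \<xi> $ i * homogenized \<sigma> g $ i $ k)" for k
  proof -
    have "\<xi> = (\<Sum>i\<in>UNIV. \<xi> $ i *\<^sub>R axis i 1)" using basis_expansion[of \<xi>] by (simp add: scalar_mult_eq_scaleR)
    then have "L_two_inner unit_cell (s k) (\<lambda>y. \<xi>) = L_two_inner unit_cell (s k) (\<lambda>y. \<Sum>i\<in>UNIV. \<xi> $ i *\<^sub>R axis i 1)"
      by simp
    also have "\<dots> = (\<Sum>i\<in>UNIV. \<xi> $ i * homogenized \<sigma> g $ i $ k)"
      unfolding hom by (subst L_two_inner_sum_right) (auto simp: sL L_two_const_cell L_two_scaleR L_two_inner_scaleR_right)
    finally show ?thesis .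
  qed
  have local: "L_two_inner unit_cell (s k) (R_grad R \<phi>) = 0" for k
  proof -
    have wg: "has_weak_grad unit_cell \<phi> (grad \<phi>)"
      by (rule smooth_has_weak_grad[OF unit_cell_open unit_cell_bounded trig_poly_smooth[OF \<phi>]])
    have "(LINT y|lebesgue_on unit_cell. (\<Sum>i\<in>UNIV. \<Sum>j\<in>UNIV.
           \<sigma> y $ i $ j * (of_bool (j = k) - g k y $ j) *
           (transpose R *v weak_grad unit_cell \<phi> y) $ i)) = 0"
      using g_local[of k] trig_poly_W12_per[OF \<phi>] unfolding local_solution_def by blast
    then have "0 = L_two_inner unit_cell (s k) (\<lambda>y. transpose R *v weak_grad unit_cell \<phi> y)"
      unfolding L_two_inner_def inner_vec_def s_nth inner_real_def sum_distrib_right by simp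
    also have "\<dots> = L_two_inner unit_cell (\<lambda>y. R *v s k y) (weak_grad unit_cell \<phi>)"
      unfolding L_two_inner_def inner_matrix_transpose ..
    also have "\<dots> = L_two_inner unit_cell (\<lambda>y. R *v s k y) (grad \<phi>)"
      by (rule weak_grad_inner_eq(1)[OF unit_cell_open unit_cell_bounded wg L_two_matrix(1)[OF sL]])
    also have "\<dots> = L_two_inner unit_cell (s k) (R_grad R \<phi>)"
      unfolding L_two_inner_def inner_matrix_transpose R_grad_def ..
    finally show ?thesis by simp
  qed
  have "(homogenized \<sigma> g *v \<eta>) \<bullet> \<xi> = (\<Sum>i\<in>UNIV. \<Sum>k\<in>UNIV. \<xi> $ i * (homogenized \<sigma> g $ i $ k * \<eta> $ k))"
    by (simp add: inner_vec_def matrix_vector_mult_def sum_distrib_left mult.commute)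
  also have "\<dots> = (\<Sum>k\<in>UNIV. \<Sum>i\<in>UNIV. \<xi> $ i * (homogenized \<sigma> g $ i $ k * \<eta> $ k))" by (rule sum.swap)
  also have "\<dots> = L_two_inner unit_cell S (\<lambda>y. \<xi>)"
    unfolding inner_S[OF L_two_const_cell] s_const by (simp add: sum_distrib_left mult_ac)
  also have "\<dots> = L_two_inner unit_cell S (\<lambda>y. \<xi> + R_grad R \<phi> y)"
    using L_two_inner_add_right[OF L_two_const_cell R_grad_L_two[OF \<phi>] SL, of \<xi>]
      inner_S[OF R_grad_L_two[OF \<phi>]] local by simp
  also have "\<dots> = L_two_inner unit_cell (\<lambda>y. \<eta> - g_dir \<eta> y) (flux \<xi> \<phi>)"
    unfolding L_two_inner_def S_eq flux_def inner_matrix_transpose ..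
  finally show ?thesis .
qed

text \<open>With \<open>\<phi>\<close> an approximate adjoint corrector for \<open>\<xi>\<close>, both \<open>g_dir \<xi>\<close> and \<open>R_grad R \<phi>\<close> are almost orthogonal to the flux, so
  the quadratic form of the homogenized matrix is almost the energy of \<open>\<xi> + R_grad R \<phi>\<close>, and \<open>R_grad R \<phi>\<close> is orthogonal
  to \<open>\<xi>\<close>.\<close>

lemma homogenized_coercive: "c * (norm \<xi>)\<^sup>2 \<le> (homogenized \<sigma> g *v \<xi>) \<bullet> \<xi>"
proof (rule field_le_epsilon)
  fix e :: real assume e: "e > 0"
  let ?n = "L_two_norm unit_cell (g_dir \<xi>)"
  define K where "K = 1 / (4 * c) + ?n + 1"
  have K: "K > 0" unfolding K_def using c_pos L_two_norm_nonneg[of unit_cell "g_dir \<xi>"] by (simp add: add_pos_nonneg)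
  define d where "d = min 1 (e / K)"
  have d: "d > 0" "d \<le> 1" using e K by (auto simp: d_def)
  have dK: "d * K \<le> e"
  proof -
    have "d * K \<le> e / K * K" using K by (intro mult_right_mono) (auto simp: d_def)
    then show ?thesis using K by simp
  qed
  obtain \<phi> where \<phi>: "approximate_corrector d \<xi> \<phi>" using approximate_corrector_exists[OF d(1)] .
  have trig: "trig_poly \<phi>" using \<phi> by (simp add: approximate_corrector_def)
  note fL = flux_L_two[OF trig, of \<xi>]
  let ?w = "\<lambda>y. \<xi> + R_grad R \<phi> y" and ?r = "L_two_norm unit_cell (R_grad R \<phi>)"
  have GL: "L_two unit_cell (R_grad R \<phi>)" by (rule R_grad_L_two[OF trig])
  have z: "L_two_inner unit_cell (R_grad R \<phi>) (\<lambda>y. \<xi>) = 0"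
    by (rule gradient_like_const[OF gradient_like_R_grad[OF trig]])
  then have "L_two_inner unit_cell (\<lambda>y. \<xi>) (R_grad R \<phi>) = 0" by (simp add: L_two_inner_commute)
  with z GL have "(L_two_norm unit_cell ?w)\<^sup>2 = (norm \<xi>)\<^sup>2 + ?r\<^sup>2"
    by (simp add: L_two_norm_power2 L_two_inner_add_left L_two_inner_add_right L_two_const_cell L_two_add
        L_two_inner_const_cell power2_norm_eq_inner)
  then have "c * ((norm \<xi>)\<^sup>2 + ?r\<^sup>2) \<le> L_two_inner unit_cell ?w (flux \<xi> \<phi>)"
    using \<sigma>_transpose_coercive[OF field_L_two[OF trig], of \<xi>] by (simp add: flux_def[abs_def])
  also have "\<dots> = L_two_inner unit_cell (\<lambda>y. \<xi>) (flux \<xi> \<phi>) + L_two_inner unit_cell (R_grad R \<phi>) (flux \<xi> \<phi>)"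
    by (rule L_two_inner_add_left[OF L_two_const_cell GL fL])
  also have "L_two_inner unit_cell (\<lambda>y. \<xi>) (flux \<xi> \<phi>)
      = (homogenized \<sigma> g *v \<xi>) \<bullet> \<xi> + L_two_inner unit_cell (g_dir \<xi>) (flux \<xi> \<phi>)"
    using homogenized_inner[OF trig, of \<xi> \<xi>]
      L_two_inner_diff_left[OF L_two_const_cell gradient_like_L_two[OF gradient_like_g_dir] fL, of \<xi> \<xi>] by simp
  also have "L_two_inner unit_cell (g_dir \<xi>) (flux \<xi> \<phi>) \<le> d * ?n"
    by (rule abs_le_D1[OF approximate_corrector_gradient_like[OF \<phi> less_imp_le[OF d(1)] gradient_like_g_dir]])
  also have "L_two_inner unit_cell (R_grad R \<phi>) (flux \<xi> \<phi>) \<le> d * ?r"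
    by (rule abs_le_D1[OF approximate_corrector_gradient_like[OF \<phi> less_imp_le[OF d(1)] gradient_like_R_grad[OF trig]]])
  finally have main: "c * (norm \<xi>)\<^sup>2 + c * ?r\<^sup>2 \<le> (homogenized \<sigma> g *v \<xi>) \<bullet> \<xi> + d * ?n + d * ?r"
    by (simp add: distrib_left)
  \<comment> \<open>completing the square absorbs the error \<open>d * ?r\<close>, for which no bound on \<open>?r\<close> is at hand\<close>
  have "0 \<le> c * (?r - d / (2 * c))\<^sup>2" using c_pos by simp
  also have "\<dots> = c * ?r\<^sup>2 - d * ?r + d * d / (4 * c)"
    using c_pos by (simp add: power2_diff field_simps power2_eq_square)
  finally have "d * ?r \<le> c * ?r\<^sup>2 + d * d / (4 * c)" by simp
  moreover have "d * d / (4 * c) \<le> d * (1 / (4 * c))"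
    using d c_pos mult_left_mono[OF d(2), of d] by (simp add: divide_right_mono)
  moreover have "d * (1 / (4 * c)) + d * ?n \<le> d * K" using d by (simp add: K_def algebra_simps)
  ultimately show "c * (norm \<xi>)\<^sup>2 \<le> (homogenized \<sigma> g *v \<xi>) \<bullet> \<xi> + e" using main dK by linarith
qed

text \<open>What becomes of the adjoint flux when \<open>P\<close> replaces \<open>\<sigma>\<close>. The condition speaks of a single \<open>P\<close>, so that \<open>\<phi>\<close> can be
  fixed first.\<close>

definition splits_near_homogenized ::
  "real \<Rightarrow> real^3 \<Rightarrow> (real^'m \<Rightarrow> real) \<Rightarrow> (real^'m \<Rightarrow> real^3^3) \<Rightarrow> bool" where
  "splits_near_homogenized d \<xi> \<phi> P \<longleftrightarrow> (\<exists>a B \<psi>. solenoidal R B \<and> trig_poly \<psi> \<and>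
     (\<forall>y. transpose (P y) *v (\<xi> + R_grad R \<phi> y) = a + B y + R_grad R \<psi> y) \<and>
     L_two_norm unit_cell (R_grad R \<psi>) \<le> d \<and> norm (a - transpose (homogenized \<sigma> g) *v \<xi>) \<le> d)"

text \<open>The order of the quantifiers is essential: \<open>\<phi>\<close> is chosen before \<open>P\<close>. The error \<open>\<sigma> - P\<close> is small only in mean square,
  and it is multiplied by the supremum of \<open>\<xi> + R_grad R \<phi>\<close>, which depends on \<open>\<phi>\<close>.\<close>

lemma trigonometric_flux_homogenized:
  assumes d: "d > 0"
  obtains \<phi> e where "trig_poly \<phi>" "e > 0"
    "\<And>P. trig_matrix P \<Longrightarrow> L_two_norm unit_cell (\<lambda>y. \<sigma> y - P y) \<le> e \<Longrightarrow>
      splits_near_homogenized d \<xi> \<phi> P"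
proof -
  define N where "N = (\<Sum>i\<in>UNIV. L_two_norm unit_cell (g i))"
  have N: "N \<ge> 0" unfolding N_def by (intro sum_nonneg L_two_norm_nonneg)
  define d1 where "d1 = d / (2 * (1 + N))"
  have d1: "d1 > 0" "d1 \<le> d / 2" "d1 * N \<le> d / 2" using d N by (auto simp: d1_def field_simps)
  obtain \<phi> where \<phi>: "approximate_corrector d1 \<xi> \<phi>" using approximate_corrector_exists[OF d1(1)] .
  have trig: "trig_poly \<phi>" using \<phi> by (simp add: approximate_corrector_def)
  obtain E where E: "E \<ge> 0" "\<And>y. y \<in> unit_cell \<Longrightarrow> norm (\<xi> + R_grad R \<phi> y) \<le> E"
    using field_bounded[OF trig] by blast
  define e where "e = d / (2 * (E + 1))"
  have e: "e > 0" "E * e \<le> d / 2" using d E(1) by (auto simp: e_def field_simps)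
  have "splits_near_homogenized d \<xi> \<phi> P"
    if P: "trig_matrix P" "L_two_norm unit_cell (\<lambda>y. \<sigma> y - P y) \<le> e" for P
  proof -
    obtain a B \<psi> where s: "solenoidal R B" "trig_poly \<psi>"
      "\<forall>y. transpose (P y) *v (\<xi> + R_grad R \<phi> y) = a + B y + R_grad R \<psi> y"
      "L_two_norm unit_cell (R_grad R \<psi>) \<le> d1 + E * e"
      "L_two_norm unit_cell (\<lambda>y. flux \<xi> \<phi> y - (a + B y + R_grad R \<psi> y)) \<le> E * e"
      using trigonometric_flux[OF \<phi> less_imp_le[OF d1(1)] P(1) E P(2)] by blast
    let ?T = "\<lambda>y. a + B y + R_grad R \<psi> y"
    have TL: "L_two unit_cell ?T"
      by (intro L_two_add L_two_const_cell solenoidal_L_two[OF s(1)] R_grad_L_two[OF s(2)])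
    note fL = flux_L_two[OF trig, of \<xi>]
    define \<eta> where "\<eta> = a - transpose (homogenized \<sigma> g) *v \<xi>"
    have "norm \<eta> * norm \<eta> = \<eta> \<bullet> a - (homogenized \<sigma> g *v \<eta>) \<bullet> \<xi>"
      unfolding inner_matrix_transpose inner_diff_right[symmetric] \<eta>_def[symmetric]
      by (simp add: dot_square_norm power2_eq_square)
    also have "\<dots> = L_two_inner unit_cell (\<lambda>y. \<eta>) ?T - L_two_inner unit_cell (\<lambda>y. \<eta>) (flux \<xi> \<phi>)
        + L_two_inner unit_cell (g_dir \<eta>) (flux \<xi> \<phi>)"
      using const_split[OF s(1,2), of \<eta> a] homogenized_inner[OF trig, of \<eta> \<xi>]
        L_two_inner_diff_left[OF L_two_const_cell gradient_like_L_two[OF gradient_like_g_dir] fL, of \<eta> \<eta>] by simp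
    also have "\<dots> = L_two_inner unit_cell (g_dir \<eta>) (flux \<xi> \<phi>) - L_two_inner unit_cell (\<lambda>y. \<eta>) (\<lambda>y. flux \<xi> \<phi> y - ?T y)"
      using L_two_inner_diff_right[OF fL TL L_two_const_cell, of \<eta>] by simp
    also have "\<dots> \<le> d1 * (norm \<eta> * N) + norm \<eta> * (E * e)"
    proof -
      have "L_two_inner unit_cell (g_dir \<eta>) (flux \<xi> \<phi>) \<le> d1 * L_two_norm unit_cell (g_dir \<eta>)"
        by (rule abs_le_D1[OF approximate_corrector_gradient_like[OF \<phi> less_imp_le[OF d1(1)] gradient_like_g_dir]])
      also have "\<dots> \<le> d1 * (norm \<eta> * N)" using d1 g_dir_norm[of \<eta>] by (simp add: N_def)
      finally have 1: "L_two_inner unit_cell (g_dir \<eta>) (flux \<xi> \<phi>) \<le> d1 * (norm \<eta> * N)" .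
      have "\<bar>L_two_inner unit_cell (\<lambda>y. \<eta>) (\<lambda>y. flux \<xi> \<phi> y - ?T y)\<bar> \<le> norm \<eta> * (E * e)"
        by (rule order_trans[OF L_two_inner_le[OF L_two_const_cell L_two_diff[OF fL TL]]])
          (simp only: L_two_norm_const_cell, intro mult_left_mono s norm_ge_zero)
      with 1 show ?thesis by linarith
    qed
    also have "\<dots> = (d1 * N + E * e) * norm \<eta>" by (simp add: algebra_simps)
    also have "\<dots> \<le> d * norm \<eta>" using d1 e by (intro mult_right_mono) auto
    finally have "norm \<eta> * norm \<eta> \<le> d * norm \<eta>" .
    then have "norm \<eta> \<le> d" using d by (cases "norm \<eta> = 0") (auto simp: mult_le_cancel_right)
    moreover have "L_two_norm unit_cell (R_grad R \<psi>) \<le> d" using s(4) d1 e by linarith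
    ultimately show ?thesis using s(1-3) unfolding \<eta>_def splits_near_homogenized_def by blast
  qed
  with trig e(1) show ?thesis by (rule that)
qed

end

section \<open>Oscillating functions on the domain\<close>

abbreviation cut_point :: "real^3^'m \<Rightarrow> real \<Rightarrow> real^3 \<Rightarrow> real^'m" where
  "cut_point R \<eta> x \<equiv> (1 / \<eta>) *\<^sub>R (R *v x)"

lemma wave_cut_point: "wave l \<theta> (cut_point R \<eta> x) = cos ((((2 * pi) / \<eta>) *\<^sub>R freq R l) \<bullet> x + \<theta>)"
proof -
  have "int_vec l \<bullet> (R *v x) = freq R l \<bullet> x"
    unfolding freq_def by (metis inner_commute inner_matrix_transpose)
  then show ?thesis by (simp add: wave_def)
qed

lemma smooth_cut:
  fixes R :: "real^3^'m"
  assumes "trig_poly \<phi>" shows "smooth (\<lambda>x. \<phi> (cut_point R \<eta> x))"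
  using assms
proof (induction rule: trig_poly.induct)
  case (trig_poly_cos a l \<theta>)
  show ?case unfolding wave_def[symmetric] wave_cut_point by (rule smooth_cos_ridge)
qed (rule smooth_add)

lemma grad_cut:
  fixes R :: "real^3^'m"
  assumes "trig_poly \<phi>"
  shows "grad (\<lambda>x. \<phi> (cut_point R \<eta> x)) x = (1 / \<eta>) *\<^sub>R R_grad R \<phi> (cut_point R \<eta> x)"
proof (rule grad_eqI)
  have "linear (\<lambda>x. cut_point R \<eta> x)"
    by (intro linear_compose_scale_right matrix_vector_mul_linear)
  then have "((\<lambda>x. cut_point R \<eta> x) has_derivative (\<lambda>h. cut_point R \<eta> h)) (at x)"
    by (simp add: linear_imp_has_derivative)
  from has_derivative_compose[OF this smooth_has_derivative[OF trig_poly_smooth[OF assms]]]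
  have "((\<lambda>x. \<phi> (cut_point R \<eta> x)) has_derivative (\<lambda>h. grad \<phi> (cut_point R \<eta> x) \<bullet> cut_point R \<eta> h)) (at x)" .
  moreover have "grad \<phi> (cut_point R \<eta> x) \<bullet> cut_point R \<eta> h = ((1 / \<eta>) *\<^sub>R R_grad R \<phi> (cut_point R \<eta> x)) \<bullet> h" for h
    unfolding R_grad_def inner_scaleR_left inner_scaleR_right by (metis inner_commute inner_matrix_transpose)
  then have "(\<lambda>h. grad \<phi> (cut_point R \<eta> x) \<bullet> cut_point R \<eta> h) = (\<lambda>h. ((1 / \<eta>) *\<^sub>R R_grad R \<phi> (cut_point R \<eta> x)) \<bullet> h)"
    by (rule ext)
  ultimately show "((\<lambda>x. \<phi> (cut_point R \<eta> x)) has_derivative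
     (\<lambda>h. ((1 / \<eta>) *\<^sub>R R_grad R \<phi> (cut_point R \<eta> x)) \<bullet> h)) (at x)" by (simp only:)
qed

lemma continuous_cut_point [continuous_intros]: "continuous_on S (\<lambda>x. cut_point R \<eta> x)"
  by (intro continuous_intros)

lemma trig_poly_bounded:
  assumes "trig_poly f" obtains C where "C \<ge> 0" "\<And>y. \<bar>f y\<bar> \<le> C"
proof -
  have "\<exists>C\<ge>0. \<forall>y. \<bar>f y\<bar> \<le> C" using assms
  proof (induction rule: trig_poly.induct)
    case (trig_poly_cos a l \<theta>)
    then show ?case by (intro exI[of _ "\<bar>a\<bar>"]) (auto simp: abs_mult mult_left_le)
  next
    case (trig_poly_add f g)
    then obtain C D where "C \<ge> 0" "\<forall>y. \<bar>f y\<bar> \<le> C" "D \<ge> 0" "\<forall>y. \<bar>g y\<bar> \<le> D" by blast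
    then show ?case by (intro exI[of _ "C + D"]) (auto intro: order_trans[OF abs_triangle_ineq] add_mono)
  qed
  then show ?thesis using that by blast
qed

lemma trig_vector_bounded:
  fixes T :: "real^'m \<Rightarrow> real^'b"
  assumes "trig_vector T" obtains C where "C \<ge> 0" "\<And>y. norm (T y) \<le> C"
proof -
  have "\<forall>j. \<exists>C. C \<ge> 0 \<and> (\<forall>y. \<bar>T y $ j\<bar> \<le> C)"
    using assms unfolding trig_vector_def by (meson trig_poly_bounded)
  then obtain C where C: "\<And>j. C j \<ge> 0" "\<And>j y. \<bar>T y $ j\<bar> \<le> C j" by metis
  have "norm (T y) \<le> (\<Sum>j\<in>UNIV. C j)" for y
    by (rule order_trans[OF norm_le_l1_cart]) (intro sum_mono C)
  moreover have "0 \<le> (\<Sum>j\<in>UNIV. C j)" using C by (intro sum_nonneg)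
  ultimately show ?thesis using that by blast
qed

lemma trig_matrix_bounded:
  fixes P :: "real^'m \<Rightarrow> real^'a^'b"
  assumes "trig_matrix P" obtains C where "C \<ge> 0" "\<And>y. norm (P y) \<le> C"
proof -
  have "\<forall>i. \<exists>C. C \<ge> 0 \<and> (\<forall>y. norm (P y $ i) \<le> C)"
  proof
    fix i
    have "trig_vector (\<lambda>y. P y $ i)" using assms by (simp add: trig_vector_def trig_matrix_def)
    then show "\<exists>C. C \<ge> 0 \<and> (\<forall>y. norm (P y $ i) \<le> C)" using trig_vector_bounded by metis
  qed
  then obtain C where C: "\<And>j. C j \<ge> 0" "\<And>j y. norm (P y $ j) \<le> C j" by metis
  have "norm (P y) \<le> (\<Sum>j\<in>UNIV. C j)" for y
  proof -
    have "norm (P y) \<le> (\<Sum>i\<in>UNIV. norm (P y $ i))" unfolding norm_vec_def by (rule L2_set_le_sum) simp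
    also have "\<dots> \<le> (\<Sum>j\<in>UNIV. C j)" by (intro sum_mono C)
    finally show ?thesis .
  qed
  moreover have "0 \<le> (\<Sum>j\<in>UNIV. C j)" using C by (intro sum_nonneg)
  ultimately show ?thesis using that by blast
qed

lemma has_weak_grad_direction:
  assumes U: "open U" "bounded U" and u: "has_weak_grad U u g" and \<psi>: "test_function U \<psi>"
  shows "L_two_inner U u (\<lambda>x. b \<bullet> grad \<psi> x) = - L_two_inner U g (\<lambda>x. \<psi> x *\<^sub>R b)"
proof -
  note T = L_two_test[OF U \<psi>]
  have uL: "L_two U u" "L_two U g" using u by (auto simp: has_weak_grad_def)
  have b: "b = (\<Sum>i\<in>UNIV. b $ i *\<^sub>R axis i 1)" using basis_expansion[of b] by (simp add: scalar_mult_eq_scaleR)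
  have "L_two_inner U u (\<lambda>x. b \<bullet> grad \<psi> x) = L_two_inner U u (\<lambda>x. \<Sum>i\<in>UNIV. b $ i *\<^sub>R grad \<psi> x $ i)"
    by (simp add: inner_vec_def)
  also have "\<dots> = (\<Sum>i\<in>UNIV. b $ i * L_two_inner U u (\<lambda>x. grad \<psi> x $ i))"
    by (subst L_two_inner_sum_right) (auto simp only: finite L_two_inner_scaleR_right intro!: L_two_scaleR T uL)
  also have "\<dots> = (\<Sum>i\<in>UNIV. b $ i * - L_two_inner U g (\<lambda>x. \<psi> x *\<^sub>R axis i 1))"
    using u \<psi> by (simp add: has_weak_grad_inner_iff)
  also have "\<dots> = - (\<Sum>i\<in>UNIV. b $ i * L_two_inner U g (\<lambda>x. \<psi> x *\<^sub>R axis i 1))"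
    by (simp add: sum_negf)
  also have "(\<Sum>i\<in>UNIV. b $ i * L_two_inner U g (\<lambda>x. \<psi> x *\<^sub>R axis i 1))
      = L_two_inner U g (\<lambda>x. \<Sum>i\<in>UNIV. b $ i *\<^sub>R (\<psi> x *\<^sub>R axis i 1))"
    by (subst L_two_inner_sum_right) (auto simp only: finite L_two_inner_scaleR_right intro!: L_two_scaleR T uL)
  also have "(\<lambda>x. \<Sum>i\<in>UNIV. b $ i *\<^sub>R (\<psi> x *\<^sub>R axis i 1)) = (\<lambda>x. \<psi> x *\<^sub>R b)"
    by (subst (2) b) (simp add: scaleR_sum_right mult.commute)
  finally show ?thesis .
qed

text \<open>Integrating by parts against the primitive of a wave gains a factor of the order of the wave
  length.\<close>

lemma oscillation_bound:
  fixes \<zeta> :: "real^'n"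
  assumes U: "open U" "bounded U" and u: "has_weak_grad U u g" and h: "test_function U h" and \<zeta>: "\<zeta> \<noteq> 0"
  shows "\<bar>L_two_inner U u (\<lambda>x. h x * cos (\<zeta> \<bullet> x + \<theta>))\<bar>
    \<le> (L_two_norm U g * L_two_norm U h + L_two_norm U u * L_two_norm U (grad h)) / norm \<zeta>"
proof -
  \<comment> \<open>the derivative of \<open>?s\<close> in direction \<open>\<zeta>\<close> is \<open>(norm \<zeta>)\<^sup>2\<close> times the given wave\<close>
  let ?s = "\<lambda>x. 1 * cos (\<zeta> \<bullet> x + (\<theta> - pi / 2))"
  have ss: "smooth ?s" by (rule smooth_cos_ridge)
  have sh: "smooth h" by (rule test_function_smooth[OF h])
  define \<psi> where "\<psi> x = h x * ?s x" for x
  have \<psi>: "test_function U \<psi>" unfolding \<psi>_def by (rule test_function_mult[OF h ss])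
  have g\<psi>: "grad \<psi> x = h x *\<^sub>R (cos (\<zeta> \<bullet> x + \<theta>) *\<^sub>R \<zeta>) + ?s x *\<^sub>R grad h x" for x
    unfolding \<psi>_def grad_mult_smooth[OF sh ss] grad_cos_ridge by simp
  have uL: "L_two U u" "L_two U g" using u by (auto simp: has_weak_grad_def)
  note hL = L_two_test[OF U h]
  define p where "p x = h x * cos (\<zeta> \<bullet> x + \<theta>)" for x
  define q where "q x = ?s x * (\<zeta> \<bullet> grad h x)" for x
  have cont: "continuous_on UNIV p" "continuous_on UNIV q"
    unfolding p_def q_def by (intro continuous_intros smooth_continuous[OF sh] smooth_continuous_grad[OF sh])+
  have L: "L_two U p" "L_two U q" using L_two_continuous[OF U] cont by auto
  have "(norm \<zeta>)\<^sup>2 * L_two_inner U u p + L_two_inner U u q = L_two_inner U u (\<lambda>x. \<zeta> \<bullet> grad \<psi> x)"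
  proof -
    have "\<zeta> \<bullet> grad \<psi> x = (norm \<zeta>)\<^sup>2 *\<^sub>R p x + q x" for x
      by (simp add: g\<psi> p_def q_def inner_add_right power2_norm_eq_inner mult_ac)
    then have "L_two_inner U u (\<lambda>x. \<zeta> \<bullet> grad \<psi> x) = L_two_inner U u (\<lambda>x. (norm \<zeta>)\<^sup>2 *\<^sub>R p x + q x)" by presburger
    also have "\<dots> = (norm \<zeta>)\<^sup>2 * L_two_inner U u p + L_two_inner U u q"
      unfolding L_two_inner_add_right[OF L_two_scaleR[OF L(1)] L(2) uL(1)] L_two_inner_scaleR_right ..
    finally show ?thesis by simp
  qed
  also have "\<dots> = - L_two_inner U g (\<lambda>x. \<psi> x *\<^sub>R \<zeta>)" by (rule has_weak_grad_direction[OF U u \<psi>])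
  finally have eq: "(norm \<zeta>)\<^sup>2 * L_two_inner U u p = - (L_two_inner U g (\<lambda>x. \<psi> x *\<^sub>R \<zeta>) + L_two_inner U u q)"
    by linarith
  have "(norm \<zeta>)\<^sup>2 * \<bar>L_two_inner U u p\<bar> = \<bar>(norm \<zeta>)\<^sup>2 * L_two_inner U u p\<bar>" by (simp add: abs_mult)
  also have "\<dots> = \<bar>L_two_inner U g (\<lambda>x. \<psi> x *\<^sub>R \<zeta>) + L_two_inner U u q\<bar>" unfolding eq by (rule abs_minus_cancel)
  also have "\<dots> \<le> \<bar>L_two_inner U g (\<lambda>x. \<psi> x *\<^sub>R \<zeta>)\<bar> + \<bar>L_two_inner U u q\<bar>" by (rule abs_triangle_ineq)
  also have "\<dots> \<le> L_two_norm U g * (norm \<zeta> * L_two_norm U h) + L_two_norm U u * (norm \<zeta> * L_two_norm U (grad h))"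
  proof (rule add_mono)
    have c\<psi>: "continuous_on UNIV (\<lambda>x. \<psi> x *\<^sub>R \<zeta>)"
      by (intro continuous_intros smooth_continuous[OF test_function_smooth[OF \<psi>]])
    have "L_two_norm U (\<lambda>x. \<psi> x *\<^sub>R \<zeta>) \<le> norm \<zeta> * L_two_norm U h"
    proof (rule L_two_norm_mono[OF hL(1) continuous_borel_measurable_on[OF c\<psi>]])
      show "AE x in lebesgue_on U. norm (\<psi> x *\<^sub>R \<zeta>) \<le> norm \<zeta> * norm (h x)"
        by (intro AE_I2) (simp add: \<psi>_def abs_mult mult_left_le mult.commute[of _ "norm \<zeta>"] mult_left_mono)
    qed simp
    then show "\<bar>L_two_inner U g (\<lambda>x. \<psi> x *\<^sub>R \<zeta>)\<bar> \<le> L_two_norm U g * (norm \<zeta> * L_two_norm U h)"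
      using L_two_inner_le[OF uL(2) L_two_continuous[OF U c\<psi>]]
      by (meson L_two_norm_nonneg mult_left_mono order_trans)
    have "L_two_norm U q \<le> norm \<zeta> * L_two_norm U (grad h)"
    proof (rule L_two_norm_mono[OF hL(2)])
      show "AE x in lebesgue_on U. norm (q x) \<le> norm \<zeta> * norm (grad h x)"
      proof (rule AE_I2)
        fix x
        have "norm (q x) \<le> 1 * \<bar>\<zeta> \<bullet> grad h x\<bar>" unfolding q_def real_norm_def abs_mult by (intro mult_right_mono) auto
        also have "\<dots> \<le> norm \<zeta> * norm (grad h x)" by (simp add: Cauchy_Schwarz_ineq2)
        finally show "norm (q x) \<le> norm \<zeta> * norm (grad h x)" .
      qed
    qed (auto simp: cont continuous_borel_measurable_on)
    then show "\<bar>L_two_inner U u q\<bar> \<le> L_two_norm U u * (norm \<zeta> * L_two_norm U (grad h))"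
      using L_two_inner_le[OF uL(1) L(2)] by (meson L_two_norm_nonneg mult_left_mono order_trans)
  qed
  finally have "norm \<zeta> * (norm \<zeta> * \<bar>L_two_inner U u p\<bar>)
      \<le> norm \<zeta> * (L_two_norm U g * L_two_norm U h + L_two_norm U u * L_two_norm U (grad h))"
    by (simp add: power2_eq_square algebra_simps)
  then have "norm \<zeta> * \<bar>L_two_inner U u p\<bar> \<le> L_two_norm U g * L_two_norm U h + L_two_norm U u * L_two_norm U (grad h)"
    using \<zeta> by simp
  then show ?thesis using \<zeta> unfolding p_def by (simp add: field_simps)
qed

text \<open>A divergence-free wave can be moved off the weak gradient, since the derivative of the wave in its own direction
  vanishes; what remains is an oscillating integral of \<open>u\<close> itself. The bound depends on \<open>u\<close> only through its norms.\<close>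

lemma solenoidal_oscillation:
  fixes R :: "real^3^'m"
  assumes U: "open U" "bounded U" and nonres: "\<And>k. k \<noteq> 0 \<Longrightarrow> freq R k \<noteq> 0"
    and h: "test_function U h" and "solenoidal R B"
  shows "\<exists>C. \<forall>\<eta>>0. \<forall>u g. has_weak_grad U u g \<longrightarrow>
     \<bar>L_two_inner U g (\<lambda>x. h x *\<^sub>R B (cut_point R \<eta> x))\<bar> \<le> C * \<eta> * (L_two_norm U u + L_two_norm U g)"
  using assms(5)
proof (induction rule: solenoidal.induct)
  case solenoidal_zero
  show ?case by (intro exI[of _ 0]) (simp add: L_two_inner_def)
next
  case (solenoidal_wave l b \<theta>)
  define h' where "h' x = b \<bullet> grad h x" for x
  have h': "test_function U h'"
  proof -
    have "test_function U (\<lambda>x. \<Sum>i\<in>UNIV. b $ i * grad h x $ i)"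
      by (intro test_function_sum test_function_cmult test_function_grad h) simp
    then show ?thesis by (simp add: h'_def[abs_def] inner_vec_def)
  qed
  define C where "C = (L_two_norm U h' + L_two_norm U (grad h')) / (2 * pi * norm (freq R l))"
  have fr: "freq R l \<noteq> 0" by (rule nonres[OF solenoidal_wave(1)])
  have "\<bar>L_two_inner U g (\<lambda>x. h x *\<^sub>R (wave l \<theta> (cut_point R \<eta> x) *\<^sub>R b))\<bar> \<le> C * \<eta> * (L_two_norm U u + L_two_norm U g)"
    if \<eta>: "\<eta> > 0" and u: "has_weak_grad U u g" for \<eta> u g
  proof -
    define \<zeta> where "\<zeta> = ((2 * pi) / \<eta>) *\<^sub>R freq R l"
    have \<zeta>0: "\<zeta> \<noteq> 0" using fr \<eta> by (simp add: \<zeta>_def)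
    have b\<zeta>: "b \<bullet> \<zeta> = 0" using solenoidal_wave(2) by (simp add: \<zeta>_def)
    let ?w = "\<lambda>x. 1 * cos (\<zeta> \<bullet> x + \<theta>)"
    have sw: "smooth ?w" by (rule smooth_cos_ridge)
    have \<psi>: "test_function U (\<lambda>x. h x * ?w x)" by (rule test_function_mult[OF h sw])
    have gr: "b \<bullet> grad (\<lambda>x. h x * ?w x) x = h' x * cos (\<zeta> \<bullet> x + \<theta>)" for x
      unfolding grad_mult_smooth[OF test_function_smooth[OF h] sw] grad_cos_ridge
      by (simp add: inner_add_right b\<zeta> h'_def)
    have "L_two_inner U g (\<lambda>x. h x *\<^sub>R (wave l \<theta> (cut_point R \<eta> x) *\<^sub>R b)) = L_two_inner U g (\<lambda>x. (h x * ?w x) *\<^sub>R b)"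
      unfolding wave_cut_point \<zeta>_def[symmetric] by simp
    also have "\<dots> = - L_two_inner U u (\<lambda>x. h' x * cos (\<zeta> \<bullet> x + \<theta>))"
      using has_weak_grad_direction[OF U u \<psi>, of b] unfolding gr by simp
    finally have "\<bar>L_two_inner U g (\<lambda>x. h x *\<^sub>R (wave l \<theta> (cut_point R \<eta> x) *\<^sub>R b))\<bar>
        \<le> (L_two_norm U g * L_two_norm U h' + L_two_norm U u * L_two_norm U (grad h')) / norm \<zeta>"
      using oscillation_bound[OF U u h' \<zeta>0, of \<theta>] by simp
    also have "\<dots> \<le> ((L_two_norm U h' + L_two_norm U (grad h')) * (L_two_norm U u + L_two_norm U g)) / norm \<zeta>"
      using L_two_norm_nonneg[of U u] L_two_norm_nonneg[of U g] L_two_norm_nonneg[of U h'] L_two_norm_nonneg[of U "grad h'"]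
      by (intro divide_right_mono) (auto simp: algebra_simps)
    also have "\<dots> = C * \<eta> * (L_two_norm U u + L_two_norm U g)"
      using \<eta> fr by (simp add: C_def \<zeta>_def field_simps)
    finally show ?thesis .
  qed
  then show ?case by blast
next
  case (solenoidal_add B B')
  from solenoidal_add.IH obtain C C' where
    C: "\<And>\<eta> u g. \<eta> > 0 \<Longrightarrow> has_weak_grad U u g \<Longrightarrow>
     \<bar>L_two_inner U g (\<lambda>x. h x *\<^sub>R B (cut_point R \<eta> x))\<bar> \<le> C * \<eta> * (L_two_norm U u + L_two_norm U g)" and
    C': "\<And>\<eta> u g. \<eta> > 0 \<Longrightarrow> has_weak_grad U u g \<Longrightarrow>
     \<bar>L_two_inner U g (\<lambda>x. h x *\<^sub>R B' (cut_point R \<eta> x))\<bar> \<le> C' * \<eta> * (L_two_norm U u + L_two_norm U g)"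
    by blast
  have "\<bar>L_two_inner U g (\<lambda>x. h x *\<^sub>R (B (cut_point R \<eta> x) + B' (cut_point R \<eta> x)))\<bar> \<le> (C + C') * \<eta> * (L_two_norm U u + L_two_norm U g)"
    if \<eta>: "\<eta> > 0" and u: "has_weak_grad U u g" for \<eta> u g
  proof -
    have L: "L_two U (\<lambda>x. h x *\<^sub>R D (cut_point R \<eta> x))" if "solenoidal R D" for D
      by (intro L_two_continuous[OF U] continuous_on_scaleR smooth_continuous[OF test_function_smooth[OF h]]
          continuous_on_compose2[OF solenoidal_continuous[OF that] continuous_cut_point subset_UNIV])
    have gL: "L_two U g" using u by (simp add: has_weak_grad_def)
    show ?thesis unfolding scaleR_add_right L_two_inner_add_right[OF L[OF solenoidal_add.hyps(1)] L[OF solenoidal_add.hyps(2)] gL]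
      using C[OF \<eta> u] C'[OF \<eta> u] by (simp add: algebra_simps)
  qed
  then show ?case by blast
qed

text \<open>The nonconstant modes are killed by the oscillation bound with the constant function \<open>1\<close> in the role of \<open>u\<close>.\<close>

lemma trig_poly_mean_value:
  fixes R :: "real^3^'m"
  assumes U: "open U" "bounded U" and nonres: "\<And>k. k \<noteq> 0 \<Longrightarrow> freq R k \<noteq> 0"
    and h: "test_function U h" and "trig_poly T"
  shows "((\<lambda>\<eta>. LINT x|lebesgue_on U. h x * T (cut_point R \<eta> x)) \<longlongrightarrow>
     (LINT x|lebesgue_on U. h x) * (LINT y|lebesgue_on unit_cell. T y)) (at_right 0)"
  using assms(5)
proof (induction rule: trig_poly.induct)
  case (trig_poly_cos a l \<theta>)
  have "((\<lambda>\<eta>. LINT x|lebesgue_on U. h x * (a * wave l \<theta> (cut_point R \<eta> x))) \<longlongrightarrow>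
     (LINT x|lebesgue_on U. h x) * (LINT y|lebesgue_on unit_cell. a * wave l \<theta> y)) (at_right 0)"
  proof (cases "l = 0")
    case True
    then have "wave l \<theta> y = cos \<theta>" for y by (simp add: wave_def)
    then show ?thesis by (simp add: measure_lebesgue_on_unit_cell)
  next
    case False
    have fr: "freq R l \<noteq> 0" by (rule nonres[OF False])
    have zero: "(LINT y|lebesgue_on unit_cell. a * wave l \<theta> y) = 0"
      unfolding wave_def using integral_cos_unit_cell[OF False] by simp
    have one: "has_weak_grad U (\<lambda>x. 1) (grad (\<lambda>x. 1))"
      by (rule smooth_has_weak_grad[OF U smooth_const])
    define C where "C = \<bar>a\<bar> * (L_two_norm U (grad (\<lambda>x::real^3. 1::real)) * L_two_norm U h
        + L_two_norm U (\<lambda>x::real^3. 1::real) * L_two_norm U (grad h)) / (2 * pi * norm (freq R l))"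
    have "((\<lambda>\<eta>. LINT x|lebesgue_on U. h x * (a * wave l \<theta> (cut_point R \<eta> x))) \<longlongrightarrow> 0) (at_right 0)"
    proof (rule Lim_null_comparison)
      have "norm (LINT x|lebesgue_on U. h x * (a * wave l \<theta> (cut_point R \<eta> x))) \<le> C * \<eta>" if \<eta>: "\<eta> > 0" for \<eta>
      proof -
        define \<zeta> where "\<zeta> = ((2 * pi) / \<eta>) *\<^sub>R freq R l"
        have \<zeta>0: "\<zeta> \<noteq> 0" using fr \<eta> by (simp add: \<zeta>_def)
        have "(LINT x|lebesgue_on U. h x * (a * wave l \<theta> (cut_point R \<eta> x)))
            = (LINT x|lebesgue_on U. a * (h x * cos (\<zeta> \<bullet> x + \<theta>)))"
          unfolding wave_cut_point \<zeta>_def[symmetric] by (simp add: mult_ac)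
        also have "\<dots> = a * L_two_inner U (\<lambda>x. 1) (\<lambda>x. h x * cos (\<zeta> \<bullet> x + \<theta>))"
          by (simp add: L_two_inner_def)
        also have "norm \<dots> \<le> \<bar>a\<bar> * ((L_two_norm U (grad (\<lambda>x::real^3. 1::real)) * L_two_norm U h
          + L_two_norm U (\<lambda>x::real^3. 1::real) * L_two_norm U (grad h)) / norm \<zeta>)"
          unfolding real_norm_def abs_mult by (intro mult_left_mono oscillation_bound[OF U one h \<zeta>0]) simp
        also have "\<dots> = C * \<eta>" using \<eta> fr unfolding C_def \<zeta>_def norm_scaleR by (simp add: field_simps)
        finally show ?thesis .
      qed
      then show "\<forall>\<^sub>F \<eta> in at_right 0. norm (LINT x|lebesgue_on U. h x * (a * wave l \<theta> (cut_point R \<eta> x))) \<le> C * \<eta>"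
        by (auto simp: eventually_at_right_field intro!: exI[of _ 1])
      have "((\<lambda>\<eta>. C * \<eta>) \<longlongrightarrow> C * 0) (at_right 0)" by (intro tendsto_intros)
      then show "((\<lambda>\<eta>. C * \<eta>) \<longlongrightarrow> 0) (at_right 0)" by simp
    qed
    then show ?thesis unfolding zero mult_zero_right .
  qed
  then show ?case unfolding wave_def .
next
  case (trig_poly_add f g)
  have ii: "integrable (lebesgue_on U) (\<lambda>x. h x * T (cut_point R \<eta> x))" if "trig_poly T" for T \<eta>
    using L_two_integrable_inner[OF L_two_test(1)[OF U h] L_two_continuous[OF U smooth_continuous[OF smooth_cut[OF that]]]] by simp
  have ic: "integrable (lebesgue_on unit_cell) T" if "trig_poly T" for T :: "real^'m \<Rightarrow> real"
    by (rule unit_cell_integrable_continuous[OF smooth_continuous[OF trig_poly_smooth[OF that]]])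
  show ?case
    using tendsto_add[OF trig_poly_add.IH] trig_poly_add.hyps ii ic by (simp add: distrib_left)
qed

text \<open>Weakly null oscillations are invisible to a functional: it is the inner product with a gradient,
  which may be taken smooth, and then one more integration by parts applies.\<close>

lemma W12_dual_oscillation:
  fixes U :: "(real^'n) set"
  assumes U: "open U" "bounded U" and f: "W12_dual U f"
    and \<Psi>: "\<And>\<eta>. 0 < \<eta> \<Longrightarrow> \<eta> < 1 \<Longrightarrow> test_function U (\<Psi> \<eta>)"
    and small: "\<And>\<eta>. 0 < \<eta> \<Longrightarrow> \<eta> < 1 \<Longrightarrow> L_two_norm U (\<Psi> \<eta>) \<le> C * \<eta>"
    and bound: "\<And>\<eta>. 0 < \<eta> \<Longrightarrow> \<eta> < 1 \<Longrightarrow> L_two_norm U (grad (\<Psi> \<eta>)) \<le> C"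
  shows "((\<lambda>\<eta>. f (\<Psi> \<eta>)) \<longlongrightarrow> 0) (at_right 0)"
proof -
  have C: "C \<ge> 0" using bound[of "1/2"] L_two_norm_nonneg[of U "grad (\<Psi> (1/2))"] by simp
  obtain w where w: "dirichlet_solution U (\<lambda>_. mat 1) f w"
    by (rule dirichlet_solution_exists[OF U zero_less_one _ f, of "mat 1"])
      (auto simp: power2_norm_eq_inner)
  have w0: "W12_0 U w" using w by (simp add: dirichlet_solution_def)
  have wL: "L_two U (weak_grad U w)" by (rule W12_0_L_two(2)[OF w0])
  have rep: "f \<psi> = L_two_inner U (weak_grad U w) (grad \<psi>)" if \<psi>: "test_function U \<psi>" for \<psi>
  proof -
    have "f \<psi> = L_two_inner U (weak_grad U w) (weak_grad U \<psi>)"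
      using w W12_0_test[OF U \<psi>] by (simp add: dirichlet_solution_def L_two_inner_def)
    also have "\<dots> = L_two_inner U (weak_grad U w) (grad \<psi>)"
      by (rule weak_grad_inner_eq(1)[OF U test_has_weak_grad[OF U \<psi>] wL])
    finally show ?thesis .
  qed
  show ?thesis
  proof (rule tendstoI)
    fix \<tau> :: real assume \<tau>: "\<tau> > 0"
    define d where "d = \<tau> / (2 * (C + 1))"
    have d: "d > 0" "d * C \<le> \<tau> / 2" using \<tau> C by (auto simp: d_def field_simps)
    obtain z where z: "test_function U z" "L_two_norm U (\<lambda>x. weak_grad U w x - grad z x) < d"
      using W12_0_approx[OF U w0 d(1)] by metis
    note zL = L_two_test[OF U z(1)]
    define K where "K = (\<Sum>i\<in>UNIV. L_two_norm U (grad (\<lambda>x. grad z x $ i)))"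
    have K: "K \<ge> 0" unfolding K_def by (intro sum_nonneg L_two_norm_nonneg)
    have est: "\<bar>f (\<Psi> \<eta>)\<bar> \<le> \<tau> / 2 + K * (C * \<eta>)" if \<eta>: "0 < \<eta>" "\<eta> < 1" for \<eta>
    proof -
      note t = \<Psi>[OF \<eta>]
      note tL = L_two_test[OF U t]
      have "L_two_inner U (grad z) (grad (\<Psi> \<eta>)) = (\<Sum>i\<in>UNIV. L_two_inner U (\<lambda>x. grad z x $ i) (\<lambda>x. grad (\<Psi> \<eta>) x $ i))"
        unfolding L_two_inner_def inner_vec_def
        by (rule Bochner_Integration.integral_sum) (rule L_two_integrable_inner[OF zL(3) tL(3)])
      also have "\<dots> = (\<Sum>i\<in>UNIV. - L_two_inner U (grad (\<lambda>x. grad z x $ i)) (\<lambda>x. \<Psi> \<eta> x *\<^sub>R axis i 1))"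
        using test_has_weak_grad[OF U test_function_grad[OF z(1)]] t by (simp add: has_weak_grad_inner_iff)
      also have "\<bar>\<dots>\<bar> \<le> (\<Sum>i\<in>UNIV. L_two_norm U (grad (\<lambda>x. grad z x $ i)) * L_two_norm U (\<Psi> \<eta>))"
      proof (rule order_trans[OF sum_abs], rule sum_mono)
        fix i
        have "\<bar>L_two_inner U (grad (\<lambda>x. grad z x $ i)) (\<lambda>x. \<Psi> \<eta> x *\<^sub>R axis i 1)\<bar>
            \<le> L_two_norm U (grad (\<lambda>x. grad z x $ i)) * L_two_norm U (\<lambda>x. \<Psi> \<eta> x *\<^sub>R (axis i 1 :: real^'n))"
          by (rule L_two_inner_le[OF L_two_test(2)[OF U test_function_grad[OF z(1)]] tL(4)])
        moreover have "L_two_norm U (\<lambda>x. \<Psi> \<eta> x *\<^sub>R (axis i 1 :: real^'n)) = L_two_norm U (\<Psi> \<eta>)"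
          by (simp add: L_two_norm_def norm_eq_sqrt_inner inner_axis_axis)
        ultimately show "\<bar>- L_two_inner U (grad (\<lambda>x. grad z x $ i)) (\<lambda>x. \<Psi> \<eta> x *\<^sub>R axis i 1)\<bar>
            \<le> L_two_norm U (grad (\<lambda>x. grad z x $ i)) * L_two_norm U (\<Psi> \<eta>)" by simp
      qed
      also have "\<dots> = K * L_two_norm U (\<Psi> \<eta>)" by (simp add: K_def sum_distrib_right)
      also have "\<dots> \<le> K * (C * \<eta>)" by (intro mult_left_mono small[OF \<eta>] K)
      finally have 1: "\<bar>L_two_inner U (grad z) (grad (\<Psi> \<eta>))\<bar> \<le> K * (C * \<eta>)" .
      have "\<bar>L_two_inner U (\<lambda>x. weak_grad U w x - grad z x) (grad (\<Psi> \<eta>))\<bar> \<le> d * C"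
        by (rule order_trans[OF L_two_inner_le[OF L_two_diff[OF wL zL(2)] tL(2)]])
          (use z(2) d bound[OF \<eta>] in \<open>auto intro!: mult_mono simp: L_two_norm_nonneg\<close>)
      moreover have "f (\<Psi> \<eta>) = L_two_inner U (\<lambda>x. weak_grad U w x - grad z x) (grad (\<Psi> \<eta>)) + L_two_inner U (grad z) (grad (\<Psi> \<eta>))"
        unfolding rep[OF t] L_two_inner_diff_left[OF wL zL(2) tL(2)] by simp
      ultimately show ?thesis using 1 d(2) by linarith
    qed
    have "((\<lambda>\<eta>. \<tau> / 2 + K * (C * \<eta>)) \<longlongrightarrow> \<tau> / 2 + K * (C * 0)) (at_right 0)" by (intro tendsto_intros)
    from order_tendstoD(2)[OF this, of \<tau>] have "\<forall>\<^sub>F \<eta> in at_right 0. \<tau> / 2 + K * (C * \<eta>) < \<tau>" using \<tau> by simp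
    moreover have "\<forall>\<^sub>F \<eta> in at_right 0. 0 < \<eta> \<and> \<eta> < (1::real)"
      by (auto simp: eventually_at_right_field intro!: exI[of _ 1])
    ultimately show "\<forall>\<^sub>F \<eta> in at_right 0. dist (f (\<Psi> \<eta>)) 0 < \<tau>"
    proof eventually_elim
      case (elim \<eta>)
      then show ?case using est[of \<eta>] by (simp add: dist_real_def)
    qed
  qed
qed

section \<open>Passing to the limit\<close>

lemma scaled_cut_eq: "scaled_cut R \<eta> f x = f (cut_point R \<eta> x)"
  by (simp add: scaled_cut_def)

lemma L_inf_L_two:
  assumes "open U" "bounded U" "L_inf U f" shows "L_two U f"
  using assms L_two_bounded[OF bounded_open_lmeasurable] unfolding L_inf_def by blast

lemma L_inf_matrix_L_two:
  fixes S :: "real^'n \<Rightarrow> real^'a^'b"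
  assumes S: "L_inf U S" and w: "L_two U w"
  shows "L_two U (\<lambda>x. S x *v w x)"
proof -
  obtain M where M: "AE x in lebesgue_on U. norm (S x) \<le> M" and m: "S \<in> borel_measurable (lebesgue_on U)"
    using S unfolding L_inf_def by blast
  show ?thesis
  proof (rule L_two_bound[OF w])
    show "AE x in lebesgue_on U. norm (S x *v w x) \<le> M * norm (w x)"
      using M by eventually_elim (meson mult_right_mono norm_ge_zero norm_matrix_vector_le order_trans)
  qed (use m L_two_measurable[OF w] in measurable)
qed

text \<open>Here the vector field carries the uniform bound and the coefficient only its mean square.\<close>

lemma L_two_matrix_bounded_vector:
  fixes S :: "real^'n \<Rightarrow> real^'a^'b"
  assumes S: "L_two U S" and w: "w \<in> borel_measurable (lebesgue_on U)" "\<And>x. norm (w x) \<le> C" and C: "C \<ge> 0"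
  shows "L_two U (\<lambda>x. transpose (S x) *v w x)"
    "L_two_norm U (\<lambda>x. transpose (S x) *v w x) \<le> C * L_two_norm U S"
proof -
  have le: "norm (transpose (S x) *v w x) \<le> C * norm (S x)" for x
  proof -
    have "norm (transpose (S x) *v w x) \<le> norm (S x) * norm (w x)" by (rule norm_transpose_vector_le)
    also have "\<dots> \<le> norm (S x) * C" by (intro mult_left_mono w(2)) simp
    finally show ?thesis by (simp add: mult.commute)
  qed
  have m: "(\<lambda>x. transpose (S x) *v w x) \<in> borel_measurable (lebesgue_on U)"
    using L_two_measurable[OF S] w(1) by measurable
  show "L_two U (\<lambda>x. transpose (S x) *v w x)"
    by (rule L_two_bound[OF S m AE_I2[OF le]])
  show "L_two_norm U (\<lambda>x. transpose (S x) *v w x) \<le> C * L_two_norm U S"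
    by (rule L_two_norm_mono[OF S m C AE_I2[OF le]])
qed

lemma admissible_cut_trig_approx:
  fixes \<sigma> :: "real^'m \<Rightarrow> real^'a^'b" and R :: "real^3^'m"
  assumes U: "open U" "bounded U" and adm: "admissible_cut R U \<sigma>"
    and \<sigma>: "L_two unit_cell \<sigma>" and \<sigma>c: "\<And>\<eta>. \<eta> > 0 \<Longrightarrow> L_two U (scaled_cut R \<eta> \<sigma>)" and e: "e > 0"
  obtains P where "trig_matrix P" "L_two_norm unit_cell (\<lambda>y. \<sigma> y - P y) < e"
    "\<forall>\<^sub>F \<eta> in at_right 0. L_two_norm U (\<lambda>x. scaled_cut R \<eta> \<sigma> x - P (cut_point R \<eta> x)) < e"
proof -
  obtain p where p: "periodic p" "continuous_on UNIV p" "L_two_norm unit_cell (\<lambda>y. \<sigma> y - p y) < e / 2"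
    and pc: "\<forall>\<^sub>F \<eta> in at_right 0. L_two_norm U (\<lambda>x. scaled_cut R \<eta> \<sigma> x - scaled_cut R \<eta> p x) < e / 2"
    using adm e unfolding admissible_cut_def by (meson half_gt_zero)
  define m where "m = sqrt (measure lebesgue U) + 1"
  have m: "m \<ge> 1" by (simp add: m_def)
  define d where "d = e / (2 * m)"
  have d: "d > 0" "d * m = e / 2" using e m by (auto simp: d_def)
  obtain P where P: "trig_matrix P" "\<And>y. norm (p y - P y) < d" using trig_matrix_approx[OF p(1,2) d(1)] by blast
  have Pc: "continuous_on UNIV P" by (rule trig_matrix_continuous[OF P(1)])
  have dm: "d * sqrt (measure lebesgue U) \<le> e / 2" "d \<le> e / 2"
  proof -
    have "d * sqrt (measure lebesgue U) \<le> d * m" using d by (intro mult_left_mono) (auto simp: m_def)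
    then show "d * sqrt (measure lebesgue U) \<le> e / 2" using d by simp
    have "d * 1 \<le> d * m" using d m by (intro mult_left_mono) auto
    then show "d \<le> e / 2" using d by simp
  qed
  have "L_two_norm unit_cell (\<lambda>y. \<sigma> y - P y) < e"
  proof -
    have pL: "L_two unit_cell p" "L_two unit_cell P"
      by (intro L_two_continuous unit_cell_open unit_cell_bounded p Pc)+
    have "L_two_norm unit_cell (\<lambda>y. p y - P y) \<le> d * sqrt (measure lebesgue (unit_cell :: (real^'m) set))"
      by (rule L_two_norm_le_bounded[OF bounded_open_lmeasurable[OF unit_cell_open unit_cell_bounded]])
        (use P d L_two_measurable[OF L_two_diff[OF pL]] in \<open>auto intro: less_imp_le\<close>)
    then have "L_two_norm unit_cell (\<lambda>y. p y - P y) \<le> e / 2" using dm by (simp add: measure_unit_cell)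
    then show ?thesis using p(3) L_two_norm_triangle3[OF \<sigma> pL] by linarith
  qed
  moreover have "\<forall>\<^sub>F \<eta> in at_right 0. L_two_norm U (\<lambda>x. scaled_cut R \<eta> \<sigma> x - P (cut_point R \<eta> x)) < e"
  proof -
    have "\<forall>\<^sub>F \<eta> in at_right 0. (\<eta>::real) > 0" by (simp add: eventually_at_right_less)
    with pc show ?thesis
    proof eventually_elim
      case (elim \<eta>)
      have L: "L_two U (scaled_cut R \<eta> p)" "L_two U (\<lambda>x. P (cut_point R \<eta> x))"
        unfolding scaled_cut_eq[abs_def]
        by (intro L_two_continuous[OF U] continuous_on_compose2[OF p(2) continuous_cut_point]
            continuous_on_compose2[OF Pc continuous_cut_point] subset_UNIV)+
      have "L_two_norm U (\<lambda>x. scaled_cut R \<eta> p x - P (cut_point R \<eta> x)) \<le> d * sqrt (measure lebesgue U)"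
        by (rule L_two_norm_le_bounded[OF bounded_open_lmeasurable[OF U]])
          (use P d L_two_measurable[OF L_two_diff[OF L]] in \<open>auto intro: less_imp_le simp: scaled_cut_eq\<close>)
      then show ?case using elim dm L_two_norm_triangle3[OF \<sigma>c[OF elim(2)] L] by linarith
    qed
  qed
  ultimately show ?thesis by (rule that[OF P(1)])
qed

text \<open>The pointwise bound on the coefficient along the cut may degenerate as the scale tends to zero; in the limit only
  \<open>cut_admissible\<close> is available.\<close>

locale homogenization_domain = homogenization_cell R \<sigma> c M g
  for R :: "real^3^'m" and \<sigma> c M g +
  fixes \<Omega> :: "(real^3) set" and f :: "(real^3 \<Rightarrow> real) \<Rightarrow> real" and u :: "real \<Rightarrow> real^3 \<Rightarrow> real"
  assumes \<Omega>: "open \<Omega>" "bounded \<Omega>"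
    and cut_bounded: "\<eta> > 0 \<Longrightarrow> L_inf \<Omega> (scaled_cut R \<eta> \<sigma>)"
    and cut_admissible: "admissible_cut R \<Omega> \<sigma>"
    and cut_coercive: "\<eta> > 0 \<Longrightarrow> coercive_on \<Omega> c (scaled_cut R \<eta> \<sigma>)"
    and f_dual: "W12_dual \<Omega> f"
    and u_solves: "\<eta> > 0 \<Longrightarrow> dirichlet_solution \<Omega> (scaled_cut R \<eta> \<sigma>) f (u \<eta>)"
begin

abbreviation grad_u :: "real \<Rightarrow> real^3 \<Rightarrow> real^3" where
  "grad_u \<eta> \<equiv> weak_grad \<Omega> (u \<eta>)"

lemma u_W12_0: "\<eta> > 0 \<Longrightarrow> W12_0 \<Omega> (u \<eta>)"
  using u_solves by (simp add: dirichlet_solution_def)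

lemma u_weak_grad: "\<eta> > 0 \<Longrightarrow> has_weak_grad \<Omega> (u \<eta>) (grad_u \<eta>)"
  by (intro has_weak_grad_weak_grad W12_0_imp_W12 u_W12_0)

lemma grad_u_L_two: "\<eta> > 0 \<Longrightarrow> L_two \<Omega> (grad_u \<eta>)"
  by (rule W12_0_L_two(2)[OF u_W12_0])

lemma cut_L_two: "\<eta> > 0 \<Longrightarrow> L_two \<Omega> (scaled_cut R \<eta> \<sigma>)"
  by (rule L_inf_L_two[OF \<Omega> cut_bounded])

text \<open>The energy estimate: the equation is tested with its own solution, and Poincare's inequality closes the bound.\<close>

lemma u_bounded:
  obtains K where "K > 0" "\<And>\<eta>. \<eta> > 0 \<Longrightarrow> L_two_norm \<Omega> (u \<eta>) \<le> K" "\<And>\<eta>. \<eta> > 0 \<Longrightarrow> L_two_norm \<Omega> (grad_u \<eta>) \<le> K"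
proof -
  obtain C where C: "C > 0" "\<And>w. W12_0 \<Omega> w \<Longrightarrow> \<bar>f w\<bar> \<le> C * W12_norm \<Omega> w"
    using W12_dual_bound[OF \<Omega> f_dual] by blast
  obtain P where P: "P > 0" "\<And>w. W12_0 \<Omega> w \<Longrightarrow> L_two_norm \<Omega> w \<le> P * L_two_norm \<Omega> (weak_grad \<Omega> w)"
    "\<And>w. W12_0 \<Omega> w \<Longrightarrow> W12_norm \<Omega> w \<le> P * L_two_norm \<Omega> (weak_grad \<Omega> w)"
    using W12_norm_le_grad[OF \<Omega>] by blast
  define K where "K = C * P / c"
  have K: "K > 0" using C P c_pos by (simp add: K_def)
  have gK: "L_two_norm \<Omega> (grad_u \<eta>) \<le> K" if \<eta>: "\<eta> > 0" for \<eta>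
  proof -
    let ?n = "L_two_norm \<Omega> (grad_u \<eta>)"
    note gL = grad_u_L_two[OF \<eta>]
    note sL = L_inf_matrix_L_two[OF cut_bounded[OF \<eta>] gL]
    have "c * ?n\<^sup>2 = (LINT x|lebesgue_on \<Omega>. c * (norm (grad_u \<eta> x))\<^sup>2)"
      by (simp add: L_two_norm_power2 L_two_inner_def power2_norm_eq_inner)
    also have "\<dots> \<le> (LINT x|lebesgue_on \<Omega>. (scaled_cut R \<eta> \<sigma> x *v grad_u \<eta> x) \<bullet> grad_u \<eta> x)"
    proof (rule integral_mono_AE)
      show "AE x in lebesgue_on \<Omega>. c * (norm (grad_u \<eta> x))\<^sup>2 \<le> (scaled_cut R \<eta> \<sigma> x *v grad_u \<eta> x) \<bullet> grad_u \<eta> x"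
        using cut_coercive[OF \<eta>] unfolding coercive_on_def by eventually_elim blast
    qed (use gL L_two_integrable_inner[OF sL gL] in \<open>auto simp: L_two_def\<close>)
    also have "\<dots> = f (u \<eta>)" using u_solves[OF \<eta>] by (simp add: dirichlet_solution_def)
    also have "\<dots> \<le> C * W12_norm \<Omega> (u \<eta>)" by (rule abs_le_D1[OF C(2)[OF u_W12_0[OF \<eta>]]])
    also have "\<dots> \<le> C * (P * ?n)" using C(1) by (intro mult_left_mono P(3)[OF u_W12_0[OF \<eta>]]) simp
    also have "\<dots> = c * (K * ?n)" using c_pos by (simp add: K_def)
    finally have "?n * ?n \<le> K * ?n" using c_pos by (simp add: power2_eq_square)
    then show ?thesis using K mult_right_le_imp_le[of ?n ?n K] L_two_norm_nonneg[of \<Omega> "grad_u \<eta>"]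
      by (cases "?n = 0") auto
  qed
  have "L_two_norm \<Omega> (u \<eta>) \<le> K + P * K" if \<eta>: "\<eta> > 0" for \<eta>
  proof -
    have "L_two_norm \<Omega> (u \<eta>) \<le> P * K"
      by (rule order_trans[OF P(2)[OF u_W12_0[OF \<eta>]]]) (intro mult_left_mono gK[OF \<eta>] less_imp_le[OF P(1)])
    then show ?thesis using K by simp
  qed
  moreover have "L_two_norm \<Omega> (grad_u \<eta>) \<le> K + P * K" if \<eta>: "\<eta> > 0" for \<eta>
    using gK[OF \<eta>] mult_pos_pos[OF P(1) K] by linarith
  ultimately show ?thesis using that[of "K + P * K"] K P by (simp add: add_pos_pos)
qed

lemma weak_equation_test:
  assumes \<eta>: "\<eta> > 0" and \<psi>: "test_function \<Omega> \<psi>"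
  shows "L_two_inner \<Omega> (grad_u \<eta>) (\<lambda>x. transpose (scaled_cut R \<eta> \<sigma> x) *v grad \<psi> x) = f \<psi>"
proof -
  note sL = L_inf_matrix_L_two[OF cut_bounded[OF \<eta>] grad_u_L_two[OF \<eta>]]
  have "f \<psi> = L_two_inner \<Omega> (\<lambda>x. scaled_cut R \<eta> \<sigma> x *v grad_u \<eta> x) (weak_grad \<Omega> \<psi>)"
    using u_solves[OF \<eta>] W12_0_test[OF \<Omega> \<psi>] by (simp add: dirichlet_solution_def L_two_inner_def)
  also have "\<dots> = L_two_inner \<Omega> (\<lambda>x. scaled_cut R \<eta> \<sigma> x *v grad_u \<eta> x) (grad \<psi>)"
    by (rule weak_grad_inner_eq(1)[OF \<Omega> test_has_weak_grad[OF \<Omega> \<psi>] sL])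
  also have "\<dots> = L_two_inner \<Omega> (grad_u \<eta>) (\<lambda>x. transpose (scaled_cut R \<eta> \<sigma> x) *v grad \<psi> x)"
    unfolding L_two_inner_def inner_matrix_transpose ..
  finally show ?thesis by simp
qed

lemma cut_scaleR_L_two:
  assumes "test_function \<Omega> h" "trig_vector T"
  shows "L_two \<Omega> (\<lambda>x. h x *\<^sub>R T (cut_point R \<eta> x))"
  by (intro L_two_continuous[OF \<Omega>] continuous_on_scaleR smooth_continuous[OF test_function_smooth[OF assms(1)]]
      continuous_on_compose2[OF trig_vector_continuous[OF assms(2)] continuous_cut_point subset_UNIV])

text \<open>The square of the gradient is a trigonometric polynomial, so its integral along the cut with the weight \<open>h\<^sup>2\<close> tends to the
  product of the integrals. The summand \<open>1\<close> leaves room for a strict inequality in the limit, also for \<open>h = 0\<close>.\<close>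

lemma small_gradient_along_cut:
  assumes h: "test_function \<Omega> h" and \<psi>: "trig_poly \<psi>" and d: "d > 0"
    and le: "L_two_norm unit_cell (R_grad R \<psi>) \<le> d"
  shows "\<forall>\<^sub>F \<eta> in at_right 0. L_two_norm \<Omega> (\<lambda>x. h x *\<^sub>R R_grad R \<psi> (cut_point R \<eta> x)) \<le> (L_two_norm \<Omega> h + 1) * d"
proof -
  let ?T = "\<lambda>y. R_grad R \<psi> y \<bullet> R_grad R \<psi> y"
  have comp: "trig_poly (\<lambda>y. R_grad R \<psi> y $ i)" for i
    using trig_vector_R_grad[OF \<psi>, of R] by (simp add: trig_vector_def)
  have sq: "trig_poly (\<lambda>y. R_grad R \<psi> y $ i * R_grad R \<psi> y $ i)" for i
    by (rule trig_poly_mult[OF comp[of i] comp[of i]])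
  have T: "trig_poly ?T"
    using trig_poly_sum[where I = UNIV and f = "\<lambda>i y. R_grad R \<psi> y $ i * R_grad R \<psi> y $ i", OF finite sq]
    by (simp add: inner_vec_def)
  have hh: "test_function \<Omega> (\<lambda>x. h x * h x)" by (rule test_function_mult[OF h test_function_smooth[OF h]])
  have lim: "((\<lambda>\<eta>. LINT x|lebesgue_on \<Omega>. h x * h x * ?T (cut_point R \<eta> x)) \<longlongrightarrow>
     (LINT x|lebesgue_on \<Omega>. h x * h x) * (LINT y|lebesgue_on unit_cell. ?T y)) (at_right 0)"
    by (rule trig_poly_mean_value[OF \<Omega> nonresonant hh T])
  have "(LINT x|lebesgue_on \<Omega>. h x * h x) * (LINT y|lebesgue_on unit_cell. ?T y)
      = (L_two_norm \<Omega> h * L_two_norm unit_cell (R_grad R \<psi>))\<^sup>2"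
    by (simp add: power_mult_distrib L_two_norm_power2 L_two_inner_def)
  also have "\<dots> < ((L_two_norm \<Omega> h + 1) * d)\<^sup>2"
  proof (rule power_strict_mono)
    have "L_two_norm \<Omega> h * L_two_norm unit_cell (R_grad R \<psi>) \<le> L_two_norm \<Omega> h * d"
      by (intro mult_left_mono le L_two_norm_nonneg)
    then show "L_two_norm \<Omega> h * L_two_norm unit_cell (R_grad R \<psi>) < (L_two_norm \<Omega> h + 1) * d"
      using d by (simp add: distrib_right)
  qed (auto simp: L_two_norm_nonneg)
  finally have "\<forall>\<^sub>F \<eta> in at_right 0. (LINT x|lebesgue_on \<Omega>. h x * h x * ?T (cut_point R \<eta> x)) < ((L_two_norm \<Omega> h + 1) * d)\<^sup>2"
    by (rule order_tendstoD(2)[OF lim])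
  then show ?thesis
  proof eventually_elim
    case (elim \<eta>)
    have "(L_two_norm \<Omega> (\<lambda>x. h x *\<^sub>R R_grad R \<psi> (cut_point R \<eta> x)))\<^sup>2 = (LINT x|lebesgue_on \<Omega>. h x * h x * ?T (cut_point R \<eta> x))"
      by (simp add: L_two_norm_power2 L_two_inner_def mult.assoc)
    with elim have "(L_two_norm \<Omega> (\<lambda>x. h x *\<^sub>R R_grad R \<psi> (cut_point R \<eta> x)))\<^sup>2 \<le> ((L_two_norm \<Omega> h + 1) * d)\<^sup>2"
      by simp
    then show ?case
      by (rule power2_le_imp_le) (use d in \<open>simp add: L_two_norm_nonneg\<close>)
  qed
qed

end

lemma grad_expansion: "(\<Sum>k\<in>UNIV. grad v x $ k *\<^sub>R axis k 1) = grad v x"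
  using basis_expansion[of "grad v x"] by (simp add: scalar_mult_eq_scaleR)

text \<open>The second term \<open>\<eta> \<Sum>\<^sub>k \<partial>\<^sub>k v \<phi>\<^sub>k (R x / \<eta>)\<close> of the two-scale expansion: it is of order \<open>\<eta>\<close>, but its gradient is
  \<open>\<Sum>\<^sub>k \<partial>\<^sub>k v R_grad R \<phi>\<^sub>k\<close> up to a term of order \<open>\<eta>\<close>. The factor \<open>\<eta>\<close> stands next to \<open>\<phi>\<^sub>k\<close> because it cancels there
  under differentiation.\<close>

definition correction :: "real^3^'m \<Rightarrow> (3 \<Rightarrow> real^'m \<Rightarrow> real) \<Rightarrow> (real^3 \<Rightarrow> real) \<Rightarrow> real \<Rightarrow> real^3 \<Rightarrow> real" where
  "correction R \<phi> v \<eta> x = (\<Sum>k\<in>UNIV. grad v x $ k * (\<eta> * \<phi> k (cut_point R \<eta> x)))"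

lemma test_function_correction:
  assumes "\<And>k. trig_poly (\<phi> k)" "test_function U v"
  shows "test_function U (correction R \<phi> v \<eta>)"
  unfolding correction_def[abs_def]
  by (intro test_function_sum test_function_mult test_function_grad smooth_cmult smooth_cut assms) simp

lemma grad_correction:
  assumes \<phi>: "\<And>k. trig_poly (\<phi> k)" and v: "test_function U v" and \<eta>: "\<eta> \<noteq> 0"
  shows "grad (correction R \<phi> v \<eta>) x = (\<Sum>k\<in>UNIV. grad v x $ k *\<^sub>R R_grad R (\<phi> k) (cut_point R \<eta> x))
    + \<eta> *\<^sub>R (\<Sum>k\<in>UNIV. \<phi> k (cut_point R \<eta> x) *\<^sub>R grad (\<lambda>x. grad v x $ k) x)"
proof -
  have w: "smooth (\<lambda>x. grad v x $ k)" for k by (rule smooth_grad[OF test_function_smooth[OF v]])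
  have c: "smooth (\<lambda>x. \<eta> * \<phi> k (cut_point R \<eta> x))" for k by (rule smooth_cmult[OF smooth_cut[OF \<phi>]])
  have "grad (\<lambda>x. grad v x $ k * (\<eta> * \<phi> k (cut_point R \<eta> x))) x
      = grad v x $ k *\<^sub>R R_grad R (\<phi> k) (cut_point R \<eta> x)
        + \<eta> *\<^sub>R (\<phi> k (cut_point R \<eta> x) *\<^sub>R grad (\<lambda>x. grad v x $ k) x)" for k
    unfolding grad_mult_smooth[OF w c] grad_cmult[OF smooth_cut[OF \<phi>]] grad_cut[OF \<phi>] using \<eta> by simp
  moreover have "grad (correction R \<phi> v \<eta>) x = (\<Sum>k\<in>UNIV. grad (\<lambda>x. grad v x $ k * (\<eta> * \<phi> k (cut_point R \<eta> x))) x)"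
    unfolding correction_def[abs_def] by (rule grad_sum[OF finite smooth_mult[OF w c]])
  ultimately show ?thesis by (simp add: sum.distrib scaleR_sum_right)
qed

context homogenization_domain
begin

text \<open>Inserting \<open>v + correction R \<phi> v \<eta>\<close> into the equation and expanding its adjoint flux. The terms of the bound are the
  correction under \<open>f\<close>; for each direction the distance of the mean flux from the homogenized one, the solenoidal
  part and the gradient part; the replacement of \<open>\<sigma>\<close> by \<open>P\<close>; and the remainder of order \<open>\<eta>\<close> in the gradient.\<close>

lemma flux_error:
  fixes \<phi> \<psi> :: "3 \<Rightarrow> real^'m \<Rightarrow> real" and a :: "3 \<Rightarrow> real^3" and B :: "3 \<Rightarrow> real^'m \<Rightarrow> real^3"
  defines "A \<equiv> homogenized \<sigma> g"
  assumes \<eta>: "\<eta> > 0" and v: "test_function \<Omega> v"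
    and \<phi>: "\<And>k. trig_poly (\<phi> k)" and P: "trig_matrix P"
    and B: "\<And>k. solenoidal R (B k)" and \<psi>: "\<And>k. trig_poly (\<psi> k)"
    and split: "\<And>k y. transpose (P y) *v (axis k 1 + R_grad R (\<phi> k) y) = a k + B k y + R_grad R (\<psi> k) y"
    and near: "\<And>k. norm (a k - transpose A *v axis k 1) \<le> d"
    and K: "L_two_norm \<Omega> (grad_u \<eta>) \<le> K"
    and E: "E \<ge> 0" "\<And>x. norm (\<Sum>k\<in>UNIV. grad v x $ k *\<^sub>R (axis k 1 + R_grad R (\<phi> k) (cut_point R \<eta> x))) \<le> E"
    and r: "r \<ge> 0" "\<And>x. norm (\<Sum>k\<in>UNIV. \<phi> k (cut_point R \<eta> x) *\<^sub>R grad (\<lambda>x. grad v x $ k) x) \<le> r"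
  shows "\<bar>L_two_inner \<Omega> (grad_u \<eta>) (\<lambda>x. transpose A *v grad v x) - f v\<bar>
    \<le> \<bar>f (correction R \<phi> v \<eta>)\<bar>
      + (\<Sum>k\<in>UNIV. K * (d * L_two_norm \<Omega> (\<lambda>x. grad v x $ k))
          + \<bar>L_two_inner \<Omega> (grad_u \<eta>) (\<lambda>x. grad v x $ k *\<^sub>R B k (cut_point R \<eta> x))\<bar>
          + K * L_two_norm \<Omega> (\<lambda>x. grad v x $ k *\<^sub>R R_grad R (\<psi> k) (cut_point R \<eta> x)))
      + K * (E * L_two_norm \<Omega> (\<lambda>x. scaled_cut R \<eta> \<sigma> x - P (cut_point R \<eta> x)))
      + \<eta> * (K * (r * L_two_norm \<Omega> (scaled_cut R \<eta> \<sigma>)))"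
proof -
  let ?X = "\<lambda>x. cut_point R \<eta> x"
  let ?S = "scaled_cut R \<eta> \<sigma>"
  let ?u = "grad_u \<eta>"
  let ?\<Phi> = "correction R \<phi> v \<eta>"
  define w where "w k x = grad v x $ k" for k x
  define Ef where "Ef x = (\<Sum>k\<in>UNIV. w k x *\<^sub>R (axis k 1 + R_grad R (\<phi> k) (?X x)))" for x
  define rf where "rf x = (\<Sum>k\<in>UNIV. \<phi> k (?X x) *\<^sub>R grad (w k) x)" for x
  define Q where "Q k x = w k x *\<^sub>R (a k - transpose A *v axis k 1)" for k x
  define Bt where "Bt k x = w k x *\<^sub>R B k (?X x)" for k x
  define Gt where "Gt k x = w k x *\<^sub>R R_grad R (\<psi> k) (?X x)" for k x
  define Z where "Z x = transpose (?S x - P (?X x)) *v Ef x" for x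
  define Y where "Y x = transpose (?S x) *v rf x" for x
  have K0: "K \<ge> 0" using K L_two_norm_nonneg[of \<Omega> ?u] by linarith
  have wt: "test_function \<Omega> (w k)" for k unfolding w_def[abs_def] by (rule test_function_grad[OF v])
  note ws = test_function_smooth[OF wt]
  have \<Phi>t: "test_function \<Omega> ?\<Phi>" by (rule test_function_correction[OF \<phi> v])
  have v\<Phi>: "test_function \<Omega> (\<lambda>x. v x + ?\<Phi> x)" by (rule test_function_add[OF v \<Phi>t])
  have Xc: "continuous_on UNIV (\<lambda>x. T (?X x))" if "continuous_on UNIV T" for T :: "real^'m \<Rightarrow> 'z::topological_space"
    by (rule continuous_on_compose2[OF that continuous_cut_point subset_UNIV])
  have Efc: "continuous_on UNIV Ef" unfolding Ef_def
    by (intro continuous_on_sum continuous_on_scaleR smooth_continuous[OF ws] continuous_on_add continuous_on_const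
        Xc trig_vector_continuous trig_vector_R_grad \<phi>)
  have rfc: "continuous_on UNIV rf" unfolding rf_def
    by (intro continuous_on_sum continuous_on_scaleR smooth_continuous_grad[OF ws] Xc smooth_continuous trig_poly_smooth \<phi>)
  note uL = grad_u_L_two[OF \<eta>]
  note SL = cut_L_two[OF \<eta>]
  have QL: "L_two \<Omega> (Q k)" for k unfolding Q_def
    by (intro L_two_continuous[OF \<Omega>] continuous_on_scaleR smooth_continuous[OF ws] continuous_on_const)
  have BL: "L_two \<Omega> (Bt k)" for k unfolding Bt_def
    by (intro L_two_continuous[OF \<Omega>] continuous_on_scaleR smooth_continuous[OF ws] Xc solenoidal_continuous[OF B])
  have GL: "L_two \<Omega> (Gt k)" for k unfolding Gt_def
    by (rule cut_scaleR_L_two[OF wt trig_vector_R_grad[OF \<psi>]])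
  have SPL: "L_two \<Omega> (\<lambda>x. ?S x - P (?X x))"
    by (intro L_two_diff SL L_two_continuous[OF \<Omega>] Xc trig_matrix_continuous P)
  have Ef_le: "norm (Ef x) \<le> E" for x unfolding Ef_def w_def by (rule E(2))
  have rf_le: "norm (rf x) \<le> r" for x unfolding rf_def w_def by (rule r(2))
  have ZL: "L_two \<Omega> Z" and Zn: "L_two_norm \<Omega> Z \<le> E * L_two_norm \<Omega> (\<lambda>x. ?S x - P (?X x))"
    unfolding Z_def
    by (rule L_two_matrix_bounded_vector[OF SPL continuous_borel_measurable_on[OF Efc] Ef_le E(1)])+
  have YL: "L_two \<Omega> Y" and Yn: "L_two_norm \<Omega> Y \<le> r * L_two_norm \<Omega> ?S"
    unfolding Y_def
    by (rule L_two_matrix_bounded_vector[OF SL continuous_borel_measurable_on[OF rfc] rf_le r(1)])+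
  have grad_v\<Phi>: "grad (\<lambda>x. v x + ?\<Phi> x) x = Ef x + \<eta> *\<^sub>R rf x" for x
  proof -
    have "grad (\<lambda>x. v x + ?\<Phi> x) x = grad v x + grad ?\<Phi> x"
      by (rule grad_add_smooth[OF test_function_smooth[OF v] test_function_smooth[OF \<Phi>t]])
    also have "grad ?\<Phi> x = (\<Sum>k\<in>UNIV. w k x *\<^sub>R R_grad R (\<phi> k) (?X x)) + \<eta> *\<^sub>R rf x"
      using grad_correction[where R = R and \<phi> = \<phi> and v = v and \<eta> = \<eta> and x = x, OF \<phi> v] \<eta> by (simp add: w_def[abs_def] rf_def)
    also have "grad v x = (\<Sum>k\<in>UNIV. w k x *\<^sub>R axis k 1)" unfolding w_def by (rule grad_expansion[symmetric])
    finally show ?thesis by (simp add: Ef_def scaleR_add_right sum.distrib)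
  qed
  have L1: "L_two \<Omega> (\<lambda>x. transpose (?S x) *v grad (\<lambda>x. v x + ?\<Phi> x) x)"
  proof -
    have c: "continuous_on UNIV (grad (\<lambda>x. v x + ?\<Phi> x))"
      by (rule smooth_continuous_grad[OF test_function_smooth[OF v\<Phi>]])
    have le: "norm (grad (\<lambda>x. v x + ?\<Phi> x) x) \<le> E + \<eta> * r" for x
      unfolding grad_v\<Phi> using Ef_le[of x] rf_le[of x] \<eta>
      by (intro order_trans[OF norm_triangle_ineq] add_mono) (auto intro!: mult_left_mono)
    have "0 \<le> E + \<eta> * r" using E(1) r(1) \<eta> by simp
    then show ?thesis
      by (rule L_two_matrix_bounded_vector(1)[OF SL continuous_borel_measurable_on[OF c] le])
  qed
  have ident: "transpose A *v grad v x = transpose (?S x) *v grad (\<lambda>x. v x + ?\<Phi> x) x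
      - ((\<Sum>k\<in>UNIV. (Q k x + Bt k x) + Gt k x) + (Z x + \<eta> *\<^sub>R Y x))" for x
  proof -
    have t: "transpose (M - N) *v z = transpose M *v z - transpose N *v z" for M N :: "real^3^3" and z
      by (simp add: transpose_def matrix_vector_mult_def vec_eq_iff sum_subtractf left_diff_distrib)
    have "transpose (P (?X x)) *v Ef x = (\<Sum>k\<in>UNIV. w k x *\<^sub>R (transpose (P (?X x)) *v (axis k 1 + R_grad R (\<phi> k) (?X x))))"
      unfolding Ef_def by (simp only: linear_sum[OF matrix_vector_mul_linear] matrix_vector_mult_scaleR)
    also have "\<dots> = (\<Sum>k\<in>UNIV. w k x *\<^sub>R (transpose A *v axis k 1) + ((Q k x + Bt k x) + Gt k x))"
      unfolding split Q_def Bt_def Gt_def by (intro sum.cong refl) (simp only: algebra_simps)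
    also have "\<dots> = transpose A *v grad v x + (\<Sum>k\<in>UNIV. (Q k x + Bt k x) + Gt k x)"
    proof -
      have "(\<Sum>k\<in>UNIV. w k x *\<^sub>R (transpose A *v axis k 1)) = transpose A *v (\<Sum>k\<in>UNIV. w k x *\<^sub>R axis k 1)"
        by (simp only: linear_sum[OF matrix_vector_mul_linear] matrix_vector_mult_scaleR)
      also have "(\<Sum>k\<in>UNIV. w k x *\<^sub>R axis k 1) = grad v x" unfolding w_def by (rule grad_expansion)
      finally have eq: "(\<Sum>k\<in>UNIV. w k x *\<^sub>R (transpose A *v axis k 1)) = transpose A *v grad v x" .
      show ?thesis by (subst sum.distrib) (simp only: eq)
    qed
    finally have PE: "transpose (P (?X x)) *v Ef x = transpose A *v grad v x + (\<Sum>k\<in>UNIV. (Q k x + Bt k x) + Gt k x)" .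
    have "transpose (?S x) *v grad (\<lambda>x. v x + ?\<Phi> x) x = transpose (?S x) *v Ef x + \<eta> *\<^sub>R Y x"
      unfolding grad_v\<Phi> Y_def by (simp only: matrix_vector_right_distrib matrix_vector_mult_scaleR)
    also have "transpose (?S x) *v Ef x = transpose (P (?X x)) *v Ef x + Z x"
      unfolding Z_def t by (simp only: algebra_simps)
    finally show ?thesis unfolding PE by (simp only: algebra_simps)
  qed
  have SumL: "L_two \<Omega> (\<lambda>x. \<Sum>k\<in>UNIV. (Q k x + Bt k x) + Gt k x)"
    by (intro L_two_sum L_two_add QL BL GL) simp
  have ZYL: "L_two \<Omega> (\<lambda>x. Z x + \<eta> *\<^sub>R Y x)" by (intro L_two_add L_two_scaleR ZL YL)
  have fv: "f (\<lambda>x. v x + ?\<Phi> x) = f v + f ?\<Phi>"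
  proof -
    have "f (\<lambda>x. 1 * v x + 1 * ?\<Phi> x) = 1 * f v + 1 * f ?\<Phi>"
      using f_dual W12_0_test[OF \<Omega> v] W12_0_test[OF \<Omega> \<Phi>t] unfolding W12_dual_def by blast
    then show ?thesis by simp
  qed
  have "L_two_inner \<Omega> ?u (\<lambda>x. transpose A *v grad v x)
      = L_two_inner \<Omega> ?u (\<lambda>x. transpose (?S x) *v grad (\<lambda>x. v x + ?\<Phi> x) x)
        - (L_two_inner \<Omega> ?u (\<lambda>x. \<Sum>k\<in>UNIV. (Q k x + Bt k x) + Gt k x)
          + (L_two_inner \<Omega> ?u Z + \<eta> * L_two_inner \<Omega> ?u Y))"
    unfolding ident L_two_inner_diff_right[OF L1 L_two_add[OF SumL ZYL] uL] L_two_inner_add_right[OF SumL ZYL uL]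
      L_two_inner_add_right[OF ZL L_two_scaleR[OF YL] uL] L_two_inner_scaleR_right ..
  also have "L_two_inner \<Omega> ?u (\<lambda>x. transpose (?S x) *v grad (\<lambda>x. v x + ?\<Phi> x) x) = f v + f ?\<Phi>"
    using weak_equation_test[OF \<eta> v\<Phi>] fv by simp
  also have "L_two_inner \<Omega> ?u (\<lambda>x. \<Sum>k\<in>UNIV. (Q k x + Bt k x) + Gt k x)
      = (\<Sum>k\<in>UNIV. (L_two_inner \<Omega> ?u (Q k) + L_two_inner \<Omega> ?u (Bt k)) + L_two_inner \<Omega> ?u (Gt k))"
    by (subst L_two_inner_sum_right[OF finite L_two_add[OF L_two_add[OF QL BL] GL] uL])
      (simp only: L_two_inner_add_right[OF L_two_add[OF QL BL] GL uL] L_two_inner_add_right[OF QL BL uL])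
  finally have main: "L_two_inner \<Omega> ?u (\<lambda>x. transpose A *v grad v x) - f v = f ?\<Phi>
      - (\<Sum>k\<in>UNIV. (L_two_inner \<Omega> ?u (Q k) + L_two_inner \<Omega> ?u (Bt k)) + L_two_inner \<Omega> ?u (Gt k))
      - L_two_inner \<Omega> ?u Z - \<eta> * L_two_inner \<Omega> ?u Y" by simp
  have bound: "\<bar>L_two_inner \<Omega> ?u T\<bar> \<le> K * t" if "L_two \<Omega> T" "L_two_norm \<Omega> T \<le> t" for T t
    by (rule order_trans[OF L_two_inner_le[OF uL that(1)]])
      (intro mult_mono K that(2) K0 L_two_norm_nonneg)
  have Qn: "L_two_norm \<Omega> (Q k) \<le> d * L_two_norm \<Omega> (w k)" for k
  proof (rule L_two_norm_mono[OF L_two_test(1)[OF \<Omega> wt] L_two_measurable[OF QL]])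
    show "0 \<le> d" using near[of k] norm_ge_zero[of "a k - transpose A *v axis k 1"] by linarith
    show "AE x in lebesgue_on \<Omega>. norm (Q k x) \<le> d * norm (w k x)"
    proof (rule AE_I2)
      fix x
      have "norm (Q k x) \<le> norm (w k x) * d"
        unfolding Q_def norm_scaleR real_norm_def by (intro mult_left_mono near) simp
      then show "norm (Q k x) \<le> d * norm (w k x)" by (simp add: mult.commute)
    qed
  qed
  have "\<bar>\<Sum>k\<in>UNIV. (L_two_inner \<Omega> ?u (Q k) + L_two_inner \<Omega> ?u (Bt k)) + L_two_inner \<Omega> ?u (Gt k)\<bar>
      \<le> (\<Sum>k\<in>UNIV. K * (d * L_two_norm \<Omega> (w k)) + \<bar>L_two_inner \<Omega> ?u (Bt k)\<bar> + K * L_two_norm \<Omega> (Gt k))"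
  proof (rule order_trans[OF sum_abs], rule sum_mono)
    fix k :: 3
    show "\<bar>L_two_inner \<Omega> ?u (Q k) + L_two_inner \<Omega> ?u (Bt k) + L_two_inner \<Omega> ?u (Gt k)\<bar>
        \<le> K * (d * L_two_norm \<Omega> (w k)) + \<bar>L_two_inner \<Omega> ?u (Bt k)\<bar> + K * L_two_norm \<Omega> (Gt k)"
      using bound[OF QL Qn, of k] bound[OF GL order_refl, of k] by linarith
  qed
  moreover have "\<bar>L_two_inner \<Omega> ?u Z\<bar> \<le> K * (E * L_two_norm \<Omega> (\<lambda>x. ?S x - P (?X x)))"
    by (rule bound[OF ZL Zn])
  moreover have "\<bar>\<eta> * L_two_inner \<Omega> ?u Y\<bar> \<le> \<eta> * (K * (r * L_two_norm \<Omega> ?S))"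
    using \<eta> mult_left_mono[OF bound[OF YL Yn], of \<eta>] by (simp add: abs_mult)
  ultimately show ?thesis unfolding main[unfolded w_def] Bt_def Gt_def w_def by linarith
qed

end

context homogenization_domain
begin

text \<open>Trigonometric polynomials and test functions are bounded on the whole space, so these bounds are uniform in the
  scale.\<close>

lemma correction_bounds:
  assumes \<phi>: "\<And>k. trig_poly (\<phi> k)" and v: "test_function \<Omega> v"
  obtains C E r where "E \<ge> 0" "r \<ge> 0"
    "\<And>\<eta> x. norm (\<Sum>k\<in>UNIV. grad v x $ k *\<^sub>R (axis k 1 + R_grad R (\<phi> k) (cut_point R \<eta> x))) \<le> E"
    "\<And>\<eta> x. norm (\<Sum>k\<in>UNIV. \<phi> k (cut_point R \<eta> x) *\<^sub>R grad (\<lambda>x. grad v x $ k) x) \<le> r"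
    "\<And>\<eta>. 0 < \<eta> \<Longrightarrow> \<eta> < 1 \<Longrightarrow> L_two_norm \<Omega> (correction R \<phi> v \<eta>) \<le> C * \<eta>"
    "\<And>\<eta>. 0 < \<eta> \<Longrightarrow> \<eta> < 1 \<Longrightarrow> L_two_norm \<Omega> (grad (correction R \<phi> v \<eta>)) \<le> C"
proof -
  have wt: "test_function \<Omega> (\<lambda>x. grad v x $ k)" for k by (rule test_function_grad[OF v])
  have "\<forall>k. \<exists>C. C \<ge> 0 \<and> (\<forall>y. \<bar>\<phi> k y\<bar> \<le> C)" using trig_poly_bounded[OF \<phi>] by metis
  then obtain p where p: "\<And>k. p k \<ge> 0" "\<And>k y. \<bar>\<phi> k y\<bar> \<le> p k" by metis
  have "\<forall>k. \<exists>C. C \<ge> 0 \<and> (\<forall>y. norm (R_grad R (\<phi> k) y) \<le> C)"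
    using trig_vector_bounded[OF trig_vector_R_grad[OF \<phi>]] by metis
  then obtain q where q: "\<And>k. q k \<ge> 0" "\<And>k y. norm (R_grad R (\<phi> k) y) \<le> q k" by metis
  have "\<forall>k. \<exists>C. C \<ge> 0 \<and> (\<forall>x. \<bar>grad v x $ k\<bar> \<le> C)" using test_function_bounded[OF wt] by metis
  then obtain b where b: "\<And>k. b k \<ge> 0" "\<And>k x. \<bar>grad v x $ k\<bar> \<le> b k" by metis
  have "\<forall>k. \<exists>C. C \<ge> 0 \<and> (\<forall>x. norm (grad (\<lambda>x. grad v x $ k) x) \<le> C)"
  proof
    fix k
    have "\<forall>j. \<exists>C. C \<ge> 0 \<and> (\<forall>x. \<bar>grad (\<lambda>x. grad v x $ k) x $ j\<bar> \<le> C)"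
      using test_function_bounded[OF test_function_grad[OF wt]] by metis
    then obtain C where C: "\<And>j. C j \<ge> 0" "\<And>j x. \<bar>grad (\<lambda>x. grad v x $ k) x $ j\<bar> \<le> C j" by metis
    have "norm (grad (\<lambda>x. grad v x $ k) x) \<le> (\<Sum>j\<in>UNIV. C j)" for x
      by (rule order_trans[OF norm_le_l1_cart]) (intro sum_mono C)
    moreover have "0 \<le> (\<Sum>j\<in>UNIV. C j)" by (intro sum_nonneg C)
    ultimately show "\<exists>C. C \<ge> 0 \<and> (\<forall>x. norm (grad (\<lambda>x. grad v x $ k) x) \<le> C)" by blast
  qed
  then obtain h where h: "\<And>k. h k \<ge> 0" "\<And>k x. norm (grad (\<lambda>x. grad v x $ k) x) \<le> h k" by metis
  define E where "E = (\<Sum>k\<in>UNIV. b k * (1 + q k))"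
  define r where "r = (\<Sum>k\<in>UNIV. p k * h k)"
  define G where "G = (\<Sum>k\<in>UNIV. b k * q k)"
  define F where "F = (\<Sum>k\<in>UNIV. b k * p k)"
  have nn: "E \<ge> 0" "r \<ge> 0" "G \<ge> 0" "F \<ge> 0"
    unfolding E_def r_def G_def F_def using b(1) q(1) p(1) h(1) by (auto intro!: sum_nonneg mult_nonneg_nonneg add_nonneg_nonneg)
  have E: "norm (\<Sum>k\<in>UNIV. grad v x $ k *\<^sub>R (axis k 1 + R_grad R (\<phi> k) (cut_point R \<eta> x))) \<le> E" for \<eta> x
    unfolding E_def
  proof (rule sum_norm_le)
    fix k :: 3
    have "norm (axis k 1 + R_grad R (\<phi> k) (cut_point R \<eta> x)) \<le> 1 + q k"
      using norm_triangle_ineq[of "axis k 1" "R_grad R (\<phi> k) (cut_point R \<eta> x)"] q(2)[of k "cut_point R \<eta> x"]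
      by (simp add: norm_eq_sqrt_inner[of "axis k 1"] inner_axis_axis)
    then show "norm (grad v x $ k *\<^sub>R (axis k 1 + R_grad R (\<phi> k) (cut_point R \<eta> x))) \<le> b k * (1 + q k)"
      unfolding norm_scaleR real_norm_def by (intro mult_mono b) auto
  qed
  have r: "norm (\<Sum>k\<in>UNIV. \<phi> k (cut_point R \<eta> x) *\<^sub>R grad (\<lambda>x. grad v x $ k) x) \<le> r" for \<eta> x
    unfolding r_def
  proof (rule sum_norm_le)
    fix k :: 3
    show "norm (\<phi> k (cut_point R \<eta> x) *\<^sub>R grad (\<lambda>x. grad v x $ k) x) \<le> p k * h k"
      unfolding norm_scaleR real_norm_def by (intro mult_mono p h) auto
  qed
  have G: "norm (\<Sum>k\<in>UNIV. grad v x $ k *\<^sub>R R_grad R (\<phi> k) (cut_point R \<eta> x)) \<le> G" for \<eta> x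
    unfolding G_def
  proof (rule sum_norm_le)
    fix k :: 3
    show "norm (grad v x $ k *\<^sub>R R_grad R (\<phi> k) (cut_point R \<eta> x)) \<le> b k * q k"
      unfolding norm_scaleR real_norm_def by (intro mult_mono b q) auto
  qed
  define m where "m = sqrt (measure lebesgue \<Omega>)"
  have m: "m \<ge> 0" by (simp add: m_def)
  note \<Omega>m = bounded_open_lmeasurable[OF \<Omega>]
  define C where "C = F * m + (G + r) * m"
  have "L_two_norm \<Omega> (correction R \<phi> v \<eta>) \<le> C * \<eta>" if \<eta>: "0 < \<eta>" "\<eta> < 1" for \<eta>
  proof -
    have t: "test_function \<Omega> (correction R \<phi> v \<eta>)" by (rule test_function_correction[OF \<phi> v])
    have "norm (correction R \<phi> v \<eta> x) \<le> F * \<eta>" for x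
      unfolding correction_def F_def sum_distrib_right
    proof (rule sum_norm_le)
      fix k :: 3
      have "\<bar>grad v x $ k\<bar> * (\<eta> * \<bar>\<phi> k (cut_point R \<eta> x)\<bar>) \<le> b k * (\<eta> * p k)"
        using \<eta> by (intro mult_mono b p mult_nonneg_nonneg) auto
      then show "norm (grad v x $ k * (\<eta> * \<phi> k (cut_point R \<eta> x))) \<le> b k * p k * \<eta>"
        using \<eta> by (simp add: abs_mult mult_ac)
    qed
    then have "L_two_norm \<Omega> (correction R \<phi> v \<eta>) \<le> (F * \<eta>) * m"
      unfolding m_def using nn \<eta>
      by (intro L_two_norm_le_bounded[OF \<Omega>m L_two_measurable[OF L_two_test(1)[OF \<Omega> t]]]) auto
    also have "\<dots> \<le> C * \<eta>"
    proof -
      have "0 \<le> (G + r) * m * \<eta>" using nn m \<eta> by simp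
      then show ?thesis by (simp add: C_def algebra_simps)
    qed
    finally show ?thesis .
  qed
  moreover have "L_two_norm \<Omega> (grad (correction R \<phi> v \<eta>)) \<le> C" if \<eta>: "0 < \<eta>" "\<eta> < 1" for \<eta>
  proof -
    have t: "test_function \<Omega> (correction R \<phi> v \<eta>)" by (rule test_function_correction[OF \<phi> v])
    have "norm (grad (correction R \<phi> v \<eta>) x) \<le> G + r" for x
    proof -
      have "norm (\<eta> *\<^sub>R (\<Sum>k\<in>UNIV. \<phi> k (cut_point R \<eta> x) *\<^sub>R grad (\<lambda>x. grad v x $ k) x)) \<le> 1 * r"
        unfolding norm_scaleR using \<eta> by (intro mult_mono r) auto
      then have "norm ((\<Sum>k\<in>UNIV. grad v x $ k *\<^sub>R R_grad R (\<phi> k) (cut_point R \<eta> x))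
          + \<eta> *\<^sub>R (\<Sum>k\<in>UNIV. \<phi> k (cut_point R \<eta> x) *\<^sub>R grad (\<lambda>x. grad v x $ k) x)) \<le> G + r"
        using G[of x \<eta>] by (intro order_trans[OF norm_triangle_ineq] add_mono) auto
      then show ?thesis
        using grad_correction[where R = R and \<phi> = \<phi> and v = v and \<eta> = \<eta> and x = x, OF \<phi> v] \<eta> by simp
    qed
    then have "L_two_norm \<Omega> (grad (correction R \<phi> v \<eta>)) \<le> (G + r) * m"
      unfolding m_def using nn
      by (intro L_two_norm_le_bounded[OF \<Omega>m L_two_measurable[OF L_two_test(2)[OF \<Omega> t]]]) auto
    also have "\<dots> \<le> C" using nn m by (simp add: C_def)
    finally show ?thesis .
  qed
  ultimately show ?thesis by (rule that[OF nn(1,2) E r])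
qed

text \<open>The correctors and the test function are smooth, so every term of the error bound is either proportional to the
  chosen accuracies or tends to zero with the scale.\<close>

lemma flux_converges_test:
  assumes v: "test_function \<Omega> v"
  shows "((\<lambda>\<eta>. L_two_inner \<Omega> (grad_u \<eta>) (\<lambda>x. transpose (homogenized \<sigma> g) *v grad v x)) \<longlongrightarrow> f v) (at_right 0)"
proof (rule tendstoI)
  fix \<tau> :: real assume \<tau>: "\<tau> > 0"
  let ?A = "homogenized \<sigma> g"
  obtain K where K: "K > 0" "\<And>\<eta>. \<eta> > 0 \<Longrightarrow> L_two_norm \<Omega> (u \<eta>) \<le> K" "\<And>\<eta>. \<eta> > 0 \<Longrightarrow> L_two_norm \<Omega> (grad_u \<eta>) \<le> K"
    using u_bounded by blast
  define n where "n k = L_two_norm \<Omega> (\<lambda>x. grad v x $ k)" for k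
  have n: "n k \<ge> 0" for k by (simp add: n_def L_two_norm_nonneg)
  have wt: "test_function \<Omega> (\<lambda>x. grad v x $ k)" for k by (rule test_function_grad[OF v])
  define W where "W = (\<Sum>k\<in>UNIV. 2 * n k + 1)"
  have W: "W \<ge> 0" unfolding W_def using n by (intro sum_nonneg) (simp add: add_nonneg_nonneg)
  \<comment> \<open>the accuracy of the correctors is fixed first; the accuracy of the trigonometric
    coefficient may then depend on the correctors\<close>
  define X where "X = K * (W + 1)"
  have X: "X > 0" unfolding X_def using K(1) W by simp
  define d where "d = \<tau> / (8 * X)"
  have d: "d > 0" using \<tau> X by (simp add: d_def)
  have dW: "K * W * d \<le> \<tau> / 8"
  proof -
    have "K * W * d \<le> K * (W + 1) * d" using K(1) d by (intro mult_right_mono mult_left_mono) auto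
    also have "\<dots> = \<tau> / 8" using X by (simp add: d_def flip: X_def)
    finally show ?thesis .
  qed
  have "\<forall>k::3. \<exists>\<phi> e. trig_poly \<phi> \<and> e > 0 \<and> (\<forall>P. trig_matrix P \<longrightarrow>
      L_two_norm unit_cell (\<lambda>y. \<sigma> y - P y) \<le> e \<longrightarrow> splits_near_homogenized d (axis k 1) \<phi> P)"
    by (rule allI, rule trigonometric_flux_homogenized[OF d], blast)
  then obtain \<phi> :: "3 \<Rightarrow> real^'m \<Rightarrow> real" and e :: "3 \<Rightarrow> real" where
    \<phi>e: "\<forall>k. trig_poly (\<phi> k) \<and> e k > 0 \<and> (\<forall>P. trig_matrix P \<longrightarrow>
      L_two_norm unit_cell (\<lambda>y. \<sigma> y - P y) \<le> e k \<longrightarrow> splits_near_homogenized d (axis k 1) (\<phi> k) P)"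
    unfolding choice_iff by blast
  then have \<phi>: "\<And>k. trig_poly (\<phi> k)" and e: "\<And>k. e k > 0" by auto
  obtain C E r where E: "E \<ge> 0" "\<And>\<eta> x. norm (\<Sum>k\<in>UNIV. grad v x $ k *\<^sub>R (axis k 1 + R_grad R (\<phi> k) (cut_point R \<eta> x))) \<le> E"
    and r: "r \<ge> 0" "\<And>\<eta> x. norm (\<Sum>k\<in>UNIV. \<phi> k (cut_point R \<eta> x) *\<^sub>R grad (\<lambda>x. grad v x $ k) x) \<le> r"
    and C: "\<And>\<eta>. 0 < \<eta> \<Longrightarrow> \<eta> < 1 \<Longrightarrow> L_two_norm \<Omega> (correction R \<phi> v \<eta>) \<le> C * \<eta>"
      "\<And>\<eta>. 0 < \<eta> \<Longrightarrow> \<eta> < 1 \<Longrightarrow> L_two_norm \<Omega> (grad (correction R \<phi> v \<eta>)) \<le> C"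
    by (rule correction_bounds[where \<phi> = \<phi>, OF \<phi> v]) blast
  define \<epsilon> where "\<epsilon> = min (Min (range e)) (\<tau> / (8 * K * (E + 1)))"
  have \<epsilon>: "\<epsilon> > 0" unfolding \<epsilon>_def using e \<tau> K(1) E(1) by (simp add: Min_gr_iff)
  have \<epsilon>e: "\<epsilon> \<le> e k" for k unfolding \<epsilon>_def by (simp add: min.coboundedI1)
  have \<epsilon>E: "K * (E * \<epsilon>) \<le> \<tau> / 8"
  proof -
    have "K * (E * \<epsilon>) \<le> K * ((E + 1) * (\<tau> / (8 * K * (E + 1))))"
    proof (intro mult_left_mono mult_mono)
      show "\<epsilon> \<le> \<tau> / (8 * K * (E + 1))" by (simp add: \<epsilon>_def)
    qed (use K(1) E(1) \<epsilon> in auto)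
    also have "\<dots> = \<tau> / 8"
    proof -
      have "K * (E + 1) \<noteq> 0" using K(1) E(1) by simp
      then show ?thesis by (simp add: mult.assoc)
    qed
    finally show ?thesis .
  qed
  have \<sigma>L: "L_two unit_cell \<sigma>"
    by (rule L_two_bounded[OF bounded_open_lmeasurable[OF unit_cell_open unit_cell_bounded] \<sigma>_measurable \<sigma>_bounded])
  obtain P where P: "trig_matrix P" "L_two_norm unit_cell (\<lambda>y. \<sigma> y - P y) < \<epsilon>"
    and Pc: "\<forall>\<^sub>F \<eta> in at_right 0. L_two_norm \<Omega> (\<lambda>x. scaled_cut R \<eta> \<sigma> x - P (cut_point R \<eta> x)) < \<epsilon>"
    by (rule admissible_cut_trig_approx[OF \<Omega> cut_admissible \<sigma>L cut_L_two \<epsilon>]) blast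
  have "\<forall>k. splits_near_homogenized d (axis k 1) (\<phi> k) P"
    using \<phi>e P(1) less_imp_le[OF less_le_trans[OF P(2) \<epsilon>e]] by blast
  then obtain a B \<psi> where split: "\<forall>k. solenoidal R (B k) \<and> trig_poly (\<psi> k) \<and>
     (\<forall>y. transpose (P y) *v (axis k 1 + R_grad R (\<phi> k) y) = a k + B k y + R_grad R (\<psi> k) y) \<and>
     L_two_norm unit_cell (R_grad R (\<psi> k)) \<le> d \<and> norm (a k - transpose ?A *v axis k 1) \<le> d"
    unfolding splits_near_homogenized_def choice_iff by blast
  then have s: "\<And>k. solenoidal R (B k)" "\<And>k. trig_poly (\<psi> k)"
    "\<And>k y. transpose (P y) *v (axis k 1 + R_grad R (\<phi> k) y) = a k + B k y + R_grad R (\<psi> k) y"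
    "\<And>k. L_two_norm unit_cell (R_grad R (\<psi> k)) \<le> d" "\<And>k. norm (a k - transpose ?A *v axis k 1) \<le> d"
    by blast+
  obtain p where p: "p \<ge> 0" "\<And>y. norm (P y) \<le> p" using trig_matrix_bounded[OF P(1)] by blast
  define m where "m = \<epsilon> + p * sqrt (measure lebesgue \<Omega>)"
  have "\<forall>k. \<exists>C. \<forall>\<eta>>0. \<forall>u g. has_weak_grad \<Omega> u g \<longrightarrow>
     \<bar>L_two_inner \<Omega> g (\<lambda>x. grad v x $ k *\<^sub>R B k (cut_point R \<eta> x))\<bar> \<le> C * \<eta> * (L_two_norm \<Omega> u + L_two_norm \<Omega> g)"
    by (rule allI) (rule solenoidal_oscillation[OF \<Omega> nonresonant wt s(1)])
  then obtain D where D0: "\<forall>k. \<forall>\<eta>>0. \<forall>u g. has_weak_grad \<Omega> u g \<longrightarrow>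
     \<bar>L_two_inner \<Omega> g (\<lambda>x. grad v x $ k *\<^sub>R B k (cut_point R \<eta> x))\<bar> \<le> D k * \<eta> * (L_two_norm \<Omega> u + L_two_norm \<Omega> g)"
    unfolding choice_iff ..
  then have D: "\<And>k \<eta> u g. \<eta> > 0 \<Longrightarrow> has_weak_grad \<Omega> u g \<Longrightarrow>
     \<bar>L_two_inner \<Omega> g (\<lambda>x. grad v x $ k *\<^sub>R B k (cut_point R \<eta> x))\<bar> \<le> D k * \<eta> * (L_two_norm \<Omega> u + L_two_norm \<Omega> g)"
    by simp
  define H where "H = (\<Sum>k\<in>UNIV. \<bar>D k\<bar> * (2 * K)) + K * (r * m)"
  have E1: "\<forall>\<^sub>F \<eta> in at_right 0. (\<eta>::real) > 0" by (simp add: eventually_at_right_less)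
  have "\<forall>\<^sub>F \<eta> in at_right 0. \<forall>k\<in>UNIV. L_two_norm \<Omega> (\<lambda>x. grad v x $ k *\<^sub>R R_grad R (\<psi> k) (cut_point R \<eta> x)) \<le> (n k + 1) * d"
    unfolding n_def by (rule eventually_ball_finite) (use small_gradient_along_cut[OF wt s(2) d s(4)] in auto)
  then have E3: "\<forall>\<^sub>F \<eta> in at_right 0. \<forall>k. L_two_norm \<Omega> (\<lambda>x. grad v x $ k *\<^sub>R R_grad R (\<psi> k) (cut_point R \<eta> x)) \<le> (n k + 1) * d"
    by simp
  have "((\<lambda>\<eta>. f (correction R \<phi> v \<eta>)) \<longlongrightarrow> 0) (at_right 0)"
    by (rule W12_dual_oscillation[OF \<Omega> f_dual test_function_correction[OF \<phi> v] C])
  then have E4: "\<forall>\<^sub>F \<eta> in at_right 0. \<bar>f (correction R \<phi> v \<eta>)\<bar> < \<tau> / 8"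
    using tendstoD[of _ 0 _ "\<tau> / 8"] \<tau> by fastforce
  have "((\<lambda>\<eta>. \<eta> * H) \<longlongrightarrow> 0 * H) (at_right 0)" by (intro tendsto_intros)
  from order_tendstoD(2)[OF this, of "\<tau> / 8"] have E5: "\<forall>\<^sub>F \<eta> in at_right 0. \<eta> * H < \<tau> / 8" using \<tau> by simp
  show "\<forall>\<^sub>F \<eta> in at_right 0. dist (L_two_inner \<Omega> (grad_u \<eta>) (\<lambda>x. transpose ?A *v grad v x)) (f v) < \<tau>"
    using E1 Pc E3 E4 E5
  proof eventually_elim
    case (elim \<eta>)
    note \<eta> = elim(1)
    have Sn: "L_two_norm \<Omega> (scaled_cut R \<eta> \<sigma>) \<le> m"
    proof -
      have PL: "L_two \<Omega> (\<lambda>x. P (cut_point R \<eta> x))"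
        by (intro L_two_continuous[OF \<Omega>] continuous_on_compose2[OF trig_matrix_continuous[OF P(1)] continuous_cut_point subset_UNIV])
      have "L_two_norm \<Omega> (\<lambda>x. P (cut_point R \<eta> x)) \<le> p * sqrt (measure lebesgue \<Omega>)"
        by (rule L_two_norm_le_bounded[OF bounded_open_lmeasurable[OF \<Omega>] L_two_measurable[OF PL] AE_I2[OF p(2)] p(1)])
      moreover have "L_two_norm \<Omega> (scaled_cut R \<eta> \<sigma>)
          \<le> L_two_norm \<Omega> (\<lambda>x. scaled_cut R \<eta> \<sigma> x - P (cut_point R \<eta> x)) + L_two_norm \<Omega> (\<lambda>x. P (cut_point R \<eta> x))"
        using L_two_norm_triangle[OF L_two_diff[OF cut_L_two[OF \<eta>] PL] PL] by simp
      ultimately show ?thesis using elim(2) by (simp add: m_def)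
    qed
    have "\<bar>L_two_inner \<Omega> (grad_u \<eta>) (\<lambda>x. transpose ?A *v grad v x) - f v\<bar>
      \<le> \<bar>f (correction R \<phi> v \<eta>)\<bar>
      + (\<Sum>k\<in>UNIV. K * (d * n k)
          + \<bar>L_two_inner \<Omega> (grad_u \<eta>) (\<lambda>x. grad v x $ k *\<^sub>R B k (cut_point R \<eta> x))\<bar>
          + K * L_two_norm \<Omega> (\<lambda>x. grad v x $ k *\<^sub>R R_grad R (\<psi> k) (cut_point R \<eta> x)))
      + K * (E * L_two_norm \<Omega> (\<lambda>x. scaled_cut R \<eta> \<sigma> x - P (cut_point R \<eta> x)))
      + \<eta> * (K * (r * L_two_norm \<Omega> (scaled_cut R \<eta> \<sigma>)))"
      unfolding n_def
      by (rule flux_error[OF \<eta> v \<phi> P(1) s(1,2,3,5) K(3)[OF \<eta>] E(1) E(2) r(1) r(2)])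
    also have "\<dots> \<le> \<tau> / 8 + (\<Sum>k\<in>UNIV. K * (2 * n k + 1) * d + \<eta> * (\<bar>D k\<bar> * (2 * K))) + K * (E * \<epsilon>) + \<eta> * (K * (r * m))"
    proof (rule add_mono[OF add_mono[OF add_mono]])
      show "\<bar>f (correction R \<phi> v \<eta>)\<bar> \<le> \<tau> / 8" using elim by simp
      show "K * (E * L_two_norm \<Omega> (\<lambda>x. scaled_cut R \<eta> \<sigma> x - P (cut_point R \<eta> x))) \<le> K * (E * \<epsilon>)"
        using K(1) E(1) elim(2) by (intro mult_left_mono) auto
      show "\<eta> * (K * (r * L_two_norm \<Omega> (scaled_cut R \<eta> \<sigma>))) \<le> \<eta> * (K * (r * m))"
        using \<eta> K(1) r(1) Sn by (intro mult_left_mono) auto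
    next
      show "(\<Sum>k\<in>UNIV. K * (d * n k)
          + \<bar>L_two_inner \<Omega> (grad_u \<eta>) (\<lambda>x. grad v x $ k *\<^sub>R B k (cut_point R \<eta> x))\<bar>
          + K * L_two_norm \<Omega> (\<lambda>x. grad v x $ k *\<^sub>R R_grad R (\<psi> k) (cut_point R \<eta> x)))
        \<le> (\<Sum>k\<in>UNIV. K * (2 * n k + 1) * d + \<eta> * (\<bar>D k\<bar> * (2 * K)))"
      proof (rule sum_mono)
        fix k :: 3
        have "\<bar>L_two_inner \<Omega> (grad_u \<eta>) (\<lambda>x. grad v x $ k *\<^sub>R B k (cut_point R \<eta> x))\<bar>
            \<le> D k * \<eta> * (L_two_norm \<Omega> (u \<eta>) + L_two_norm \<Omega> (grad_u \<eta>))"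
          by (rule D[OF \<eta> u_weak_grad[OF \<eta>]])
        also have "\<dots> \<le> (\<bar>D k\<bar> * \<eta>) * (K + K)"
          using \<eta> K(2,3)[OF \<eta>] by (intro mult_mono add_mono mult_right_mono) (auto simp: L_two_norm_nonneg)
        finally have 1: "\<bar>L_two_inner \<Omega> (grad_u \<eta>) (\<lambda>x. grad v x $ k *\<^sub>R B k (cut_point R \<eta> x))\<bar> \<le> \<eta> * (\<bar>D k\<bar> * (2 * K))"
          by (simp add: mult_ac)
        have 2: "K * L_two_norm \<Omega> (\<lambda>x. grad v x $ k *\<^sub>R R_grad R (\<psi> k) (cut_point R \<eta> x)) \<le> K * ((n k + 1) * d)"
          using K(1) elim(3) by (intro mult_left_mono) auto
        have 3: "K * (d * n k) + K * ((n k + 1) * d) = K * (2 * n k + 1) * d" by (simp add: algebra_simps)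
        show "K * (d * n k) + \<bar>L_two_inner \<Omega> (grad_u \<eta>) (\<lambda>x. grad v x $ k *\<^sub>R B k (cut_point R \<eta> x))\<bar>
            + K * L_two_norm \<Omega> (\<lambda>x. grad v x $ k *\<^sub>R R_grad R (\<psi> k) (cut_point R \<eta> x))
            \<le> K * (2 * n k + 1) * d + \<eta> * (\<bar>D k\<bar> * (2 * K))"
          using 1 2 3 by linarith
      qed
    qed
    also have "\<dots> = \<tau> / 8 + K * W * d + K * (E * \<epsilon>) + \<eta> * H"
      unfolding W_def H_def sum.distrib[of "\<lambda>k. K * (2 * n k + 1) * d"] sum_distrib_left sum_distrib_right distrib_left[of \<eta>]
      by (simp only: add_ac)
    also have "\<dots> < \<tau>" using dW \<epsilon>E elim(5) \<tau> by linarith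
    finally show ?case by (simp add: dist_real_def)
  qed
qed

theorem flux_converges:
  assumes v: "W12_0 \<Omega> v"
  shows "((\<lambda>\<eta>. L_two_inner \<Omega> (grad_u \<eta>) (\<lambda>x. transpose (homogenized \<sigma> g) *v weak_grad \<Omega> v x)) \<longlongrightarrow> f v) (at_right 0)"
proof (rule tendstoI)
  fix \<tau> :: real assume \<tau>: "\<tau> > 0"
  let ?A = "homogenized \<sigma> g"
  obtain K where K: "K > 0" "\<And>\<eta>. \<eta> > 0 \<Longrightarrow> L_two_norm \<Omega> (grad_u \<eta>) \<le> K"
    by (rule u_bounded) blast
  obtain C where C: "C > 0" "\<And>w. W12_0 \<Omega> w \<Longrightarrow> \<bar>f w\<bar> \<le> C * W12_norm \<Omega> w"
    using W12_dual_bound[OF \<Omega> f_dual] by blast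
  define L where "L = K * norm (transpose ?A) + C"
  have L: "L > 0" unfolding L_def using K(1) C(1) by (simp add: add_nonneg_pos)
  define d where "d = \<tau> / (2 * L)"
  have d: "d > 0" "d * L = \<tau> / 2" using \<tau> L by (auto simp: d_def)
  obtain z where z: "test_function \<Omega> z" "L_two_norm \<Omega> (\<lambda>x. weak_grad \<Omega> v x - grad z x) < d"
    "W12_norm \<Omega> (\<lambda>x. v x - z x) < d" using W12_0_approx[OF \<Omega> v d(1)] by metis
  have z0: "W12_0 \<Omega> z" by (rule W12_0_test[OF \<Omega> z(1)])
  note vL = W12_0_L_two(2)[OF v] and zL = L_two_test(2)[OF \<Omega> z(1)]
  have lim: "\<forall>\<^sub>F \<eta> in at_right 0. dist (L_two_inner \<Omega> (grad_u \<eta>) (\<lambda>x. transpose ?A *v grad z x)) (f z) < \<tau> / 2"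
    by (rule tendstoD[OF flux_converges_test[OF z(1)]]) (use \<tau> in simp)
  have E1: "\<forall>\<^sub>F \<eta> in at_right 0. (\<eta>::real) > 0" by (simp add: eventually_at_right_less)
  show "\<forall>\<^sub>F \<eta> in at_right 0. dist (L_two_inner \<Omega> (grad_u \<eta>) (\<lambda>x. transpose ?A *v weak_grad \<Omega> v x)) (f v) < \<tau>"
    using lim E1
  proof eventually_elim
    case (elim \<eta>)
    note uL = grad_u_L_two[OF elim(2)]
    have dL: "L_two \<Omega> (\<lambda>x. weak_grad \<Omega> v x - grad z x)" by (rule L_two_diff[OF vL zL])
    have "L_two_norm \<Omega> (\<lambda>x. transpose ?A *v (weak_grad \<Omega> v x - grad z x)) \<le> norm (transpose ?A) * d"
      by (rule order_trans[OF L_two_matrix(2)[OF dL]]) (use z(2) in \<open>auto intro!: mult_left_mono\<close>)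
    then have 1: "\<bar>L_two_inner \<Omega> (grad_u \<eta>) (\<lambda>x. transpose ?A *v (weak_grad \<Omega> v x - grad z x))\<bar> \<le> K * (norm (transpose ?A) * d)"
      using K(1) by (intro order_trans[OF L_two_inner_le[OF uL L_two_matrix(1)[OF dL]]] mult_mono K(2)[OF elim(2)])
        (auto simp: L_two_norm_nonneg)
    have 2: "\<bar>f (\<lambda>x. v x - z x)\<bar> \<le> C * d"
      by (rule order_trans[OF C(2)[OF W12_0_diff[OF \<Omega> v z0]]]) (use z(3) C(1) in \<open>auto intro!: mult_left_mono\<close>)
    have "L_two_inner \<Omega> (grad_u \<eta>) (\<lambda>x. transpose ?A *v (weak_grad \<Omega> v x - grad z x))
        = L_two_inner \<Omega> (grad_u \<eta>) (\<lambda>x. transpose ?A *v weak_grad \<Omega> v x) - L_two_inner \<Omega> (grad_u \<eta>) (\<lambda>x. transpose ?A *v grad z x)"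
      unfolding matrix_vector_mult_diff_distrib
      by (rule L_two_inner_diff_right[OF L_two_matrix(1)[OF vL] L_two_matrix(1)[OF zL] uL])
    moreover have "f (\<lambda>x. v x - z x) = f v - f z" by (rule W12_dual_diff[OF \<Omega> f_dual v z0])
    moreover have "K * (norm (transpose ?A) * d) + C * d = \<tau> / 2" using d(2) by (simp add: L_def algebra_simps)
    ultimately show ?case using 1 2 elim(1) unfolding dist_real_def by linarith
  qed
qed

text \<open>To evaluate a functional \<open>F\<close> on \<open>u \<eta>\<close>, represent it by the solution \<open>z\<close> of the adjoint homogenized problem with
  right-hand side \<open>F\<close>; then \<open>F (u \<eta>)\<close> is exactly the quantity whose limit \<open>f z\<close> is known.\<close>

theorem homogenization:
  "\<exists>u0. dirichlet_solution \<Omega> (\<lambda>_. homogenized \<sigma> g) f u0 \<and>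
     (\<forall>v. dirichlet_solution \<Omega> (\<lambda>_. homogenized \<sigma> g) f v \<longrightarrow> (AE x in lebesgue_on \<Omega>. v x = u0 x)) \<and>
     weakly_converges_W12_0 \<Omega> u u0 (at_right 0)"
proof -
  let ?A = "homogenized \<sigma> g"
  obtain u0 where u0: "dirichlet_solution \<Omega> (\<lambda>_. ?A) f u0"
    by (rule dirichlet_solution_exists[OF \<Omega> c_pos homogenized_coercive f_dual])
  have u0W: "W12_0 \<Omega> u0" and u0_eq: "\<And>v. W12_0 \<Omega> v \<Longrightarrow> L_two_inner \<Omega> (\<lambda>x. ?A *v weak_grad \<Omega> u0 x) (weak_grad \<Omega> v) = f v"
    using u0 by (auto simp: dirichlet_solution_def L_two_inner_def)
  have unique: "AE x in lebesgue_on \<Omega>. v x = u0 x" if v: "dirichlet_solution \<Omega> (\<lambda>_. ?A) f v" for v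
  proof -
    have vW: "W12_0 \<Omega> v" and v_eq: "\<And>w. W12_0 \<Omega> w \<Longrightarrow> L_two_inner \<Omega> (\<lambda>x. ?A *v weak_grad \<Omega> v x) (weak_grad \<Omega> w) = f w"
      using v by (auto simp: dirichlet_solution_def L_two_inner_def)
    define w where "w = (\<lambda>x. v x - u0 x)"
    have w0: "W12_0 \<Omega> w" unfolding w_def by (rule W12_0_diff[OF \<Omega> vW u0W])
    let ?G = "\<lambda>x. weak_grad \<Omega> v x - weak_grad \<Omega> u0 x"
    have wg: "has_weak_grad \<Omega> w ?G" unfolding w_def
      by (intro has_weak_grad_diff[OF \<Omega>] has_weak_grad_weak_grad W12_0_imp_W12 vW u0W)
    note vL = W12_0_L_two(2)[OF vW] and u0L = W12_0_L_two(2)[OF u0W] and wL = W12_0_L_two(2)[OF w0]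
    have GL: "L_two \<Omega> ?G" by (rule L_two_diff[OF vL u0L])
    have "0 = L_two_inner \<Omega> (\<lambda>x. ?A *v ?G x) (weak_grad \<Omega> w)"
      unfolding matrix_vector_mult_diff_distrib
        L_two_inner_diff_left[OF L_two_matrix(1)[OF vL] L_two_matrix(1)[OF u0L] wL] v_eq[OF w0] u0_eq[OF w0] by simp
    also have "\<dots> = L_two_inner \<Omega> (\<lambda>x. ?A *v ?G x) ?G"
      by (rule weak_grad_inner_eq(1)[OF \<Omega> wg L_two_matrix(1)[OF GL]])
    also have "\<dots> \<ge> (LINT x|lebesgue_on \<Omega>. c * (norm (?G x))\<^sup>2)"
      unfolding L_two_inner_def using GL L_two_integrable_inner[OF L_two_matrix(1)[OF GL] GL] homogenized_coercive
      by (intro integral_mono) (auto simp: L_two_def)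
    finally have "c * (L_two_norm \<Omega> ?G)\<^sup>2 \<le> 0"
      by (simp add: L_two_norm_power2 L_two_inner_def power2_norm_eq_inner)
    then have "(L_two_norm \<Omega> ?G)\<^sup>2 \<le> 0" using c_pos by (simp add: mult_le_0_iff)
    then have "L_two_norm \<Omega> ?G = 0" by simp
    then have z: "L_two_norm \<Omega> (weak_grad \<Omega> w) = 0" by (simp add: weak_grad_norm_eq[OF \<Omega> wg])
    obtain Q where "\<And>u. W12_0 \<Omega> u \<Longrightarrow> L_two_norm \<Omega> u \<le> Q * L_two_norm \<Omega> (weak_grad \<Omega> u)"
      by (rule W12_norm_le_grad[OF \<Omega>]) blast
    from this[OF w0] have "L_two_norm \<Omega> w = 0" using z L_two_norm_nonneg[of \<Omega> w] by simp
    then have "AE x in lebesgue_on \<Omega>. w x = 0" by (rule L_two_norm_zero_AE[OF W12_0_L_two(1)[OF w0]])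
    then show ?thesis by eventually_elim (simp add: w_def)
  qed
  have "weakly_converges_W12_0 \<Omega> u u0 (at_right 0)"
    unfolding weakly_converges_W12_0_def
  proof (intro conjI allI impI u0W)
    have E1: "\<forall>\<^sub>F \<eta> in at_right 0. (\<eta>::real) > 0" by (simp add: eventually_at_right_less)
    then show "\<forall>\<^sub>F \<eta> in at_right 0. W12_0 \<Omega> (u \<eta>)" by eventually_elim (rule u_W12_0)
    fix F assume F: "W12_dual \<Omega> F"
    have co: "c * (norm \<xi>)\<^sup>2 \<le> (transpose ?A *v \<xi>) \<bullet> \<xi>" for \<xi>
      using homogenized_coercive[of \<xi>] unfolding inner_matrix_transpose[of ?A] by (subst inner_commute)
    obtain z where z: "dirichlet_solution \<Omega> (\<lambda>_. transpose ?A) F z"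
      by (rule dirichlet_solution_exists[OF \<Omega> c_pos co F])
    have zW: "W12_0 \<Omega> z" and z_eq: "\<And>v. W12_0 \<Omega> v \<Longrightarrow> L_two_inner \<Omega> (weak_grad \<Omega> v) (\<lambda>x. transpose ?A *v weak_grad \<Omega> z x) = F v"
      using z by (auto simp: dirichlet_solution_def L_two_inner_def inner_commute)
    have "((\<lambda>\<eta>. L_two_inner \<Omega> (grad_u \<eta>) (\<lambda>x. transpose ?A *v weak_grad \<Omega> z x)) \<longlongrightarrow> f z) (at_right 0)"
      by (rule flux_converges[OF zW])
    moreover have "f z = F u0"
      unfolding u0_eq[OF zW, symmetric] z_eq[OF u0W, symmetric] L_two_inner_def inner_matrix_transpose ..
    ultimately have "((\<lambda>\<eta>. L_two_inner \<Omega> (grad_u \<eta>) (\<lambda>x. transpose ?A *v weak_grad \<Omega> z x)) \<longlongrightarrow> F u0) (at_right 0)" by simp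
    then show "((\<lambda>\<eta>. F (u \<eta>)) \<longlongrightarrow> F u0) (at_right 0)"
      by (rule Lim_transform_eventually) (rule eventually_mono[OF E1], rule z_eq[OF u_W12_0])
  qed
  with u0 unique show ?thesis by blast
qed

end

theorem theorem1:
  fixes \<Omega> :: "(real^3) set"
    and R :: "real^3^'m"
    and \<sigma> :: "real^'m \<Rightarrow> real^3^3"
    and c :: real
    and f :: "(real^3 \<Rightarrow> real) \<Rightarrow> real"
    and u :: "real \<Rightarrow> real^3 \<Rightarrow> real"
    and g :: "3 \<Rightarrow> real^'m \<Rightarrow> real^3"
  assumes "bounded_lipschitz_domain \<Omega>"
    and "CARD('m) > 3"
    and "\<And>k. k \<noteq> 0 \<Longrightarrow> transpose R *v int_vec k \<noteq> 0"
    and "periodic \<sigma>"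
    and "L_inf UNIV \<sigma>"
    and "\<And>\<eta>. \<eta> > 0 \<Longrightarrow> L_inf \<Omega> (scaled_cut R \<eta> \<sigma>)"
    and "admissible_cut R \<Omega> \<sigma>"
    and "c > 0"
    and "coercive_on UNIV c \<sigma>"
    and "\<And>\<eta>. \<eta> > 0 \<Longrightarrow> coercive_on \<Omega> c (scaled_cut R \<eta> \<sigma>)"
    and "W12_dual \<Omega> f"
    and "\<And>\<eta>. \<eta> > 0 \<Longrightarrow> dirichlet_solution \<Omega> (scaled_cut R \<eta> \<sigma>) f (u \<eta>)"
    and "\<And>k. local_solution R \<sigma> k (g k)"
  shows "\<exists>u0. dirichlet_solution \<Omega> (\<lambda>_. homogenized \<sigma> g) f u0 \<and>
           (\<forall>v. dirichlet_solution \<Omega> (\<lambda>_. homogenized \<sigma> g) f v \<longrightarrow>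
                (AE x in lebesgue_on \<Omega>. v x = u0 x)) \<and>
           weakly_converges_W12_0 \<Omega> u u0 (at_right 0)"
proof -
  have \<Omega>: "open \<Omega>" "bounded \<Omega>" using assms(1) by (auto simp: bounded_lipschitz_domain_def)
  obtain M where m: "\<sigma> \<in> borel_measurable lebesgue" and M: "AE y in lebesgue. norm (\<sigma> y) \<le> M"
    using assms(5) unfolding L_inf_def lebesgue_on_UNIV_eq by blast
  have AE_cell: "AE y in lebesgue_on unit_cell. Q y" if "AE y in lebesgue. Q y" for Q :: "real^'m \<Rightarrow> bool"
  proof (subst AE_restrict_space_iff)
    show "unit_cell \<inter> space lebesgue \<in> sets (lebesgue :: (real^'m) measure)" by (simp add: unit_cell_sets)
    show "AE y in lebesgue. y \<in> unit_cell \<longrightarrow> Q y" using that by eventually_elim simp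
  qed
  have \<sigma>m: "\<sigma> \<in> borel_measurable (lebesgue_on unit_cell)" using m by (rule measurable_restrict_space1)
  have \<sigma>L: "L_two unit_cell \<sigma>"
    by (rule L_two_bounded[OF bounded_open_lmeasurable[OF unit_cell_open unit_cell_bounded] \<sigma>m AE_cell[OF M]])
  have coer: "coercive_on unit_cell c \<sigma>"
    using AE_cell assms(9) unfolding coercive_on_def lebesgue_on_UNIV_eq by blast
  have approx: "\<exists>P. trig_matrix P \<and> L_two_norm unit_cell (\<lambda>y. \<sigma> y - P y) < e" if "e > 0" for e
    by (rule admissible_cut_trig_approx[OF \<Omega> assms(7) \<sigma>L L_inf_L_two[OF \<Omega> assms(6)] that]) blast+
  interpret homogenization_domain R \<sigma> c M g \<Omega> f u
    using assms(3) \<sigma>m AE_cell[OF M] coer assms(8) approx assms(13) \<Omega> assms(6,7,10,11,12)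
    by unfold_locales (simp_all only: freq_def not_False_eq_True)
  show ?thesis by (rule homogenization)
qed

end
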